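(* Let $t\in(0,1/4]$, $\eta\in[0,1)$, $\gamma=(1-\eta)/t$. Let $U\in\mathcal C^2(\mathbb R^d)$ be such that $\pi\propto e^{-U}$ is a probability measure, $|\nabla^2U(x)|\leqslant1$ for all $x\in\mathbb R^d$, and, for some $L_H>0$, $\|\nabla^2U(x)-\nabla^2U(x')\|_F\leqslant L_H|x-x'|$ for all $x,x'\in\mathbb R^d$. Let $\mu=\pi\otimes\mathcal N(0,I_d)$ and $\mathcal Q=\mathcal D_\eta\mathcal H_t\mathcal D_\eta$. Then for all $\nu\in\mathcal P(\mathbb R^{2d})$, $$\mathrm{Ent}(\nu\mathcal Q|\mu)\leqslant c_1(\eta,t)\,\mathcal W_2^2(\nu,\mu),$$ where $$c_1(\eta,t)=\max(1,\eta^2t^2)\left(\frac{13}{2t^2(1-\eta^2)}+5L_H^2t^4\right).$$ If, moreover, $\eta>0$ and $t\leqslant1/8$, then for all $\nu\in\mathcal P(\mathbb R^{2d})$ and all integers $n\geqslant2$, $$\mathrm{Ent}(\nu\mathcal Q^n|\mu)\leqslant c_n(\eta,t)\,\mathcal W_2^2(\nu,\mu)$$ with $c_n(\eta,t)=c_*\big(t\min(n,\lfloor1/(4t)\rfloor)\big)$ where, for all $s>0$, $$c_*(s)=\max(1,\eta^2s^2)\left(\frac{s}{\gamma}\left(\frac{12}{\eta s^2}+\frac{6\gamma}{\eta s}+4\right)^2+132\,e^{4s/3}(L_Hs)^2\right).$$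
   Context: $|A|$ is the operator norm and $\|A\|_F$ the Frobenius norm of a matrix. $\mathcal P(\mathbb R^{2d})$ is the set of probability measures on $\mathbb R^{2d}$, whose points are written $z=(x,v)$. Hamiltonian flow: $\Phi_s(x,v)=(x_s,v_s)$ solves $\dot x_s=v_s$, $\dot v_s=-\nabla U(x_s)$, $(x_0,v_0)=(x,v)$. Markov operators: $\mathcal H_tf(z)=f(\Phi_t(z))$ and $\mathcal D_\eta f(x,v)=\mathbb E\big(f(x,\eta v+\sqrt{1-\eta^2}G)\big)$ with $G\sim\mathcal N(0,I_d)$; $\mathcal Q$ is their composition, and $\nu\mathcal Q$ is defined by $\int f\,\mathrm d(\nu\mathcal Q)=\int\mathcal Qf\,\mathrm d\nu$. $\mathrm{Ent}(\nu|\mu)=\int\ln(\mathrm d\nu/\mathrm d\mu)\,\mathrm d\nu$ if $\nu\ll\mu$, $+\infty$ otherwise. $\mathcal W_2^2(\nu,\mu)=\inf_r\int|z-z'|^2r(\mathrm dz,\mathrm dz')$, the infimum running over all couplings $r$ of $\nu$ and $\mu$ (Euclidean norm on $\mathbb R^{2d}$). *)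

theory Defs
  imports "HOL-Probability.Probability"
begin

text \<open>
  Phase space is the product type \<open>(real ^ 'd) \<times> (real ^ 'd)\<close>; its library norm is the
  Euclidean norm of \<open>\<real>\<^sup>2\<^sup>d\<close>.
\<close>

definition gradient :: "('a::real_inner \<Rightarrow> real) \<Rightarrow> 'a \<Rightarrow> 'a" where
  "gradient f x = (THE D. GDERIV f x :> D)"

definition hessian :: "(real ^ 'd \<Rightarrow> real) \<Rightarrow> real ^ 'd \<Rightarrow> real ^ 'd ^ 'd" where
  "hessian f x = jacobian (gradient f) (at x)"

definition C2 :: "(real ^ 'd \<Rightarrow> real) \<Rightarrow> bool" where
  "C2 f \<longleftrightarrow> (\<forall>x. f differentiable (at x)) \<and> (\<forall>x. gradient f differentiable (at x)) \<and>
     continuous_on UNIV (hessian f)"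

definition operator_norm :: "real ^ 'n ^ 'm \<Rightarrow> real" where
  "operator_norm A = onorm (\<lambda>h. A *v h)"

definition frobenius_norm :: "real ^ 'n ^ 'm \<Rightarrow> real" where
  "frobenius_norm A = sqrt (\<Sum>i\<in>UNIV. \<Sum>j\<in>UNIV. (A $ i $ j)\<^sup>2)"

text \<open>
  If \<open>exp (- U)\<close> is not integrable, its Bochner integral is \<open>0\<close> and \<open>gibbs U\<close> is the null
  measure. Hence \<open>prob_space (gibbs U)\<close> holds exactly when \<open>exp (- U)\<close> can be normalised.
\<close>

definition gibbs :: "('a::euclidean_space \<Rightarrow> real) \<Rightarrow> 'a measure" where
  "gibbs U = density lborel (\<lambda>x. ennreal (exp (- U x) / (\<integral>y. exp (- U y) \<partial>lborel)))"

definition std_gaussian :: "(real ^ 'd) measure" where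
  "std_gaussian = density lborel (\<lambda>x. ennreal (\<Prod>i\<in>UNIV. std_normal_density (x $ i)))"

definition hamiltonian_trajectory ::
  "('a::real_inner \<Rightarrow> real) \<Rightarrow> 'a \<times> 'a \<Rightarrow> (real \<Rightarrow> 'a \<times> 'a) \<Rightarrow> bool" where
  "hamiltonian_trajectory U z c \<longleftrightarrow> c 0 = z \<and>
     (\<forall>s. ((\<lambda>r. fst (c r)) has_vector_derivative snd (c s)) (at s) \<and>
          ((\<lambda>r. snd (c r)) has_vector_derivative - gradient U (fst (c s))) (at s))"

text \<open>The trajectory exists and is unique as soon as \<open>gradient U\<close> is Lipschitz.\<close>

definition hamiltonian_flow ::
  "('a::real_inner \<Rightarrow> real) \<Rightarrow> real \<Rightarrow> 'a \<times> 'a \<Rightarrow> 'a \<times> 'a" where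
  "hamiltonian_flow U s z = (THE c. hamiltonian_trajectory U z c) s"

definition flow_op ::
  "('a::real_inner \<Rightarrow> real) \<Rightarrow> real \<Rightarrow> ('a \<times> 'a \<Rightarrow> real) \<Rightarrow> 'a \<times> 'a \<Rightarrow> real" where
  "flow_op U t f z = f (hamiltonian_flow U t z)"

definition refresh_op ::
  "real \<Rightarrow> ((real ^ 'd) \<times> (real ^ 'd) \<Rightarrow> real) \<Rightarrow> (real ^ 'd) \<times> (real ^ 'd) \<Rightarrow> real" where
  "refresh_op \<eta> f = (\<lambda>(x, v). \<integral>g. f (x, \<eta> *\<^sub>R v + sqrt (1 - \<eta>\<^sup>2) *\<^sub>R g) \<partial>std_gaussian)"

definition hmc_op ::
  "(real ^ 'd \<Rightarrow> real) \<Rightarrow> real \<Rightarrow> real \<Rightarrow>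
   ((real ^ 'd) \<times> (real ^ 'd) \<Rightarrow> real) \<Rightarrow> (real ^ 'd) \<times> (real ^ 'd) \<Rightarrow> real" where
  "hmc_op U \<eta> t = refresh_op \<eta> \<circ> flow_op U t \<circ> refresh_op \<eta>"

text \<open>
  The measure \<open>\<nu>K\<close> of a Markov operator \<open>K\<close>, determined by
  \<open>\<integral>f d(\<nu>K) = \<integral>Kf d\<nu>\<close> for all bounded Borel functions \<open>f\<close>.
\<close>

definition markov_act ::
  "'z::topological_space measure \<Rightarrow> (('z \<Rightarrow> real) \<Rightarrow> 'z \<Rightarrow> real) \<Rightarrow> 'z measure" where
  "markov_act \<nu> K = (THE \<rho>. prob_space \<rho> \<and> sets \<rho> = sets borel \<and>
     (\<forall>f \<in> borel_measurable borel. bounded (range f) \<longrightarrow>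
        (\<integral>z. f z \<partial>\<rho>) = (\<integral>z. K f z \<partial>\<nu>)))"

text \<open>
  Library conventions: \<open>absolutely_continuous \<mu> \<nu>\<close> means \<open>\<nu> \<lless> \<mu>\<close>, and
  \<open>KL_divergence (exp 1) \<mu> \<nu>\<close> is the \<open>\<nu>\<close>-integral of \<open>ln (d\<nu>/d\<mu>)\<close>. The negative part of
  \<open>ln (d\<nu>/d\<mu>)\<close> is always \<open>\<nu>\<close>-integrable for probability measures, so failure of integrability
  means that the integral is \<open>\<infinity>\<close>, whereas \<open>KL_divergence\<close> would then be \<open>0\<close>.
\<close>

definition Ent :: "'z measure \<Rightarrow> 'z measure \<Rightarrow> ereal" where
  "Ent \<nu> \<mu> =
     (if absolutely_continuous \<mu> \<nu> \<and> integrable \<nu> (entropy_density (exp 1) \<mu> \<nu>)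
      then ereal (KL_divergence (exp 1) \<mu> \<nu>) else \<infinity>)"

definition couplings :: "'z measure \<Rightarrow> 'z measure \<Rightarrow> ('z \<times> 'z) measure set" where
  "couplings \<nu> \<mu> = {r. sets r = sets (\<nu> \<Otimes>\<^sub>M \<mu>) \<and> distr r \<nu> fst = \<nu> \<and> distr r \<mu> snd = \<mu>}"

definition W2_sq :: "'z::real_normed_vector measure \<Rightarrow> 'z measure \<Rightarrow> ennreal" where
  "W2_sq \<nu> \<mu> = (INF r\<in>couplings \<nu> \<mu>. \<integral>\<^sup>+p. ennreal ((norm (fst p - snd p))\<^sup>2) \<partial>r)"

definition c_one :: "real \<Rightarrow> real \<Rightarrow> real \<Rightarrow> real" where
  "c_one L \<eta> t = max 1 (\<eta>\<^sup>2 * t\<^sup>2) * (13 / (2 * t\<^sup>2 * (1 - \<eta>\<^sup>2)) + 5 * L\<^sup>2 * t ^ 4)"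

definition c_star :: "real \<Rightarrow> real \<Rightarrow> real \<Rightarrow> real \<Rightarrow> real" where
  "c_star L \<eta> \<gamma> s = max 1 (\<eta>\<^sup>2 * s\<^sup>2) *
     (s / \<gamma> * (12 / (\<eta> * s\<^sup>2) + 6 * \<gamma> / (\<eta> * s) + 4)\<^sup>2 + 132 * exp (4 * s / 3) * (L * s)\<^sup>2)"

definition c_n :: "real \<Rightarrow> real \<Rightarrow> real \<Rightarrow> nat \<Rightarrow> real" where
  "c_n L \<eta> t n = c_star L \<eta> ((1 - \<eta>) / t) (t * of_int (min (int n) \<lfloor>1 / (4 * t)\<rfloor>))"

end

theory Submission
  imports Defs
begin

text \<open>
  Everything is reduced to pointwise log-Harnack inequalities
  \<open>(Q ^^ n) f z \<le> ln ((Q ^^ n) (exp \<circ> f) z') + c * (norm (z - z'))\<^sup>2\<close> for bounded Borel functions \<open>f\<close>: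
  integrated along a coupling of \<open>\<nu>\<close> and \<open>\<mu>\<close>, and combined with the invariance of \<open>\<mu>\<close>, such an
  inequality bounds the Donsker--Varadhan functional, hence the entropy.

  For one step, the Gaussian refreshment started from \<open>z'\<close> is transported by a diffeomorphism so that
  after the Hamiltonian flow both positions agree exactly, and the second refreshment absorbs the
  difference of the velocities. The cost of the transport is a squared displacement plus the squared
  Frobenius norm of its Jacobian, which is where \<open>L\<^sub>H\<close> enters. In the first \<open>n - 1\<close> of \<open>n\<close> steps,
  the Gaussian is merely translated, by predictable amounts that drive the difference of the positions
  to 0 along a cubic Hermite path; only the last step has to match exactly. Liouville's theorem, needed for the
  invariance, is obtained from the volume-preserving leapfrog steps rather than from a determinant.
\<close>

section \<open>Change of variables and matrix norms\<close>

text \<open>Two mechanisms keep the constants small. First, a map \<open>x + u x\<close> close to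
  the identity changes the logarithm of the Gaussian density by a term linear in \<open>u\<close>
  and the logarithm of the determinant by the trace of the Jacobian; these first-order terms cancel
  on average, and what remains is quadratic and bounded by a Frobenius norm, without the dimension.
  Second, a translation of the Gaussian that is fixed before the noise is drawn has trivial Jacobian
  and costs only half its squared length. It cannot hit a target exactly, because the flow is
  nonlinear in the momentum, but it misses by order \<open>t\<^sup>2\<close>, and the next step can
  correct that. So the Jacobian is paid for once, in the last step. Along a path of duration
  \<open>s\<close> the translations are of order \<open>t / s\<^sup>2\<close>, up to friction terms
  and the noise level \<open>sqrt (1 - \<eta>\<^sup>2)\<close>; the sum of \<open>s / t\<close>
  squares is then of order \<open>1 / (\<gamma> * s ^ 3)\<close>, which is, up to powers of \<eta>,
  the leading part of \<open>c_star\<close>.\<close>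

lemma integral_change_of_variables_le:
  fixes h :: "real^'m::{finite,wellorder} \<Rightarrow> real" and F :: "real^'m::_ \<Rightarrow> real^'m::_"
  assumes h: "integrable lborel h" "\<And>x. 0 \<le> h x"
    and F: "\<And>x. (F has_derivative F' x) (at x)" "inj F"
  shows "integrable lebesgue (\<lambda>x. \<bar>det (matrix (F' x))\<bar> * h (F x))"
    and "(\<integral>x. \<bar>det (matrix (F' x))\<bar> * h (F x) \<partial>lebesgue) \<le> integral\<^sup>L lborel h"
proof -
  let ?h = "\<lambda>x. vec (h x) :: real^1"
  have contF: "continuous_on UNIV F"
    using F(1) by (meson continuous_at_imp_continuous_on has_derivative_continuous)
  \<comment> \<open>Invariance of domain yields measurability of the range even where the
    determinant of \<open>F'\<close> vanishes.\<close>
  have op: "open (range F)"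
    using invariance_of_domain[OF contF open_UNIV] F(2) by simp
  have hl: "integrable lebesgue h"
    using h(1) by (metis borel_measurable_integrable integrable_completion measurable_lborel1 measurable_lborel2)
  have hl': "h absolutely_integrable_on UNIV"
    using hl by (simp add: set_integrable_def)
  have im: "h absolutely_integrable_on (range F)"
    by (rule set_integrable_subset[OF hl']) (use op in auto)
  have "(\<lambda>x. \<bar>det (matrix (F' x))\<bar> *\<^sub>R ?h (F x)) absolutely_integrable_on UNIV \<and>
    integral UNIV (\<lambda>x. \<bar>det (matrix (F' x))\<bar> *\<^sub>R ?h (F x)) = vec (integral (range F) h)"
    using has_absolute_integral_change_of_variables[of UNIV F F' ?h "vec (integral (range F) h)"]
      F im by (auto simp: absolutely_integrable_on_1_iff integral_on_1_eq)
  then have 2: "(\<lambda>x. \<bar>det (matrix (F' x))\<bar> * h (F x)) absolutely_integrable_on UNIV"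
    and 3: "integral UNIV (\<lambda>x. \<bar>det (matrix (F' x))\<bar> * h (F x)) = integral (range F) h"
    by (auto simp: absolutely_integrable_on_1_iff integral_on_1_eq)
  then show int: "integrable lebesgue (\<lambda>x. \<bar>det (matrix (F' x))\<bar> * h (F x))"
    by (simp add: set_integrable_def)
  have "(\<integral>x. \<bar>det (matrix (F' x))\<bar> * h (F x) \<partial>lebesgue) = integral (range F) h"
    using int 3 by (simp flip: integral_lebesgue)
  \<comment> \<open>\<open>F\<close> need not be onto; the mass outside its range is dropped, which
    is why the result is an inequality.\<close>
  also have "\<dots> \<le> integral UNIV h"
    using im hl' h(2) by (intro integral_subset_le) (auto simp: absolutely_integrable_on_def)
  also have "\<dots> = integral\<^sup>L lborel h"
    using h(1) by (simp add: integral_lborel)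
  finally show "(\<integral>x. \<bar>det (matrix (F' x))\<bar> * h (F x) \<partial>lebesgue) \<le> integral\<^sup>L lborel h" .
qed

lemma matrix_inner_sum: "(A::real^'n^'m) \<bullet> B = (\<Sum>i\<in>UNIV. \<Sum>j\<in>UNIV. A $ i $ j * B $ i $ j)"
  by (simp add: inner_vec_def)

text \<open>Since a matrix is a vector of rows, the library norm on matrices is the Frobenius norm.
  Operator bounds are expressed instead through \<open>norm (A *v h)\<close>.\<close>

lemma norm_matrix_square: "(norm (A::real^'n^'m))\<^sup>2 = (\<Sum>i\<in>UNIV. \<Sum>j\<in>UNIV. (A $ i $ j)\<^sup>2)"
  unfolding power2_norm_eq_inner matrix_inner_sum by (simp add: power2_eq_square)

lemma norm_transpose_matrix: "norm (transpose (A::real^'n^'m)) = norm A"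
proof -
  have "(norm (transpose A))\<^sup>2 = (norm A)\<^sup>2"
    unfolding norm_matrix_square by (subst sum.swap) (simp add: transpose_def)
  then show ?thesis by simp
qed

lemma norm_matrix_columns: "(norm (A::real^'n^'m))\<^sup>2 = (\<Sum>j\<in>UNIV. (norm (column j A))\<^sup>2)"
  unfolding norm_matrix_square
  by (subst sum.swap) (simp add: norm_vec_def L2_set_def sum_nonneg column_def)

lemma column_matrix_mult: "column j (A ** B) = A *v column j (B::real^'n^'k)" for A :: "real^'k^'m"
  by (simp add: column_def matrix_matrix_mult_def matrix_vector_mult_def vec_eq_iff)

text \<open>The operator bound acts on each column of \<open>B\<close>, and squared Frobenius norms
  add over columns.\<close>

lemma norm_matrix_mult_left_le:
  fixes A :: "real^'k^'m" and B :: "real^'n^'k"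
  assumes "\<And>h. norm (A *v h) \<le> b * norm h" "0 \<le> b"
  shows "norm (A ** B) \<le> b * norm B"
proof -
  have "(norm (A ** B))\<^sup>2 \<le> (\<Sum>j\<in>UNIV. (b * norm (column j B))\<^sup>2)"
    unfolding norm_matrix_columns column_matrix_mult
    by (intro sum_mono power_mono assms) auto
  also have "\<dots> = (b * norm B)\<^sup>2"
    by (simp add: norm_matrix_columns power_mult_distrib sum_distrib_left)
  finally show ?thesis using assms(2) by (simp add: power2_le_iff_abs_le)
qed

text \<open>Pairing \<open>transpose B *v r\<close> with itself moves \<open>B\<close> to the other
  side, so the adjoint inherits the bound; multiplication on the right is then reduced to
  multiplication on the left by transposing.\<close>

lemma norm_transpose_mult_le:
  fixes B :: "real^'n^'m"
  assumes "\<And>h. norm (B *v h) \<le> b * norm h" "0 \<le> b"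
  shows "norm (transpose B *v r) \<le> b * norm r"
proof -
  let ?x = "transpose B *v r"
  have "norm ?x * norm ?x = r \<bullet> (B *v ?x)"
    by (metis dot_lmul_matrix norm_eq_sqrt_inner power2_eq_square power2_norm_eq_inner transpose_matrix_vector vector_transpose_matrix inner_commute)
  also have "\<dots> \<le> norm r * (b * norm ?x)"
    by (meson assms(1) mult_left_mono norm_cauchy_schwarz norm_ge_zero order_trans)
  finally show ?thesis
    by (cases "norm ?x = 0") (use assms in \<open>auto simp: mult_ac zero_le_mult_iff\<close>)
qed

lemma norm_matrix_mult_right_le:
  fixes A :: "real^'k^'m" and B :: "real^'n^'k"
  assumes "\<And>h. norm (B *v h) \<le> b * norm h" "0 \<le> b"
  shows "norm (A ** B) \<le> b * norm A"
  using norm_matrix_mult_left_le[OF norm_transpose_mult_le[OF assms] assms(2), of "transpose A"]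
  by (metis matrix_transpose_mul norm_transpose_matrix)

lemma trace_mult_le: "trace (A ** B) \<le> norm A * norm (B :: real^'n^'m)" for A :: "real^'m^'n"
proof -
  have "trace (A ** B) = transpose A \<bullet> B"
    unfolding matrix_inner_sum trace_def matrix_matrix_mult_def
    by (subst sum.swap) (simp add: transpose_def)
  also have "\<dots> \<le> norm (transpose A) * norm B" by (rule norm_cauchy_schwarz)
  finally show ?thesis by (simp add: norm_transpose_matrix)
qed

text \<open>Fubini for products of one-variable functions. Lebesgue measure on
  \<open>real^'d\<close> is the image of a product over \<open>Basis\<close>, so indices have to be
  translated into basis vectors.\<close>

lemma lborel_prod_integral:
  fixes f :: "'d::finite \<Rightarrow> real \<Rightarrow> real"
  assumes "\<And>i. integrable lborel (f i)"
  shows "has_bochner_integral lborel (\<lambda>x::real^'d. \<Prod>i\<in>UNIV. f i (x $ i)) (\<Prod>i\<in>UNIV. integral\<^sup>L lborel (f i))"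
proof -
  let ?B = "Basis :: (real^'d) set"
  let ?a = "\<lambda>i::'d. axis i (1::real)"
  \<comment> \<open>The index is recovered from its basis vector; \<open>axis i 1\<close> is
    injective in \<open>i\<close>, so the choice is forced.\<close>
  define g where "g b = f (SOME i. b = ?a i)" for b
  have g: "g (?a i) = f i" for i
    unfolding g_def by (rule arg_cong[where f=f]) (rule some_equality, auto simp: axis_eq_axis)
  have img: "?B = ?a ` UNIV" by (auto simp: Basis_vec_def)
  have inj: "inj ?a" by (auto intro!: injI simp: axis_eq_axis)
  have prod: "(\<Prod>b\<in>?B. h b) = (\<Prod>i\<in>UNIV. h (?a i))" for h :: "_ \<Rightarrow> real"
    unfolding img by (subst prod.reindex[OF inj]) simp
  interpret product_sigma_finite "\<lambda>_::real^'d. lborel :: real measure" ..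
  have gi: "integrable lborel (g b)" if "b \<in> ?B" for b
    using that assms unfolding img by (auto simp: g)
  have comp: "(\<Sum>b\<in>?B. x b *\<^sub>R b) $ i = x (?a i)" for x i
    unfolding img sum.reindex[OF inj] by (simp add: axis_def if_distrib cong: if_cong)
  have eq: "(\<Prod>i\<in>UNIV. f i ((\<Sum>b\<in>?B. x b *\<^sub>R b) $ i)) = (\<Prod>b\<in>?B. g b (x b))" for x
    unfolding prod comp g ..
  have [measurable]: "f i \<in> borel_measurable borel" for i
    using borel_measurable_integrable[OF assms[of i]] by simp
  have m[measurable]: "(\<lambda>x::real^'d. \<Prod>i\<in>UNIV. f i (x $ i)) \<in> borel_measurable borel" by measurable
  have D: "(lborel :: (real^'d) measure) = distr (\<Pi>\<^sub>M b\<in>?B. lborel) borel (\<lambda>f. \<Sum>b\<in>?B. f b *\<^sub>R b)"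
    unfolding lborel_def[where 'a="real^'d"] by (simp add: lborel_eq_real cong: PiM_cong)
  have "has_bochner_integral (\<Pi>\<^sub>M b\<in>?B. lborel) (\<lambda>x. \<Prod>b\<in>?B. g b (x b)) (\<Prod>b\<in>?B. integral\<^sup>L lborel (g b))"
    using product_integrable_prod[OF finite_Basis gi] product_integral_prod[OF finite_Basis gi]
    by (simp add: has_bochner_integral_iff)
  then show ?thesis
    unfolding D by (subst has_bochner_integral_distr) (auto simp: comp prod g simp del: sum_component vector_scaleR_component)
qed

section \<open>Gaussian measures and determinants\<close>

definition gauss_density :: "real^'d \<Rightarrow> real" where
  "gauss_density x = (\<Prod>i\<in>UNIV. std_normal_density (x $ i))"

lemma std_gaussian_eq: "std_gaussian = density lborel (\<lambda>x. ennreal (gauss_density x))"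
  by (simp add: std_gaussian_def gauss_density_def)

lemma sets_std_gaussian[simp, measurable_cong]: "sets std_gaussian = sets borel"
  and space_std_gaussian[simp]: "space std_gaussian = UNIV"
  by (simp_all add: std_gaussian_def)

lemma gauss_density_measurable[measurable]: "gauss_density \<in> borel_measurable borel"
  unfolding gauss_density_def by measurable

lemma gauss_density_pos[simp]: "0 < gauss_density x"
  unfolding gauss_density_def by (auto intro!: prod_pos simp: normal_density_pos)

lemma gauss_density_nonneg[simp]: "0 \<le> gauss_density x"
  using gauss_density_pos less_imp_le by blast

lemma norm_vec_square: "(norm (x::real^'d))\<^sup>2 = (\<Sum>i\<in>UNIV. (x $ i)\<^sup>2)"
  by (simp add: norm_vec_def L2_set_def sum_nonneg)

lemma gauss_density_exp: "gauss_density (x::real^'d) = gauss_density (0::real^'d) * exp (- (norm x)\<^sup>2 / 2)"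
proof -
  have "gauss_density x = (\<Prod>i\<in>(UNIV::'d set). std_normal_density 0 * exp (- (x $ i)\<^sup>2 / 2))"
    unfolding gauss_density_def by (intro prod.cong) (auto simp: std_normal_density_def)
  also have "\<dots> = gauss_density (0::real^'d) * exp (\<Sum>i\<in>UNIV. - (x $ i)\<^sup>2 / 2)"
    by (simp add: prod.distrib exp_sum gauss_density_def)
  also have "(\<Sum>i\<in>UNIV. - (x $ i)\<^sup>2 / 2) = - (norm x)\<^sup>2 / 2"
    by (simp add: norm_vec_square sum_negf sum_divide_distrib)
  finally show ?thesis .
qed

lemma integral_std_gaussian:
  fixes f :: "real^'d \<Rightarrow> real"
  assumes [measurable]: "f \<in> borel_measurable borel"
  shows "integral\<^sup>L std_gaussian f = (\<integral>x. gauss_density x * f x \<partial>lborel)"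
    and "integrable std_gaussian f \<longleftrightarrow> integrable lborel (\<lambda>x. gauss_density x * f x)"
  unfolding std_gaussian_eq by (simp_all add: integral_density integrable_density)

lemma gauss_density_integral: "has_bochner_integral lborel (gauss_density :: real^'d \<Rightarrow> real) 1"
  using lborel_prod_integral[of "\<lambda>i::'d. std_normal_density"] integral_std_normal_moment_even[of 0]
    integrable_std_normal_moment[of 0]
  by (simp add: gauss_density_def[abs_def])

lemma prob_space_std_gaussian: "prob_space (std_gaussian :: (real^'d) measure)"
proof
  show "emeasure std_gaussian (space (std_gaussian :: (real^'d) measure)) = 1"
    using gauss_density_integral[where 'd='d]
    by (simp add: std_gaussian_eq emeasure_density nn_integral_eq_integral has_bochner_integral_iff)
qed

lemma std_gaussian_second_moment:
  fixes a b :: "'d::finite"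
  shows "has_bochner_integral std_gaussian (\<lambda>x::real^'d. x $ a * x $ b) (if a = b then 1 else 0)"
proof -
  \<comment> \<open>The factors are distributed over the coordinates so that the mixed moment
    becomes a product of one-dimensional moments of order 2, 1 or 0.\<close>
  define f where "f i x = std_normal_density x * ((if i = a then x else 1) * (if i = b then x else 1))" for i x
  have f: "f i = (if i = a \<and> i = b then (\<lambda>x. std_normal_density x * x ^ (2*1)) else
     if i = a \<or> i = b then (\<lambda>x. std_normal_density x * x ^ (2*0+1))
     else (\<lambda>x. std_normal_density x * x ^ (2*0)))" for i
    by (auto simp: f_def fun_eq_iff power2_eq_square)
  have fi: "integrable lborel (f i)" for i
    unfolding f by (simp only: integrable_std_normal_moment if_True if_False split: if_split) simp
  have I: "integral\<^sup>L lborel (f i) = (if (i = a) = (i = b) then 1 else 0)" for i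
    unfolding f using integral_std_normal_moment_even[of 1] integral_std_normal_moment_even[of 0]
      integral_std_normal_moment_odd[of 0] by (auto simp: fact_2 numeral_2_eq_2)
  have P: "(\<Prod>i\<in>UNIV. integral\<^sup>L lborel (f i)) = (if a = b then 1 else 0)"
    unfolding I by (cases "a = b") (auto intro!: prod_zero)
  have eq: "(\<Prod>i\<in>UNIV. f i (x $ i)) = gauss_density x * (x $ a * x $ b)" for x :: "real^'d"
    by (simp add: f_def prod.distrib gauss_density_def prod.delta)
  show ?thesis
    using lborel_prod_integral[of f, OF fi] unfolding P eq
    by (simp add: has_bochner_integral_iff integral_std_gaussian)
qed

text \<open>The covariance of the standard Gaussian is the identity, so only the terms with
  \<open>j = k\<close> survive. This identity is the source of the Frobenius norm in the determinant
  bound.\<close>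

lemma std_gaussian_quadratic:
  fixes B :: "real^'d^'d"
  shows "has_bochner_integral std_gaussian (\<lambda>x. (norm (B *v x))\<^sup>2) ((norm B)\<^sup>2)"
proof -
  have eq: "(norm (B *v x))\<^sup>2 = (\<Sum>i\<in>UNIV. \<Sum>j\<in>UNIV. \<Sum>k\<in>UNIV. (B $ i $ j * B $ i $ k) * (x $ j * x $ k))" for x
    unfolding norm_vec_square by (simp add: matrix_vector_mult_def power2_eq_square sum_product mult_ac)
  have n: "(norm B)\<^sup>2 = (\<Sum>i\<in>UNIV. \<Sum>j\<in>UNIV. \<Sum>k\<in>UNIV. (B $ i $ j * B $ i $ k) * (if j = k then 1 else 0))"
    unfolding norm_matrix_square
  proof (intro sum.cong refl)
    fix i j
    have "(\<Sum>k\<in>UNIV. (B $ i $ j * B $ i $ k) * (if j = k then 1 else 0)) = (\<Sum>k\<in>UNIV. if j = k then B $ i $ j * B $ i $ k else 0)"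
      by (intro sum.cong) auto
    then show "(B $ i $ j)\<^sup>2 = (\<Sum>k\<in>UNIV. (B $ i $ j * B $ i $ k) * (if j = k then 1 else 0))"
      by (simp add: power2_eq_square)
  qed
  show ?thesis unfolding eq n
    by (intro has_bochner_integral_sum has_bochner_integral_mult_right std_gaussian_second_moment)
qed

lemma std_gaussian_norm_square:
  "has_bochner_integral std_gaussian (\<lambda>x::real^'d. (norm x)\<^sup>2) (real CARD('d))"
proof -
  have "(norm (mat 1 :: real^'d^'d))\<^sup>2 = real CARD('d)"
    unfolding norm_matrix_square by (simp add: mat_def if_distrib[where f="\<lambda>x. x\<^sup>2"] cong: if_cong)
  then show ?thesis using std_gaussian_quadratic[of "mat 1 :: real^'d^'d"] by simp
qed

text \<open>Jensen's inequality for \<open>exp\<close>, from integrating its tangent line at the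
  mean.\<close>

lemma (in prob_space) exp_expectation_le:
  fixes X :: "'a \<Rightarrow> real"
  assumes "integrable M X" "integrable M (\<lambda>x. exp (X x))"
  shows "exp (expectation X) \<le> expectation (\<lambda>x. exp (X x))"
proof -
  let ?m = "expectation X"
  have "expectation (\<lambda>x. exp ?m * (1 + (X x - ?m))) \<le> expectation (\<lambda>x. exp (X x))"
  proof (rule integral_mono)
    fix x
    have "exp ?m * (1 + (X x - ?m)) \<le> exp ?m * exp (X x - ?m)"
      by (intro mult_left_mono exp_ge_add_one_self) auto
    then show "exp ?m * (1 + (X x - ?m)) \<le> exp (X x)" by (simp add: exp_diff)
  qed (use assms in auto)
  then show ?thesis using assms by (simp add: prob_space)
qed

lemma matrix_diff_rdistrib: "(A - B) ** C = A ** C - B ** (C :: real^'n^'k)" for A :: "real^'k^'m"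
  by (simp add: matrix_matrix_mult_def vec_eq_iff left_diff_distrib sum_subtractf)

text \<open>A Gaussian substitute for a singular value argument. The function
  \<open>\<bar>det B\<bar> * gauss_density (B *v x)\<close> has mass at most 1. Relative to the
  Gaussian it is a constant times \<open>exp\<close> of a quadratic form whose mean is half of the
  dimension minus the squared Frobenius norm, and Jensen's inequality compares the two.\<close>

lemma abs_det_le_exp:
  fixes B :: "real^'m::{finite,wellorder}^'m::_"
  shows "\<bar>det B\<bar> \<le> exp (((norm B)\<^sup>2 - real CARD('m::_)) / 2)"
proof (cases "det B = 0")
  case False
  interpret G: prob_space "std_gaussian :: (real^'m::_) measure" by (rule prob_space_std_gaussian)
  let ?X = "\<lambda>x::real^'m::_. ((norm x)\<^sup>2 - (norm (B *v x))\<^sup>2) / 2"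
  have inj: "inj ((*v) B)" using False by (simp add: inj_matrix_vector_mult invertible_det_nz)
  have der: "((*v) B has_derivative (*v) B) (at x)" for x
    by (intro bounded_linear_imp_has_derivative matrix_vector_mul_bounded_linear)
  have Bm[measurable]: "(*v) B \<in> borel_measurable borel"
    by (intro borel_measurable_continuous_onI linear_continuous_on matrix_vector_mul_bounded_linear)
  have gB: "gauss_density (B *v x) = gauss_density x * exp (?X x)" for x
    using gauss_density_exp[of x] gauss_density_exp[of "B *v x"]
    by (simp add: field_simps flip: exp_add)
  note cov = integral_change_of_variables_le[of gauss_density "(*v) B" "\<lambda>_. (*v) B", OF _ _ der inj]
  have gi: "integrable lborel (gauss_density :: real^'m::_ \<Rightarrow> real)" "integral\<^sup>L lborel (gauss_density :: real^'m::_ \<Rightarrow> real) = 1"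
    using gauss_density_integral by (auto simp: has_bochner_integral_iff)
  have I: "integrable lebesgue (\<lambda>x. \<bar>det B\<bar> * (gauss_density x * exp (?X x)))"
    "(\<integral>x. \<bar>det B\<bar> * (gauss_density x * exp (?X x)) \<partial>lebesgue) \<le> 1"
    using cov gi by (simp_all add: gB)
  have I2: "integrable lborel (\<lambda>x. gauss_density x * exp (?X x))"
    "\<bar>det B\<bar> * (\<integral>x. gauss_density x * exp (?X x) \<partial>lborel) \<le> 1"
    using I False by (simp_all add: integrable_completion integral_completion)
  have X: "has_bochner_integral std_gaussian ?X ((real CARD('m::_) - (norm B)\<^sup>2) / 2)"
    by (intro has_bochner_integral_divide has_bochner_integral_diff std_gaussian_norm_square std_gaussian_quadratic)
  have "exp ((real CARD('m::_) - (norm B)\<^sup>2) / 2) \<le> G.expectation (\<lambda>x. exp (?X x))"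
    using G.exp_expectation_le[of ?X] X I2 by (simp add: has_bochner_integral_iff integral_std_gaussian)
  then have "\<bar>det B\<bar> * exp ((real CARD('m::_) - (norm B)\<^sup>2) / 2) \<le> \<bar>det B\<bar> * G.expectation (\<lambda>x. exp (?X x))"
    by (intro mult_left_mono) auto
  also have "\<dots> \<le> 1" using I2 by (simp add: integral_std_gaussian)
  finally have "\<bar>det B\<bar> \<le> 1 / exp ((real CARD('m::_) - (norm B)\<^sup>2) / 2)" by (simp add: field_simps)
  also have "\<dots> = exp (((norm B)\<^sup>2 - real CARD('m::_)) / 2)"
    by (simp add: exp_minus[symmetric] divide_inverse[of 1] minus_divide_left)
  finally show ?thesis .
qed simp

text \<open>The upper bound on determinants is applied to the inverse \<open>B\<close> of
  \<open>mat 1 + A\<close>, whose operator norm is at most 2. Expanding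
  \<open>B = mat 1 - B ** A\<close> isolates \<open>trace A\<close>; the constant 4 collects 2 from
  \<open>trace ((B ** A) ** A)\<close> and half of 4 from the square of
  \<open>norm (B ** A)\<close>.\<close>

lemma exp_trace_le_abs_det:
  fixes A :: "real^'m::{finite,wellorder}^'m::_"
  assumes A: "\<And>h. norm (A *v h) \<le> norm h / 2"
  shows "exp (trace A - 4 * (norm A)\<^sup>2) \<le> \<bar>det (mat 1 + A)\<bar>"
proof -
  let ?M = "mat 1 + A"
  have low: "norm h / 2 \<le> norm (?M *v h)" for h
    using norm_triangle_ineq2[of h "- (A *v h)"] A[of h]
    by (simp add: matrix_vector_mult_add_rdistrib)
  have "inj ((*v) ?M)"
  proof (rule injI)
    fix x y assume "?M *v x = ?M *v y"
    then show "x = y" using low[of "x - y"] by (simp add: matrix_vector_mult_diff_distrib)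
  qed
  then have "invertible ?M"
    by (metis invertible_left_inverse matrix_left_invertible_injective)
  then obtain B where MB: "?M ** B = mat 1" and BM: "B ** ?M = mat 1"
    unfolding invertible_def by blast
  have Bn: "norm (B *v h) \<le> 2 * norm h" for h
    using low[of "B *v h"] MB by (simp add: matrix_vector_mul_assoc)
  have B: "B = mat 1 - B ** A"
    using BM by (simp add: matrix_add_ldistrib algebra_simps)
  have tr: "trace (B ** A) = trace A - trace ((B ** A) ** A)"
    by (subst B) (simp add: trace_sub matrix_diff_rdistrib)
  have BA: "norm (B ** A) \<le> 2 * norm A" by (rule norm_matrix_mult_left_le) (use Bn in auto)
  have t1: "trace ((B ** A) ** A) \<le> 2 * (norm A)\<^sup>2"
    using trace_mult_le[of "B ** A" A] mult_right_mono[OF BA norm_ge_zero[of A]]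
    by (simp add: power2_eq_square)
  have t2: "(norm (B ** A))\<^sup>2 \<le> 4 * (norm A)\<^sup>2"
    using power_mono[OF BA, of 2] by (simp add: power_mult_distrib)
  have ti: "mat 1 \<bullet> X = trace X" for X :: "real^'m::_^'m::_"
    unfolding matrix_inner_sum trace_def by (simp add: mat_def if_distrib[where f="\<lambda>x. x * _"] cong: if_cong)
  have nd: "(norm (mat 1 - X))\<^sup>2 = trace (mat 1 :: real^'m::_^'m::_) - 2 * trace X + (norm X)\<^sup>2" for X :: "real^'m::_^'m::_"
  proof -
    have "(norm (mat 1 - X))\<^sup>2 = mat 1 \<bullet> (mat 1 :: real^'m::_^'m::_) - 2 * (mat 1 \<bullet> X) + X \<bullet> X"
      unfolding power2_norm_eq_inner inner_diff_left inner_diff_right inner_commute[of X "mat 1"] by linarith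
    then show ?thesis unfolding ti power2_norm_eq_inner .
  qed
  have nB1: "norm B = norm (mat 1 - B ** A)" using B by (rule arg_cong)
  have "(norm B)\<^sup>2 = trace (mat 1 :: real^'m::_^'m::_) - 2 * trace (B ** A) + (norm (B ** A))\<^sup>2"
    unfolding nB1 by (rule nd)
  then have nB: "((norm B)\<^sup>2 - real CARD('m::_)) / 2 \<le> 4 * (norm A)\<^sup>2 - trace A"
    using tr t1 t2 by (simp add: trace_I)
  have "det ?M * det B = 1" using MB by (metis det_I det_mul)
  then have d: "\<bar>det ?M\<bar> * \<bar>det B\<bar> = 1" by (simp flip: abs_mult)
  have "\<bar>det B\<bar> \<le> exp (4 * (norm A)\<^sup>2 - trace A)"
    using abs_det_le_exp[of B] nB by (meson exp_le_cancel_iff order_trans)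
  then have "\<bar>det ?M\<bar> * \<bar>det B\<bar> \<le> \<bar>det ?M\<bar> * exp (4 * (norm A)\<^sup>2 - trace A)"
    by (intro mult_left_mono) auto
  then have "1 \<le> \<bar>det ?M\<bar> * exp (4 * (norm A)\<^sup>2 - trace A)"
    by (simp only: d)
  then have "exp (trace A - 4 * (norm A)\<^sup>2) * 1 \<le> exp (trace A - 4 * (norm A)\<^sup>2) * (\<bar>det ?M\<bar> * exp (4 * (norm A)\<^sup>2 - trace A))"
    by (intro mult_left_mono) auto
  also have "\<dots> = \<bar>det ?M\<bar>" by (simp flip: exp_add)
  finally show ?thesis by simp
qed

section \<open>Transport of the Gaussian by maps close to the identity\<close>

definition gauss_lebesgue :: "(real^'d) measure" where
  "gauss_lebesgue = density lebesgue (\<lambda>x. ennreal (gauss_density x))"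

lemma sets_gauss_lebesgue[simp, measurable_cong]: "sets gauss_lebesgue = sets lebesgue"
  and space_gauss_lebesgue[simp]: "space gauss_lebesgue = UNIV"
  by (simp_all add: gauss_lebesgue_def)

lemma gauss_density_lebesgue[measurable]: "gauss_density \<in> borel_measurable lebesgue"
  by (intro measurable_completion) simp

lemma integral_gauss_lebesgue:
  fixes f :: "real^'d \<Rightarrow> real"
  assumes [measurable]: "f \<in> borel_measurable lebesgue"
  shows "integral\<^sup>L gauss_lebesgue f = (\<integral>x. gauss_density x * f x \<partial>lebesgue)"
    and "integrable gauss_lebesgue f \<longleftrightarrow> integrable lebesgue (\<lambda>x. gauss_density x * f x)"
  unfolding gauss_lebesgue_def by (simp_all add: integral_density integrable_density)

lemma gauss_lebesgue_borel:
  fixes f :: "real^'d \<Rightarrow> real"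
  assumes f[measurable]: "f \<in> borel_measurable borel"
  shows "integral\<^sup>L gauss_lebesgue f = integral\<^sup>L std_gaussian f"
    and "integrable gauss_lebesgue f \<longleftrightarrow> integrable std_gaussian f"
proof -
  have [measurable]: "f \<in> borel_measurable lebesgue" by (intro measurable_completion) simp
  have m: "(\<lambda>x. gauss_density x * f x) \<in> borel_measurable lborel" by simp
  show "integral\<^sup>L gauss_lebesgue f = integral\<^sup>L std_gaussian f"
    "integrable gauss_lebesgue f \<longleftrightarrow> integrable std_gaussian f"
    by (simp_all add: integral_gauss_lebesgue integral_std_gaussian integral_completion[OF m] integrable_completion[OF m])
qed

lemma prob_space_gauss_lebesgue: "prob_space (gauss_lebesgue :: (real^'d) measure)"
proof
  show "emeasure gauss_lebesgue (space (gauss_lebesgue :: (real^'d) measure)) = 1"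
    using gauss_density_integral[where 'd='d]
    by (simp add: gauss_lebesgue_def emeasure_density nn_integral_completion nn_integral_eq_integral has_bochner_integral_iff)
qed

lemma integrable_norm_std_gaussian: "integrable std_gaussian (\<lambda>x::real^'d. norm x)"
proof (rule Bochner_Integration.integrable_bound)
  interpret G: prob_space "std_gaussian :: (real^'d) measure" by (rule prob_space_std_gaussian)
  show "integrable std_gaussian (\<lambda>x::real^'d. 1 + (norm x)\<^sup>2)"
    using std_gaussian_norm_square[where 'd='d] by (auto simp: has_bochner_integral_iff)
  show "AE x in std_gaussian. norm (norm (x::real^'d)) \<le> norm (1 + (norm x)\<^sup>2)"
  proof (rule AE_I2)
    fix x :: "real^'d"
    have "2 * norm x \<le> 1 + (norm x)\<^sup>2"
      using zero_le_power2[of "norm x - 1"] by (simp add: power2_diff)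
    then show "norm (norm x) \<le> norm (1 + (norm x)\<^sup>2)"
      using norm_ge_zero[of x] by (simp del: norm_ge_zero)
  qed
qed simp

text \<open>Applied to \<open>k = 1\<close> and the field \<open>- \<epsilon> u\<close>, this inequality yields, as \<open>\<epsilon>\<close> tends to 0, the
  half of Gaussian integration by parts that removes its own divergence defect.\<close>

lemma gaussian_transport_defect:
  fixes u :: "real^'m::{finite,wellorder} \<Rightarrow> real^'m::_" and k :: "real^'m::_ \<Rightarrow> real"
    and A :: "real^'m::_ \<Rightarrow> real^'m::_^'m::_"
  assumes der: "\<And>x. (u has_derivative (*v) (A x)) (at x)"
    and K: "\<And>x. norm (u x) \<le> K"
    and op: "\<And>x h. norm (A x *v h) \<le> norm h / 2"
    and D: "\<And>x. norm (A x) \<le> D"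
    and k[measurable]: "k \<in> borel_measurable borel" and a: "0 < a" and kb: "\<And>x. a \<le> k x" "\<And>x. k x \<le> b"
  shows "(\<integral>x. ln (k (x + u x)) \<partial>std_gaussian) \<le> ln (\<integral>x. k x \<partial>std_gaussian) + K\<^sup>2 / 2 + 4 * D\<^sup>2
     + (\<integral>x. x \<bullet> u x - trace (A x) \<partial>gauss_lebesgue)"
    and "integrable gauss_lebesgue (\<lambda>x. x \<bullet> u x - trace (A x))"
proof -
  interpret G: prob_space "gauss_lebesgue :: (real^'m::_) measure" by (rule prob_space_gauss_lebesgue)
  interpret S: prob_space "std_gaussian :: (real^'m::_) measure" by (rule prob_space_std_gaussian)
  have PU: "G.prob UNIV = 1" using G.prob_space by simp
  have K0: "0 \<le> K" and D0: "0 \<le> D" using K D norm_ge_zero order_trans by blast+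
  have kpos: "0 < k x" for x using a kb(1)[of x] by linarith
  have contu: "continuous_on UNIV u"
    using der by (meson continuous_at_imp_continuous_on has_derivative_continuous)
  then have um[measurable]: "u \<in> borel_measurable borel" by (rule borel_measurable_continuous_onI)
  have "(\<lambda>x. matrix ((*v) (A x)) $ i $ j) \<in> borel_measurable (lebesgue_on UNIV)" for i j
    by (rule borel_measurable_partial_derivatives) (use der in auto)
  \<comment> \<open>Partial derivatives are obtained as Lebesgue measurable functions, which is why
    integrals involving \<open>A\<close> are taken for the completed Gaussian
    \<open>gauss_lebesgue\<close>.\<close>
  then have Am[measurable]: "(\<lambda>x. A x $ i $ j) \<in> borel_measurable lebesgue" for i j by simp
  have trm[measurable]: "(\<lambda>x. trace (A x)) \<in> borel_measurable lebesgue"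
    unfolding trace_def by measurable
  have "\<bar>trace (A x)\<bar> \<le> CARD('m::_) * D" for x
  proof -
    have "\<bar>trace (A x)\<bar> \<le> (\<Sum>i\<in>UNIV. \<bar>A x $ i $ i\<bar>)" unfolding trace_def by (rule sum_abs)
    also have "\<dots> \<le> (\<Sum>i\<in>(UNIV::'m set). D)"
    proof (rule sum_mono)
      fix i :: 'm
      show "\<bar>A x $ i $ i\<bar> \<le> D"
        using component_le_norm_cart[of "A x $ i" i] Finite_Cartesian_Product.norm_nth_le[of "A x" i] D[of x] by linarith
    qed
    finally show ?thesis by simp
  qed
  then have itr: "integrable gauss_lebesgue (\<lambda>x. trace (A x))"
    by (intro G.integrable_const_bound[of _ "CARD('m::_) * D"]) auto
  have "integrable std_gaussian (\<lambda>x. x \<bullet> u x)"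
  proof (rule Bochner_Integration.integrable_bound)
    show "integrable std_gaussian (\<lambda>x::real^'m::_. K * norm x)"
      by (intro integrable_mult_right integrable_norm_std_gaussian)
    show "AE x in std_gaussian. norm (x \<bullet> u x) \<le> norm (K * norm x)"
      using K K0 by (auto intro!: AE_I2 order_trans[OF Cauchy_Schwarz_ineq2] mult_left_mono simp: abs_mult mult.commute[of K])
  qed simp
  then have ixu: "integrable gauss_lebesgue (\<lambda>x. x \<bullet> u x)" by (simp add: gauss_lebesgue_borel)
  show idiv: "integrable gauss_lebesgue (\<lambda>x. x \<bullet> u x - trace (A x))" using ixu itr by auto
  have iu: "integrable gauss_lebesgue (\<lambda>x. (norm (u x))\<^sup>2 / 2)"
  proof -
    have "integrable std_gaussian (\<lambda>x. (norm (u x))\<^sup>2 / 2)"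
      by (rule S.integrable_const_bound[of _ "K\<^sup>2 / 2"]) (auto intro!: AE_I2 power_mono K)
    then show ?thesis by (simp add: gauss_lebesgue_borel)
  qed
  have lnk: "\<bar>ln (k x)\<bar> \<le> \<bar>ln a\<bar> + \<bar>ln b\<bar>" for x
  proof -
    have "ln a \<le> ln (k x)" "ln (k x) \<le> ln b"
      using a kb[of x] kpos[of x] by (subst ln_le_cancel_iff; linarith)+
    then show ?thesis by linarith
  qed
  have ik: "integrable gauss_lebesgue (\<lambda>x. ln (k (x + u x)))"
  proof -
    have "integrable std_gaussian (\<lambda>x. ln (k (x + u x)))"
      by (rule S.integrable_const_bound[of _ "\<bar>ln a\<bar> + \<bar>ln b\<bar>"]) (auto intro!: AE_I2 lnk)
    then show ?thesis by (simp add: gauss_lebesgue_borel)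
  qed
  define F where "F x = x + u x" for x
  \<comment> \<open>\<open>X\<close> is the logarithm, relative to the Gaussian, of a lower bound
    for the density pulled back along \<open>F\<close>: the log-determinant is replaced by
    \<open>trace (A x) - 4 * D\<^sup>2\<close>.\<close>
  define X where "X x = ln (k (x + u x)) - (x \<bullet> u x - trace (A x)) - (norm (u x))\<^sup>2 / 2 - 4 * D\<^sup>2" for x
  have iX: "integrable gauss_lebesgue X" unfolding X_def using ik idiv iu by auto
  then have Xm[measurable]: "X \<in> borel_measurable lebesgue"
    using borel_measurable_integrable by (metis measurable_cong_sets sets_gauss_lebesgue)
  have derF: "(F has_derivative (*v) (mat 1 + A x)) (at x)" for x
    unfolding F_def by (auto intro!: derivative_eq_intros der simp: matrix_vector_mult_add_rdistrib)
  have "inj F"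
  proof (rule injI)
    fix x y assume eq: "F x = F y"
    have "norm (u x - u y) \<le> 1/2 * norm (x - y)"
    proof (rule differentiable_bound[of UNIV u "\<lambda>x. (*v) (A x)"])
      show "onorm ((*v) (A x)) \<le> 1 / 2" for x using op[of x] by (intro onorm_le) simp
    qed (use der in auto)
    moreover have "norm (u x - u y) = norm (x - y)" using eq unfolding F_def
      by (metis add_diff_eq diff_add_eq eq_diff_eq norm_minus_commute diff_add_cancel add_diff_cancel_left' group_cancel.sub1 add.commute minus_diff_eq)
    ultimately show "x = y" by simp
  qed
  define h where "h x = gauss_density x * k x" for x
  have ikS: "integrable std_gaussian k"
    by (rule S.integrable_const_bound[of _ b]) (use kb kpos in \<open>auto intro!: AE_I2 simp: abs_of_pos\<close>)
  then have hi: "integrable lborel h" and hI: "integral\<^sup>L lborel h = integral\<^sup>L std_gaussian k"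
    unfolding h_def by (simp_all add: integral_std_gaussian)
  have h0: "0 \<le> h x" for x using kpos[of x] by (simp add: h_def less_imp_le)
  have expX: "gauss_density x * exp (X x) = exp (trace (A x) - 4 * D\<^sup>2) * h (F x)" for x
  proof -
    have "gauss_density (F x) = gauss_density x * exp (- (x \<bullet> u x) - (norm (u x))\<^sup>2 / 2)"
    proof -
      have n2: "(norm (F x))\<^sup>2 = (norm x)\<^sup>2 + 2 * (x \<bullet> u x) + (norm (u x))\<^sup>2"
        unfolding power2_norm_eq_inner F_def by (simp add: inner_add inner_commute)
      have "exp (- (norm (F x))\<^sup>2 / 2) = exp (- (norm x)\<^sup>2 / 2) * exp (- (x \<bullet> u x) - (norm (u x))\<^sup>2 / 2)"
        unfolding n2 exp_add[symmetric] by (simp add: field_simps)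
      then show ?thesis using gauss_density_exp[of x] gauss_density_exp[of "F x"] by simp
    qed
    moreover have "exp (X x) = k (F x) * (exp (- (x \<bullet> u x) - (norm (u x))\<^sup>2 / 2) * exp (trace (A x) - 4 * D\<^sup>2))"
    proof -
      have "X x = ln (k (F x)) + ((- (x \<bullet> u x) - (norm (u x))\<^sup>2 / 2) + (trace (A x) - 4 * D\<^sup>2))"
        by (simp add: X_def F_def)
      then show ?thesis using kpos[of "F x"] by (simp only: exp_add exp_ln)
    qed
    ultimately show ?thesis unfolding h_def by (simp add: mult_ac)
  qed
  have le: "gauss_density x * exp (X x) \<le> \<bar>det (matrix ((*v) (mat 1 + A x)))\<bar> * h (F x)" for x
  proof -
    have "exp (trace (A x) - 4 * D\<^sup>2) \<le> exp (trace (A x) - 4 * (norm (A x))\<^sup>2)"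
      using D[of x] by (simp add: power_mono)
    also have "\<dots> \<le> \<bar>det (mat 1 + A x)\<bar>" by (rule exp_trace_le_abs_det) (rule op)
    finally show ?thesis unfolding expX using h0 by (auto intro!: mult_right_mono)
  qed
  note cov = integral_change_of_variables_le[of h F, OF hi h0 derF \<open>inj F\<close>]
  have iexp': "integrable lebesgue (\<lambda>x. gauss_density x * exp (X x))"
    by (rule Bochner_Integration.integrable_bound[OF cov(1)])
      (use le h0 in \<open>auto intro!: AE_I2 simp: abs_mult\<close>)
  then have iexp: "integrable gauss_lebesgue (\<lambda>x. exp (X x))" by (simp add: integral_gauss_lebesgue)
  have "exp (G.expectation X) \<le> G.expectation (\<lambda>x. exp (X x))"
    by (rule G.exp_expectation_le[OF iX iexp])
  also have "\<dots> = (\<integral>x. gauss_density x * exp (X x) \<partial>lebesgue)" by (simp add: integral_gauss_lebesgue)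
  also have "\<dots> \<le> integral\<^sup>L std_gaussian k"
    unfolding hI[symmetric] by (rule order_trans[OF integral_mono[OF iexp' cov(1)] cov(2)]) (rule le)
  finally have "G.expectation X \<le> ln (integral\<^sup>L std_gaussian k)"
    by (metis exp_gt_zero exp_le_cancel_iff exp_ln less_le_trans)
  moreover have "G.expectation X = G.expectation (\<lambda>x. ln (k (x + u x))) - G.expectation (\<lambda>x. x \<bullet> u x - trace (A x))
    - G.expectation (\<lambda>x. (norm (u x))\<^sup>2 / 2) - 4 * D\<^sup>2"
    unfolding X_def using ik idiv iu by (simp add: PU)
  moreover have "G.expectation (\<lambda>x. (norm (u x))\<^sup>2 / 2) \<le> G.expectation (\<lambda>x. K\<^sup>2 / 2)"
    by (intro integral_mono iu) (auto intro!: power_mono K)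
  moreover have "G.expectation (\<lambda>x. ln (k (x + u x))) = S.expectation (\<lambda>x. ln (k (x + u x)))"
    by (rule gauss_lebesgue_borel) simp
  ultimately show "(\<integral>x. ln (k (x + u x)) \<partial>std_gaussian) \<le> ln (\<integral>x. k x \<partial>std_gaussian) + K\<^sup>2 / 2 + 4 * D\<^sup>2
     + (\<integral>x. x \<bullet> u x - trace (A x) \<partial>gauss_lebesgue)" by (simp add: PU)
qed

lemma gaussian_transport_wellorder:
  fixes u :: "real^'m::{finite,wellorder} \<Rightarrow> real^'m::_" and k :: "real^'m::_ \<Rightarrow> real"
    and A :: "real^'m::_ \<Rightarrow> real^'m::_^'m::_"
  assumes der: "\<And>x. (u has_derivative (*v) (A x)) (at x)"
    and K: "\<And>x. norm (u x) \<le> K"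
    and op: "\<And>x h. norm (A x *v h) \<le> norm h / 2"
    and D: "\<And>x. norm (A x) \<le> D"
    and k[measurable]: "k \<in> borel_measurable borel" and a: "0 < a" and kb: "\<And>x. a \<le> k x" "\<And>x. k x \<le> b"
  shows "(\<integral>x. ln (k (x + u x)) \<partial>std_gaussian) \<le> ln (\<integral>x. k x \<partial>std_gaussian) + K\<^sup>2 / 2 + 4 * D\<^sup>2"
proof -
  interpret S: prob_space "std_gaussian :: (real^'m::_) measure" by (rule prob_space_std_gaussian)
  let ?I = "\<integral>x. x \<bullet> u x - trace (A x) \<partial>gauss_lebesgue"
  let ?C = "K\<^sup>2 / 2 + 4 * D\<^sup>2"
  \<comment> \<open>With \<open>k = 1\<close> both logarithms vanish. The field
    \<open>- e *\<^sub>R u x\<close> scales the defect by \<open>- e\<close> but the error terms by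
    \<open>e\<^sup>2\<close>, so dividing by \<open>e\<close> leaves a bound that tends to
    0.\<close>
  have "?I \<le> e * ?C" if e: "0 < e" "e < 1" for e :: real
  proof -
    have "(\<integral>x. ln ((\<lambda>_. 1) (x + - e *\<^sub>R u x)) \<partial>(std_gaussian :: (real^'m::_) measure))
      \<le> ln (\<integral>x. (\<lambda>_. 1) x \<partial>(std_gaussian :: (real^'m::_) measure)) + (e * K)\<^sup>2 / 2 + 4 * (e * D)\<^sup>2
     + (\<integral>x. x \<bullet> (- e *\<^sub>R u x) - trace (- e *\<^sub>R A x) \<partial>gauss_lebesgue)"
    proof (rule gaussian_transport_defect[where a = 1 and b = 1])
      fix x h :: "real^'m::_"
      have mv: "(- e *\<^sub>R A x) *v h = - e *\<^sub>R (A x *v h)" for h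
        by (simp add: vec_eq_iff matrix_vector_mult_def sum_distrib_left mult_ac sum_negf)
      show "((\<lambda>x. - e *\<^sub>R u x) has_derivative (*v) (- e *\<^sub>R A x)) (at x)"
        unfolding mv by (intro derivative_intros der)
      have "norm ((- e *\<^sub>R A x) *v h) = e * norm (A x *v h)" unfolding mv using e by simp
      also have "\<dots> \<le> 1 * (norm h / 2)" using e by (intro mult_mono op) auto
      finally show "norm ((- e *\<^sub>R A x) *v h) \<le> norm h / 2" by simp
      show "norm (- e *\<^sub>R u x) \<le> e * K" "norm (- e *\<^sub>R A x) \<le> e * D" using e K D by auto
    qed auto
    moreover have "(\<lambda>x. x \<bullet> (- e *\<^sub>R u x) - trace (- e *\<^sub>R A x)) = (\<lambda>x. - e * (x \<bullet> u x - trace (A x)))"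
    proof
      fix x
      have "trace (- e *\<^sub>R A x) = - e * trace (A x)"
        by (simp add: trace_def sum_distrib_left sum_negf)
      then show "x \<bullet> (- e *\<^sub>R u x) - trace (- e *\<^sub>R A x) = - e * (x \<bullet> u x - trace (A x))"
        by (simp only: inner_scaleR_right right_diff_distrib)
    qed
    moreover have "S.prob UNIV = 1" using S.prob_space by simp
    ultimately have "0 \<le> e\<^sup>2 * ?C + - e * ?I"
      by (simp only: integral_mult_right_zero) (simp add: algebra_simps power2_eq_square)
    then have "e * ?I \<le> e * (e * ?C)" by (simp add: power2_eq_square algebra_simps)
    then show ?thesis using e by simp
  qed
  then have "\<forall>\<^sub>F e in at_right 0. ?I \<le> e * ?C"
    by (intro eventually_mono[OF eventually_at_right_real[of 0 1]]) auto
  moreover have "((\<lambda>e. e * ?C) \<longlongrightarrow> 0 * ?C) (at_right 0)" by (intro tendsto_intros)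
  ultimately have "?I \<le> 0 * ?C" by (intro tendsto_lowerbound) auto
  then show ?thesis using gaussian_transport_defect(1)[OF assms] by simp
qed

text \<open>The change-of-variables theorem of the library is stated for index types that are well-ordered;
  \<open>'d idx\<close> is a well-ordered copy of an arbitrary finite type.\<close>

typedef ('d::finite) idx = "{..<CARD('d)}" by (rule exI[of _ 0]) simp

instance idx :: (finite) finite
proof
  have "finite (Rep_idx ` (UNIV :: 'a idx set))"
    by (rule finite_subset[of _ "{..<CARD('a)}"]) (use Rep_idx in auto)
  then show "finite (UNIV :: 'a idx set)" by (rule finite_imageD) (auto intro: injI simp: Rep_idx_inject)
qed

instantiation idx :: (finite) wellorder
begin
definition "x \<le> y \<longleftrightarrow> Rep_idx x \<le> Rep_idx (y :: 'a idx)"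
definition "x < y \<longleftrightarrow> Rep_idx x < Rep_idx (y :: 'a idx)"
instance
proof
  fix P :: "'a idx \<Rightarrow> bool" and a
  assume step: "\<And>x. (\<And>y. y < x \<Longrightarrow> P y) \<Longrightarrow> P x"
  show "P a" by (induction a rule: measure_induct_rule[of Rep_idx]) (use step in \<open>auto simp: less_idx_def\<close>)
qed (auto simp: less_eq_idx_def less_idx_def Rep_idx_inject)
end

lemma card_idx: "CARD('d::finite idx) = CARD('d)"
  using type_definition.card[OF type_definition_idx] by simp

lemma Basis_prod_cart: "(\<Prod>b\<in>(Basis :: (real^'d) set). f b) = (\<Prod>i\<in>UNIV. f (axis i (1::real)))"
proof -
  have B: "(Basis :: (real^'d) set) = (\<lambda>i. axis i (1::real)) ` UNIV" by (auto simp: Basis_vec_def)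
  have inj: "inj (\<lambda>i::'d. axis i (1::real))" by (auto intro!: injI simp: axis_eq_axis)
  show ?thesis unfolding B by (subst prod.reindex[OF inj]) simp
qed

definition reindex :: "('d \<Rightarrow> 'e) \<Rightarrow> real^'e \<Rightarrow> real^'d" where
  "reindex \<sigma> x = (\<chi> i. x $ \<sigma> i)"

lemma reindex_nth[simp]: "reindex \<sigma> x $ i = x $ \<sigma> i"
  by (simp add: reindex_def)

context
  fixes \<sigma> :: "'d::finite \<Rightarrow> 'e::finite"
  assumes bij: "bij \<sigma>"
begin

lemma norm_reindex: "norm (reindex \<sigma> x) = norm x"
proof -
  have "(\<Sum>i\<in>UNIV. (x $ \<sigma> i)\<^sup>2) = (\<Sum>i\<in>UNIV. (x $ i)\<^sup>2)"
    using sum.reindex_bij_betw[OF bij, of "\<lambda>i. (x $ i)\<^sup>2"] .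
  then show ?thesis by (simp add: norm_vec_def L2_set_def)
qed

lemma bounded_linear_reindex: "bounded_linear (reindex \<sigma>)"
  by (rule bounded_linear_intro[of _ 1]) (auto simp: vec_eq_iff norm_reindex)

lemma reindex_measurable: "reindex \<sigma> \<in> borel_measurable borel"
  by (intro borel_measurable_continuous_onI linear_continuous_on bounded_linear_reindex)

lemma reindex_inv: "reindex (inv \<sigma>) (reindex \<sigma> x) = x" "reindex \<sigma> (reindex (inv \<sigma>) y) = y"
  using bij by (auto simp: vec_eq_iff bij_is_surj surj_f_inv_f bij_is_inj)

lemma distr_lborel_reindex: "distr lborel borel (reindex \<sigma>) = lborel"
proof (rule lborel_eqI[symmetric])
  fix l u :: "real^'d" assume lu: "\<And>b. b \<in> Basis \<Longrightarrow> l \<bullet> b \<le> u \<bullet> b"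
  have le: "l $ i \<le> u $ i" for i using lu[of "axis i 1"] by (simp add: inner_axis)
  have "reindex \<sigma> -` box l u = box (reindex (inv \<sigma>) l) (reindex (inv \<sigma>) u)"
    using bij by (auto simp: mem_box_cart bij_is_surj surj_f_inv_f) (metis bij_inv_eq_iff)+
  then have "emeasure (distr lborel borel (reindex \<sigma>)) (box l u)
    = emeasure lborel (box (reindex (inv \<sigma>) l) (reindex (inv \<sigma>) u))"
    by (subst emeasure_distr) (auto simp: reindex_measurable)
  also have "\<dots> = (\<Prod>b\<in>Basis. (reindex (inv \<sigma>) u - reindex (inv \<sigma>) l) \<bullet> b)"
    using le by (subst emeasure_lborel_box) (auto simp: Basis_vec_def inner_axis)
  also have "\<dots> = (\<Prod>i\<in>UNIV. u $ inv \<sigma> i - l $ inv \<sigma> i)"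
    unfolding Basis_prod_cart by (simp add: inner_axis)
  also have "\<dots> = (\<Prod>i\<in>UNIV. u $ i - l $ i)"
    using prod.reindex_bij_betw[OF bij_imp_bij_inv[OF bij], of "\<lambda>i. u $ i - l $ i"] by simp
  also have "\<dots> = (\<Prod>b\<in>Basis. (u - l) \<bullet> b)"
    unfolding Basis_prod_cart by (simp add: inner_axis)
  finally show "emeasure (distr lborel borel (reindex \<sigma>)) (box l u) = (\<Prod>b\<in>Basis. (u - l) \<bullet> b)" .
qed simp

lemma gauss_density_reindex: "gauss_density (reindex \<sigma> x) = gauss_density x"
  using prod.reindex_bij_betw[OF bij, of "\<lambda>i. std_normal_density (x $ i)"] by (simp add: gauss_density_def)

lemma integral_std_gaussian_reindex:
  fixes f :: "real^'d \<Rightarrow> real"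
  assumes [measurable]: "f \<in> borel_measurable borel"
  shows "(\<integral>x. f (reindex \<sigma> x) \<partial>std_gaussian) = (\<integral>x. f x \<partial>std_gaussian)"
proof -
  note [measurable] = reindex_measurable
  have "(\<integral>x. f x \<partial>std_gaussian) = (\<integral>x. gauss_density x * f x \<partial>distr lborel borel (reindex \<sigma>))"
    by (simp add: integral_std_gaussian distr_lborel_reindex)
  also have "\<dots> = (\<integral>x. f (reindex \<sigma> x) \<partial>std_gaussian)"
    by (subst integral_distr) (auto simp: integral_std_gaussian gauss_density_reindex)
  finally show ?thesis by simp
qed

end

text \<open>The coordinates are renamed by a bijection onto the well-ordered index type; the
  Gaussian, the operator bound and the Frobenius norm are invariant under it. The two costs are that
  of a translation and that of the second-order part of the log-determinant.\<close>

lemma gaussian_transport: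
  fixes u :: "real^'d \<Rightarrow> real^'d" and k :: "real^'d \<Rightarrow> real" and A :: "real^'d \<Rightarrow> real^'d^'d"
  assumes der: "\<And>x. (u has_derivative (*v) (A x)) (at x)"
    and K: "\<And>x. norm (u x) \<le> K"
    and op: "\<And>x h. norm (A x *v h) \<le> norm h / 2"
    and D: "\<And>x. norm (A x) \<le> D"
    and k[measurable]: "k \<in> borel_measurable borel" and a: "0 < a" and kb: "\<And>x. a \<le> k x" "\<And>x. k x \<le> b"
  shows "(\<integral>x. ln (k (x + u x)) \<partial>std_gaussian) \<le> ln (\<integral>x. k x \<partial>std_gaussian) + K\<^sup>2 / 2 + 4 * D\<^sup>2"
proof -
  obtain \<sigma> :: "'d \<Rightarrow> 'd idx" where bij: "bij \<sigma>"
    using finite_same_card_bij[of "UNIV :: 'd set" "UNIV :: 'd idx set"] by (auto simp: card_idx)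
  define \<tau> where "\<tau> = inv \<sigma>"
  have bij': "bij \<tau>" unfolding \<tau>_def by (rule bij_imp_bij_inv[OF bij])
  have inv\<tau>: "inv \<tau> = \<sigma>" unfolding \<tau>_def by (rule inv_inv_eq[OF bij])
  let ?T = "reindex \<sigma>" and ?S = "reindex \<tau>"
  have TS: "?S (?T x) = x" "?T (?S y) = y" for x y
    using reindex_inv[OF bij] unfolding \<tau>_def by auto
  define B where "B x = (\<chi> i j. A (?T x) $ \<tau> i $ \<tau> j)" for x
  have Bv: "B x *v h = ?S (A (?T x) *v ?T h)" for x h
  proof -
    have "(\<Sum>j\<in>UNIV. A (?T x) $ \<tau> i $ \<tau> j * h $ j) = (\<Sum>j\<in>UNIV. A (?T x) $ \<tau> i $ j * h $ \<sigma> j)" for i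
      using sum.reindex_bij_betw[OF bij, of "\<lambda>j. A (?T x) $ \<tau> i $ \<tau> j * h $ j"] bij
      by (simp add: \<tau>_def bij_is_inj)
    then show ?thesis by (simp add: vec_eq_iff B_def matrix_vector_mult_def)
  qed
  have nB: "norm (B x) = norm (A (?T x))" for x
  proof -
    have "(norm (B x))\<^sup>2 = (\<Sum>i\<in>UNIV. \<Sum>j\<in>UNIV. (A (?T x) $ \<tau> i $ \<tau> j)\<^sup>2)"
      unfolding norm_matrix_square by (simp add: B_def)
    also have "\<dots> = (\<Sum>i\<in>UNIV. \<Sum>j\<in>UNIV. (A (?T x) $ \<tau> i $ j)\<^sup>2)"
      by (intro sum.cong refl sum.reindex_bij_betw[OF bij'])
    also have "\<dots> = (norm (A (?T x)))\<^sup>2"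
      unfolding norm_matrix_square
      using sum.reindex_bij_betw[OF bij', of "\<lambda>i. \<Sum>j\<in>UNIV. (A (?T x) $ i $ j)\<^sup>2"] by simp
    finally show ?thesis by simp
  qed
  have contu: "continuous_on UNIV u"
    using der by (meson continuous_at_imp_continuous_on has_derivative_continuous)
  then have um[measurable]: "u \<in> borel_measurable borel" by (rule borel_measurable_continuous_onI)
  have [measurable]: "?T \<in> borel_measurable borel" by (rule reindex_measurable[OF bij])
  have "(\<integral>x. ln (k (?T (x + ?S (u (?T x))))) \<partial>std_gaussian) \<le> ln (\<integral>x. k (?T x) \<partial>std_gaussian) + K\<^sup>2 / 2 + 4 * D\<^sup>2"
  proof (rule gaussian_transport_wellorder[where u = "\<lambda>x. ?S (u (?T x))" and A = B and k = "\<lambda>x. k (?T x)" and a = a and b = b])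
    fix x h :: "real^'d idx"
    show "((\<lambda>x. ?S (u (?T x))) has_derivative (*v) (B x)) (at x)"
      unfolding Bv
      by (intro bounded_linear.has_derivative[OF bounded_linear_reindex[OF bij']]
         has_derivative_compose[of ?T ?T x UNIV u, OF _ der]
         bounded_linear_imp_has_derivative bounded_linear_reindex[OF bij])
    show "norm (B x *v h) \<le> norm h / 2"
      unfolding Bv norm_reindex[OF bij'] using op[of "?T x" "?T h"] norm_reindex[OF bij, of h] by simp
  qed (auto simp: norm_reindex[OF bij'] nB K D a kb)
  moreover have "?T (x + ?S (u (?T x))) = ?T x + u (?T x)" for x
    using TS(2)[of "u (?T x)"] by (simp add: bounded_linear_reindex[OF bij, THEN bounded_linear.linear, THEN linear_add])
  ultimately show ?thesis
    using integral_std_gaussian_reindex[OF bij, of "\<lambda>x. ln (k (x + u x))"] integral_std_gaussian_reindex[OF bij k] by simp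
qed

text \<open>The Cameron-Martin cost: a constant displacement has zero Jacobian.\<close>

lemma gaussian_shift:
  fixes k :: "real^'d \<Rightarrow> real"
  assumes "k \<in> borel_measurable borel" "0 < a" "\<And>x. a \<le> k x" "\<And>x. k x \<le> b"
  shows "(\<integral>x. ln (k (x + h)) \<partial>std_gaussian) \<le> ln (\<integral>x. k x \<partial>std_gaussian) + (norm h)\<^sup>2 / 2"
proof -
  have z: "(*v) (0 :: real^'d^'d) = (\<lambda>_. 0)" by (simp add: matrix_vector_mult_def vec_eq_iff fun_eq_iff)
  show ?thesis
    using gaussian_transport[of "\<lambda>_. h" "\<lambda>_. 0" "norm h" 0 k a b] assms by (simp add: z)
qed

section \<open>A variational bound on the entropy\<close>

text \<open>This makes the negative part of the log-density integrable: expressed under the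
  reference measure, it is weighted by the density itself.\<close>

lemma mult_neg_ln_le_one:
  fixes r :: real assumes "0 \<le> r"
  shows "r * max 0 (- ln r) \<le> 1"
proof (cases "0 < r \<and> r < 1")
  case True
  then have "- ln r = ln (1 / r)" by (simp add: ln_div)
  also have "\<dots> \<le> 1 / r" using True by (meson divide_pos_pos ln_bound zero_less_one)
  finally have "r * max 0 (- ln r) \<le> r * (1 / r)" using True by (intro mult_left_mono) auto
  then show ?thesis using True by simp
next
  case False
  then have "r = 0 \<or> 1 \<le> r" using assms by auto
  then show ?thesis by auto
qed

text \<open>The converse half of the Donsker--Varadhan formula: it is tested on multiples of indicators of
  null sets, and then on truncations of the log-density.\<close>

lemma Ent_le_of_variational:
  fixes \<mu> \<rho> :: "'z measure"
  assumes "prob_space \<mu>" "prob_space \<rho>" and sets_eq: "sets \<rho> = sets \<mu>"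
    and dv: "\<And>f B. f \<in> borel_measurable \<mu> \<Longrightarrow> (\<And>x. \<bar>f x\<bar> \<le> B) \<Longrightarrow> (\<integral>x. f x \<partial>\<rho>) \<le> C + ln (\<integral>x. exp (f x) \<partial>\<mu>)"
  shows "Ent \<rho> \<mu> \<le> ereal C"
proof -
  interpret M: prob_space \<mu> by fact
  interpret R: prob_space \<rho> by fact
  note [measurable_cong] = sets_eq
  have sp: "space \<rho> = space \<mu>" using sets_eq by (rule sets_eq_imp_space_eq)
  have ac: "absolutely_continuous \<mu> \<rho>"
    unfolding absolutely_continuous_def
  proof
    fix A assume A: "A \<in> null_sets \<mu>"
    then have [measurable]: "A \<in> sets \<mu>" by auto
    \<comment> \<open>The test function vanishes almost everywhere under \<mu>, so its exponential
      moment is 1 whatever the factor \<open>n\<close>.\<close>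
    have "real n * R.prob A \<le> C" for n :: nat
    proof -
      have "(\<integral>x. real n * indicator A x \<partial>\<rho>) \<le> C + ln (\<integral>x. exp (real n * indicator A x) \<partial>\<mu>)"
        by (rule dv[of _ "real n"]) (auto simp: indicator_def)
      moreover have "(\<integral>x. exp (real n * indicator A x) \<partial>\<mu>) = (\<integral>x. 1 \<partial>\<mu>)"
      proof (rule integral_cong_AE)
        show "AE x in \<mu>. exp (real n * indicator A x) = 1"
          using AE_not_in[OF A] by eventually_elim simp
      qed auto
      moreover have "A \<in> sets \<rho>" using sets_eq by simp
      ultimately show ?thesis by (simp add: M.prob_space)
    qed
    then have "R.prob A \<le> 0"
      by (metis ex_less_of_nat_mult linorder_not_le)
    then have "R.prob A = 0" by (simp add: measure_le_0_iff)
    then show "A \<in> null_sets \<rho>" using sets_eq by (auto simp: R.emeasure_eq_measure)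
  qed
  define r where "r x = enn2real (RN_deriv \<mu> \<rho> x)" for x
  have [measurable]: "r \<in> borel_measurable \<mu>" unfolding r_def by measurable
  have r0: "0 \<le> r x" for x unfolding r_def by simp
  have "AE x in \<mu>. RN_deriv \<mu> \<rho> x \<noteq> \<infinity>"
    by (rule M.RN_deriv_finite) (use ac sets_eq R.sigma_finite_measure_axioms in auto)
  then have "density \<mu> (\<lambda>x. ennreal (r x)) = density \<mu> (RN_deriv \<mu> \<rho>)"
    by (intro density_cong) (auto simp: r_def less_top elim!: eventually_mono)
  also have "\<dots> = \<rho>" by (rule M.density_RN_deriv) (use ac sets_eq in auto)
  finally have dens: "\<rho> = density \<mu> (\<lambda>x. ennreal (r x))" by simp
  have ed: "entropy_density (exp 1) \<mu> \<rho> = (\<lambda>x. ln (r x))"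
    by (simp add: entropy_density_def r_def fun_eq_iff log_def)
  have rpos: "AE x in \<rho>. 0 < r x"
    by (subst dens, subst AE_density) (auto simp: less_le r0)
  have intr: "integrable \<mu> r" "integral\<^sup>L \<mu> r = 1"
  proof -
    have "(\<integral>\<^sup>+x. ennreal (r x) \<partial>\<mu>) = emeasure \<rho> (space \<rho>)"
      unfolding sp by (subst dens) (simp add: emeasure_density cong: nn_integral_cong)
    then have "(\<integral>\<^sup>+x. ennreal (r x) \<partial>\<mu>) = ennreal 1" by (simp add: R.emeasure_space_1)
    then have "has_bochner_integral \<mu> r 1"
      by (intro has_bochner_integral_nn_integral) (auto simp: r0)
    then show "integrable \<mu> r" "integral\<^sup>L \<mu> r = 1" by (auto simp: has_bochner_integral_iff)
  qed
  \<comment> \<open>\<open>ln 0\<close> is a default value, so the zeros of the density are sent to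
    the lower truncation level explicitly.\<close>
  define f where "f n x = (if r x = 0 then - real n else max (- real n) (min (real n) (ln (r x))))" for n x
  have [measurable]: "f n \<in> borel_measurable \<mu>" for n unfolding f_def by measurable
  have fb: "\<bar>f n x\<bar> \<le> real n" for n x unfolding f_def by auto
  have fle: "(\<integral>x. f n x \<partial>\<rho>) \<le> C + exp (- real n)" for n
  proof -
    \<comment> \<open>Truncation from above only lowers the exponential, and truncation from below
      adds at most \<open>exp (- real n)\<close>. As \<open>r\<close> has integral 1, the
      logarithmic term in \<open>dv\<close> is then at most \<open>exp (- real n)\<close>.\<close>
    have e: "exp (f n x) \<le> r x + exp (- real n)" for x
    proof (cases "r x = 0")
      case False
      then have "0 < r x" using r0[of x] by simp
      have "f n x \<le> ln (r x) \<or> f n x = - real n" using False unfolding f_def by auto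
      then show ?thesis
      proof
        assume "f n x \<le> ln (r x)"
        then have "exp (f n x) \<le> r x" using \<open>0 < r x\<close> by (metis exp_le_cancel_iff exp_ln)
        then show ?thesis by (simp add: add_increasing2)
      qed (simp add: r0)
    qed (simp add: f_def)
    have ie: "integrable \<mu> (\<lambda>x. exp (f n x))"
      by (rule M.integrable_const_bound[of _ "exp n"]) (use fb[of n] in \<open>auto simp: abs_le_iff\<close>)
    have "(\<integral>x. exp (f n x) \<partial>\<mu>) \<le> (\<integral>x. r x + exp (- real n) \<partial>\<mu>)"
      by (intro integral_mono ie e) (use intr in auto)
    then have le: "(\<integral>x. exp (f n x) \<partial>\<mu>) \<le> 1 + exp (- real n)" using intr by (simp add: M.prob_space)
    have "exp (- real n) \<le> (\<integral>x. exp (f n x) \<partial>\<mu>)"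
      by (rule M.integral_ge_const[OF ie]) (use fb[of n] in \<open>auto simp: abs_le_iff minus_le_iff\<close>)
    then have "ln (\<integral>x. exp (f n x) \<partial>\<mu>) \<le> ln (1 + exp (- real n))"
      using le less_le_trans[OF exp_gt_zero[of "- real n"]] by (subst ln_le_cancel_iff) (auto intro: add_pos_pos)
    also have "\<dots> \<le> exp (- real n)" by (rule ln_add_one_self_le_self) simp
    finally show ?thesis using dv[of "f n" n] fb[of n] by fastforce
  qed
  define neg where "neg x = max 0 (- ln (r x))" for x
  define ps where "ps x = max 0 (ln (r x))" for x
  have [measurable]: "neg \<in> borel_measurable \<mu>" "ps \<in> borel_measurable \<mu>" unfolding neg_def ps_def by measurable
  have ineg: "integrable \<rho> neg"
  proof -
    have "integrable \<mu> (\<lambda>x. r x * neg x)"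
      by (rule M.integrable_const_bound[of _ 1])
       (auto simp: abs_mult abs_of_nonneg r0 neg_def intro!: mult_neg_ln_le_one)
    then show ?thesis by (subst dens, subst integrable_density) (auto simp: r0)
  qed
  let ?K = "C + 1 + integral\<^sup>L \<rho> neg"
  have ipn: "integrable \<rho> (\<lambda>x. min (real n) (ps x))" for n
    by (rule R.integrable_const_bound[of _ n]) (auto simp: ps_def)
  \<comment> \<open>The bound is uniform in \<open>n\<close>, so that Fatou's lemma turns it into
    integrability of the positive part; only then can dominated convergence be used for the signed
    integrals.\<close>
  have Kb: "(\<integral>x. min (real n) (ps x) \<partial>\<rho>) \<le> ?K" for n
  proof -
    have ifn: "integrable \<rho> (f n)" by (rule R.integrable_const_bound[of _ n]) (use fb in auto)
    have "(\<integral>x. min (real n) (ps x) \<partial>\<rho>) \<le> (\<integral>x. f n x + neg x \<partial>\<rho>)"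
    proof (rule integral_mono_AE[OF ipn])
      show "AE x in \<rho>. min (real n) (ps x) \<le> f n x + neg x"
        using rpos by eventually_elim (auto simp: f_def ps_def neg_def)
    qed (use ifn ineg in auto)
    also have "\<dots> = (\<integral>x. f n x \<partial>\<rho>) + integral\<^sup>L \<rho> neg" using ifn ineg by simp
    also have "\<dots> \<le> ?K"
    proof -
      have "exp (- real n) \<le> 1" by simp
      then show ?thesis using fle[of n] by linarith
    qed
    finally show ?thesis .
  qed
  have lim_ps: "(\<lambda>n. min (real n) (ps x)) \<longlonglongrightarrow> ps x" for x
  proof (rule tendsto_eventually)
    obtain N where "ps x \<le> real N" using real_arch_simple by blast
    then show "\<forall>\<^sub>F n in sequentially. min (real n) (ps x) = ps x"
      by (intro eventually_sequentiallyI[of N]) auto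
  qed
  have ips: "integrable \<rho> ps"
  proof (rule integrableI_nonneg)
    have "(\<integral>\<^sup>+x. ennreal (ps x) \<partial>\<rho>) = (\<integral>\<^sup>+x. liminf (\<lambda>n. ennreal (min (real n) (ps x))) \<partial>\<rho>)"
      by (intro nn_integral_cong lim_imp_Liminf[symmetric] tendsto_ennrealI lim_ps) simp
    also have "\<dots> \<le> liminf (\<lambda>n. \<integral>\<^sup>+x. ennreal (min (real n) (ps x)) \<partial>\<rho>)"
      by (rule nn_integral_liminf) measurable
    also have "\<dots> \<le> liminf (\<lambda>n. ennreal ?K)"
    proof (intro Liminf_mono always_eventually allI)
      fix n
      have "(\<integral>\<^sup>+x. ennreal (min (real n) (ps x)) \<partial>\<rho>) = ennreal (\<integral>x. min (real n) (ps x) \<partial>\<rho>)"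
        by (rule nn_integral_eq_integral[OF ipn]) (auto simp: ps_def)
      also have "\<dots> \<le> ennreal ?K" by (intro ennreal_leI Kb)
      finally show "(\<integral>\<^sup>+x. ennreal (min (real n) (ps x)) \<partial>\<rho>) \<le> ennreal ?K" .
    qed
    finally show "(\<integral>\<^sup>+x. ennreal (ps x) \<partial>\<rho>) < \<infinity>" by (simp add: Liminf_const le_less_trans)
  qed (auto simp: ps_def)
  have "(\<lambda>x. ln (r x)) = (\<lambda>x. ps x - neg x)" by (auto simp: ps_def neg_def)
  then have il: "integrable \<rho> (\<lambda>x. ln (r x))" using ips ineg by simp
  have "(\<lambda>n. \<integral>x. f n x \<partial>\<rho>) \<longlonglongrightarrow> (\<integral>x. ln (r x) \<partial>\<rho>)"
  proof (rule integral_dominated_convergence[where w = "\<lambda>x. \<bar>ln (r x)\<bar>"])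
    show "AE x in \<rho>. (\<lambda>n. f n x) \<longlonglongrightarrow> ln (r x)"
      using rpos
    proof eventually_elim
      case (elim x)
      obtain N where "\<bar>ln (r x)\<bar> \<le> real N" using real_arch_simple by blast
      then show ?case using elim
        by (intro tendsto_eventually eventually_sequentiallyI[of N]) (auto simp: f_def)
    qed
    show "AE x in \<rho>. norm (f n x) \<le> \<bar>ln (r x)\<bar>" for n
      using rpos by eventually_elim (auto simp: f_def)
  qed (use il in auto)
  moreover have "(\<lambda>n. C + exp (- real n)) \<longlonglongrightarrow> C + 0"
    by (intro tendsto_intros filterlim_compose[OF exp_at_bot] filterlim_compose[OF filterlim_uminus_at_bot_at_top] filterlim_real_sequentially)
  ultimately have "(\<integral>x. ln (r x) \<partial>\<rho>) \<le> C"
    using fle by (auto intro!: LIMSEQ_le[of "\<lambda>n. \<integral>x. f n x \<partial>\<rho>"])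
  then show ?thesis unfolding Ent_def KL_divergence_def ed using ac il by simp
qed

section \<open>Global solutions of ordinary differential equations\<close>

lemma antiderivative_exists:
  fixes g :: "real \<Rightarrow> 'a::euclidean_space"
  assumes "continuous_on UNIV g"
  shows "\<exists>G. G 0 = 0 \<and> (\<forall>s. (G has_vector_derivative g s) (at s))"
proof -
  let ?G = "\<lambda>u::real. LBINT y=0..u. g y"
  show ?thesis
  proof (intro exI[of _ ?G] conjI allI)
  show "?G 0 = 0" by (simp flip: zero_ereal_def)
  fix s :: real
  have "((\<lambda>u. LBINT y=ereal 0..u. g y) has_vector_derivative g s) (at s within {- \<bar>s\<bar> - 1..\<bar>s\<bar> + 1})"
    by (rule interval_integral_FTC2) (use assms continuous_on_subset in auto)
  then show "(?G has_vector_derivative g s) (at s)"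
    by (simp add: at_within_Icc_at zero_ereal_def)
  qed
qed

text \<open>Negative times are reflected to positive ones. The comparison function is evaluated at
  the absolute value of the time, so it has to be differentiable only on the open half-line.\<close>

lemma vector_derivative_bound:
  fixes G :: "real \<Rightarrow> 'a::real_normed_vector"
  assumes "G 0 = 0" and "\<And>s. (G has_vector_derivative g s) (at s)" and "continuous_on UNIV g"
    and phi: "\<And>s. 0 < s \<Longrightarrow> (\<phi> has_vector_derivative \<phi>' s) (at s)" "continuous_on {0..} \<phi>"
    and bound: "\<And>s. norm (g s) \<le> \<phi>' \<bar>s\<bar>"
  shows "norm (G s) \<le> \<phi> \<bar>s\<bar> - \<phi> 0"
proof -
  consider "s = 0" | "0 < s" | "s < 0" by linarith
  then show ?thesis
  proof cases
    case 2
    have "norm (G s - G 0) \<le> \<phi> s - \<phi> 0"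
    proof (rule differentiable_bound_general[OF 2])
      show "continuous_on {0..s} G"
        using assms(2) by (meson continuous_at_imp_continuous_on has_vector_derivative_continuous)
      show "continuous_on {0..s} \<phi>" using phi(2) by (rule continuous_on_subset) auto
      show "norm (g x) \<le> \<phi>' x" if "0 < x" for x using bound[of x] that by simp
    qed (use assms in auto)
    then show ?thesis using 2 assms(1) by simp
  next
    case 3
    then have pos: "0 < - s" by simp
    have der: "((\<lambda>r. G (- r)) has_vector_derivative - g (- x)) (at x)" for x
    proof -
      have "(uminus has_vector_derivative (-1::real)) (at x)" by (auto intro!: derivative_eq_intros)
      from vector_diff_chain_at[OF this, of G "g (- x)"] show ?thesis using assms(2)[of "- x"] by (simp add: o_def)
    qed
    have "norm (G (- (- s)) - G (- 0)) \<le> \<phi> (- s) - \<phi> 0"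
    proof (rule differentiable_bound_general[OF pos])
      show "continuous_on {0..- s} (\<lambda>r. G (- r))"
        using der by (meson continuous_at_imp_continuous_on has_vector_derivative_continuous)
      show "continuous_on {0..- s} \<phi>" using phi(2) by (rule continuous_on_subset) auto
      show "norm (- g (- x)) \<le> \<phi>' x" if "0 < x" for x using bound[of "- x"] that by simp
    qed (use der phi in auto)
    then show ?thesis using 3 assms(1) by simp
  qed (use assms(1) in simp)
qed

text \<open>Picard iteration for \<open>y s = exp (- 2 \<bar>s\<bar>) (c s - y\<^sub>0)\<close> is a contraction of the bounded continuous
  functions on the whole line, so that no continuation argument is needed.\<close>

lemma global_solution:
  fixes f :: "real \<Rightarrow> 'a::euclidean_space \<Rightarrow> 'a"
  assumes cont: "continuous_on UNIV (\<lambda>p. f (fst p) (snd p))"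
    and lip: "\<And>s y y'. norm (f s y - f s y') \<le> norm (y - y')"
    and bd: "\<And>s. norm (f s y0) \<le> M"
  shows "\<exists>c. c 0 = y0 \<and> (\<forall>s. (c has_vector_derivative f s (c s)) (at s))"
proof -
  \<comment> \<open>The rate 2 is twice the Lipschitz constant of \<open>f\<close>: integrating
    \<open>exp (2 * r)\<close> produces a factor 1/2, which becomes the contraction
    constant.\<close>
  define w :: "real \<Rightarrow> real" where "w s = exp (2 * \<bar>s\<bar>)" for s
  have wc: "continuous_on UNIV w" unfolding w_def by (intro continuous_intros)
  have wpos: "0 < w s" for s by (simp add: w_def)
  have M0: "0 \<le> M" using bd[of 0] norm_ge_zero order_trans by blast
  define g where "g y r = f r (y0 + w r *\<^sub>R apply_bcontfun y r)" for y :: "real \<Rightarrow>\<^sub>C 'a" and r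
  have gc: "continuous_on UNIV (g y)" for y
    unfolding g_def
    by (rule continuous_on_compose2[OF cont, of UNIV "\<lambda>r. (r, y0 + w r *\<^sub>R apply_bcontfun y r)", simplified])
      (intro continuous_intros wc continuous_on_apply_bcontfun)
  define G where "G y = (SOME G. G 0 = 0 \<and> (\<forall>s. (G has_vector_derivative g y s) (at s)))" for y
  have G: "G y 0 = 0" "(G y has_vector_derivative g y s) (at s)" for y s
    using someI_ex[OF antiderivative_exists[OF gc[of y]]] unfolding G_def by auto
  have Gc: "continuous_on UNIV (G y)" for y
    using G(2) by (meson continuous_at_imp_continuous_on has_vector_derivative_continuous)
  have wd: "((\<lambda>s. C * exp (2 * s) / 2) has_vector_derivative C * exp (2 * s)) (at s)" for C s :: real
    by (auto intro!: derivative_eq_intros simp: has_real_derivative_iff_has_vector_derivative[symmetric])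
  have Gb: "norm (G y s) \<le> (M + norm y) * w s / 2" for y s
  proof -
    have "norm (g y r) \<le> (M + norm y) * exp (2 * \<bar>r\<bar>)" for r
    proof -
      have "norm (g y r) \<le> norm (f r y0) + norm (g y r - f r y0)" by norm
      also have "\<dots> \<le> M + norm (w r *\<^sub>R apply_bcontfun y r)"
        using bd[of r] lip[of r "y0 + w r *\<^sub>R apply_bcontfun y r" y0] by (simp add: g_def)
      also have "\<dots> \<le> M * w r + w r * norm y"
        using wpos[of r] norm_bounded[of y r] M0
        by (intro add_mono) (auto simp: w_def mult_le_cancel_left1)
      finally show ?thesis by (simp add: w_def algebra_simps)
    qed
    then have "norm (G y s) \<le> (M + norm y) * exp (2 * \<bar>s\<bar>) / 2 - (M + norm y) * exp (2 * 0) / 2"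
      by (intro vector_derivative_bound[OF G gc, where \<phi>="\<lambda>s. (M + norm y) * exp (2 * s) / 2" and \<phi>'="\<lambda>s. (M + norm y) * exp (2 * s)"])
        (auto intro!: continuous_intros wd)
    then have "norm (G y s) \<le> (M + norm y) * exp (2 * \<bar>s\<bar>) / 2 - (M + norm y) / 2" by simp
    moreover have "0 \<le> (M + norm y) / 2" using M0 by simp
    moreover have "p \<le> q - r \<Longrightarrow> 0 \<le> r \<Longrightarrow> p \<le> q" for p q r :: real by linarith
    ultimately show ?thesis unfolding w_def by blast
  qed
  define T where "T y = Bcontfun (\<lambda>s. (1 / w s) *\<^sub>R G y s)" for y
  have inB: "(\<lambda>s. (1 / w s) *\<^sub>R G y s) \<in> bcontfun" for y
    unfolding bcontfun_def mem_Collect_eq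
  proof
    show "continuous_on UNIV (\<lambda>s. (1 / w s) *\<^sub>R G y s)"
      using wpos by (intro continuous_intros wc Gc) (auto simp: less_imp_neq[symmetric] order_less_imp_not_eq2)
    show "bounded (range (\<lambda>s. (1 / w s) *\<^sub>R G y s))"
      unfolding bounded_iff
    proof (intro exI[of _ "(M + norm y) / 2"] ballI)
      fix v assume "v \<in> range (\<lambda>s. (1 / w s) *\<^sub>R G y s)"
      then obtain s where v: "v = (1 / w s) *\<^sub>R G y s" by auto
      have "norm v = norm (G y s) / w s" using wpos[of s] by (simp add: v)
      also have "\<dots> \<le> (M + norm y) / 2" using Gb[of y s] wpos[of s] by (simp add: divide_le_eq mult.commute)
      finally show "norm v \<le> (M + norm y) / 2" .
    qed
  qed
  have Tap: "apply_bcontfun (T y) s = (1 / w s) *\<^sub>R G y s" for y s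
    unfolding T_def by (simp add: Bcontfun_inverse[OF inB])
  have contr: "dist (T y) (T z) \<le> 1 / 2 * dist y z" for y z
  proof (rule dist_bound)
    fix s
    have "norm (g y r - g z r) \<le> dist y z * exp (2 * \<bar>r\<bar>)" for r
    proof -
      have "norm (g y r - g z r) \<le> norm (w r *\<^sub>R (apply_bcontfun y r - apply_bcontfun z r))"
        unfolding g_def using lip by (simp add: algebra_simps) (metis add_diff_cancel_left lip)
      also have "\<dots> \<le> w r * dist y z"
        using wpos[of r] dist_bounded[of y r z] by (simp add: dist_norm)
      finally show ?thesis by (simp add: w_def mult.commute)
    qed
    then have "norm (G y s - G z s) \<le> dist y z * exp (2 * \<bar>s\<bar>) / 2 - dist y z * exp (2 * 0) / 2"
      by (intro vector_derivative_bound[where G="\<lambda>s. G y s - G z s" and g="\<lambda>s. g y s - g z s" and \<phi>="\<lambda>s. dist y z * exp (2 * s) / 2" and \<phi>'="\<lambda>s. dist y z * exp (2 * s)"] wd)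
        (auto intro!: continuous_intros derivative_intros G gc simp: G(1))
    then have "norm (G y s - G z s) \<le> dist y z * exp (2 * \<bar>s\<bar>) / 2 - dist y z / 2" by simp
    moreover have "p \<le> q - r \<Longrightarrow> 0 \<le> r \<Longrightarrow> p \<le> q" for p q r :: real by linarith
    ultimately have "norm (G y s - G z s) \<le> dist y z * w s / 2"
      unfolding w_def by (metis zero_le_dist divide_nonneg_nonneg zero_le_numeral)
    have "dist (apply_bcontfun (T y) s) (apply_bcontfun (T z) s) = norm ((1 / w s) *\<^sub>R (G y s - G z s))"
      by (simp only: Tap dist_norm scaleR_diff_right)
    also have "\<dots> = norm (G y s - G z s) / w s" using wpos[of s] by simp
    also have "\<dots> \<le> 1 / 2 * dist y z"
      using wpos[of s] \<open>norm (G y s - G z s) \<le> dist y z * w s / 2\<close> by (simp add: divide_le_eq mult_ac)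
    finally show "dist (apply_bcontfun (T y) s) (apply_bcontfun (T z) s) \<le> 1 / 2 * dist y z" .
  qed
  obtain y where y: "T y = y"
    using banach_fix_type[of "1/2" T] contr by auto
  define c where "c s = y0 + G y s" for s
  have eq: "c s = y0 + w s *\<^sub>R apply_bcontfun y s" for s
    using Tap[of y s] wpos[of s] unfolding y c_def by simp
  have "(c has_vector_derivative f s (c s)) (at s)" for s
  proof -
    have "(c has_vector_derivative g y s) (at s)"
      unfolding c_def by (auto intro!: derivative_eq_intros G)
    then show ?thesis unfolding g_def eq[symmetric] .
  qed
  moreover have "c 0 = y0" by (simp add: c_def G)
  ultimately show ?thesis by blast
qed

text \<open>The function \<open>exp (- 2 * s) * (d s \<bullet> d s)\<close> is nonincreasing. The
  inner product is differentiated instead of the norm, which is not smooth at zero.\<close>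

lemma gronwall:
  fixes d :: "real \<Rightarrow> 'a::real_inner"
  assumes d: "\<And>s. (d has_vector_derivative d' s) (at s)" and le: "\<And>s. norm (d' s) \<le> norm (d s)"
    and s: "0 \<le> s"
  shows "norm (d s) \<le> exp s * norm (d 0)"
proof -
  let ?\<phi> = "\<lambda>s. exp (- 2 * s) * (d s \<bullet> d s)"
  have der: "(?\<phi> has_real_derivative exp (- 2 * r) * (2 * (d r \<bullet> d' r) - 2 * (d r \<bullet> d r))) (at r)" for r
  proof -
    have "((\<lambda>r. d r \<bullet> d r) has_real_derivative 2 * (d r \<bullet> d' r)) (at r)"
      using bounded_bilinear.has_vector_derivative[OF bounded_bilinear_inner d[of r] d[of r]]
      by (simp add: has_real_derivative_iff_has_vector_derivative inner_commute)
    then show ?thesis by (auto intro!: derivative_eq_intros simp: algebra_simps)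
  qed
  have "?\<phi> s \<le> ?\<phi> 0"
  proof (rule DERIV_nonpos_imp_nonincreasing[OF s])
    fix r
    have "d r \<bullet> d' r \<le> norm (d r) * norm (d r)"
      using norm_cauchy_schwarz[of "d r" "d' r"] mult_left_mono[OF le[of r] norm_ge_zero[of "d r"]] by linarith
    then have "exp (- 2 * r) * (2 * (d r \<bullet> d' r) - 2 * (d r \<bullet> d r)) \<le> 0"
      by (intro mult_nonneg_nonpos) (auto simp: power2_norm_eq_inner[symmetric] power2_eq_square)
    then show "\<exists>y. (?\<phi> has_real_derivative y) (at r) \<and> y \<le> 0" using der by blast
  qed
  then have "exp (- 2 * s) * (norm (d s))\<^sup>2 \<le> (norm (d 0))\<^sup>2"
    by (simp add: power2_norm_eq_inner)
  then have "(norm (d s))\<^sup>2 \<le> exp (2 * s) * (norm (d 0))\<^sup>2"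
    by (simp add: exp_minus field_simps)
  also have "\<dots> = (exp s * norm (d 0))\<^sup>2" by (simp add: power_mult_distrib exp_double)
  finally show ?thesis by (simp add: power2_le_iff_abs_le)
qed

section \<open>The Hamiltonian flow\<close>

lemma norm_matrix_vector_le: "norm (A *v x) \<le> norm A * norm x" for A :: "real^'n^'m"
proof -
  have "(norm (A *v x))\<^sup>2 = (\<Sum>i\<in>UNIV. (A $ i \<bullet> x)\<^sup>2)"
    by (simp add: norm_vec_def L2_set_def sum_nonneg matrix_vector_mul_component)
  also have "\<dots> \<le> (\<Sum>i\<in>UNIV. (norm (A $ i))\<^sup>2 * (norm x)\<^sup>2)"
    by (intro sum_mono) (metis Cauchy_Schwarz_ineq2 abs_le_square_iff abs_mult abs_norm_cancel power_mult_distrib)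
  also have "\<dots> = (norm A * norm x)\<^sup>2"
    by (simp add: norm_vec_def[of A] L2_set_def sum_nonneg power_mult_distrib flip: sum_distrib_right)
  finally show ?thesis by (simp add: power2_le_iff_abs_le)
qed

text \<open>\<open>gradient\<close> is a definite description: existence comes from representing the
  derivative in the standard basis, uniqueness from testing against all vectors.\<close>

lemma GDERIV_gradient:
  fixes f :: "'a::euclidean_space \<Rightarrow> real"
  assumes "f differentiable (at x)"
  shows "GDERIV f x :> gradient f x"
proof -
  obtain f' where f': "(f has_derivative f') (at x)" using assms unfolding differentiable_def by blast
  then interpret bounded_linear f' by (rule has_derivative_bounded_linear)
  define D where "D = (\<Sum>b\<in>Basis. f' b *\<^sub>R b)"
  have "f' h = h \<bullet> D" for h
  proof -
    have "f' h = f' (\<Sum>b\<in>Basis. (h \<bullet> b) *\<^sub>R b)" by (simp add: euclidean_representation)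
    then show ?thesis by (simp add: D_def sum scaleR inner_sum_right mult.commute)
  qed
  then have "f' = (\<lambda>h. h \<bullet> D)" by (rule ext)
  then have D: "GDERIV f x :> D" using f' by (simp add: gderiv_def)
  show ?thesis unfolding gradient_def
  proof (rule theI2[where a = D])
    fix D' assume D': "GDERIV f x :> D'"
    have "(\<lambda>h. h \<bullet> D') = (\<lambda>h. h \<bullet> D)"
      by (rule has_derivative_unique[OF D'[unfolded gderiv_def] D[unfolded gderiv_def]])
    then have "\<forall>h. h \<bullet> D' = h \<bullet> D" by (simp add: fun_eq_iff)
    then show "D' = D" by (simp only: vector_eq_ldot)
  qed (use D in auto)
qed

locale potential =
  fixes U :: "real^'d \<Rightarrow> real" and L :: real
  assumes C2: "C2 U"
    and hess_bound: "\<And>x. operator_norm (hessian U x) \<le> 1"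
    and L: "0 < L"
    and hess_Lipschitz: "\<And>x x'. frobenius_norm (hessian U x - hessian U x') \<le> L * norm (x - x')"
begin

abbreviation "g \<equiv> gradient U"
abbreviation "H \<equiv> hessian U"

lemma U_derivative: "(U has_derivative (\<lambda>h. h \<bullet> g x)) (at x)"
  using GDERIV_gradient[of U x] C2 unfolding C2_def gderiv_def by simp

lemma g_derivative: "(g has_derivative (*v) (H x)) (at x)"
  using C2 unfolding C2_def hessian_def by (simp add: jacobian_works)

lemma H_continuous: "continuous_on UNIV H"
  using C2 unfolding C2_def by simp

lemma H_bound: "norm (H x *v h) \<le> norm h"
  using onorm[OF matrix_vector_mul_bounded_linear, of "H x" h] mult_right_mono[OF hess_bound[of x] norm_ge_zero[of h]]
  by (simp add: operator_norm_def)

lemma g_Lipschitz: "norm (g x - g y) \<le> norm (x - y)"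
proof -
  have "norm (g x - g y) \<le> 1 * norm (x - y)"
    by (rule differentiable_bound[of UNIV g "\<lambda>x. (*v) (H x)"])
      (use g_derivative hess_bound in \<open>auto simp: operator_norm_def\<close>)
  then show ?thesis by simp
qed

lemma g_continuous: "continuous_on UNIV g"
  using g_derivative by (meson continuous_at_imp_continuous_on has_derivative_continuous)

lemma H_Lipschitz: "norm (H x - H y) \<le> L * norm (x - y)"
proof -
  have "norm (H x - H y) = frobenius_norm (H x - H y)"
    by (simp add: frobenius_norm_def norm_vec_def L2_set_def sum_nonneg)
  then show ?thesis using hess_Lipschitz[of x y] by simp
qed

text \<open>The mean value inequality for \<open>g z - H x *v z\<close> on the ball of radius
  \<open>norm h\<close> about \<open>x\<close>, where the Lipschitz Hessian makes the derivative at
  most \<open>L * norm h\<close>.\<close>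

lemma g_Taylor: "norm (g (x + h) - g x - H x *v h) \<le> L * (norm h)\<^sup>2"
proof -
  let ?f = "\<lambda>z. g z - H x *v z"
  have "norm (?f (x + h) - ?f x) \<le> (L * norm h) * norm (x + h - x)"
  proof (rule differentiable_bound[of "cball x (norm h)" ?f "\<lambda>z k. (H z - H x) *v k"])
    fix z assume z: "z \<in> cball x (norm h)"
    show "(?f has_derivative (\<lambda>k. (H z - H x) *v k)) (at z within cball x (norm h))"
      unfolding matrix_vector_mult_diff_rdistrib
      by (rule has_derivative_at_withinI[OF has_derivative_diff[OF g_derivative
            bounded_linear_imp_has_derivative[OF matrix_vector_mul_bounded_linear]]])
    show "onorm (\<lambda>k. (H z - H x) *v k) \<le> L * norm h"
    proof (rule onorm_le)
      fix k
      have "norm ((H z - H x) *v k) \<le> norm (H z - H x) * norm k" by (rule norm_matrix_vector_le)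
      also have "\<dots> \<le> (L * norm h) * norm k"
      proof (rule mult_right_mono)
        have "norm (z - x) \<le> norm h" using z by (simp add: dist_norm norm_minus_commute)
        then have "L * norm (z - x) \<le> L * norm h" using L by (intro mult_left_mono) auto
        then show "norm (H z - H x) \<le> L * norm h" using H_Lipschitz[of z x] by linarith
      qed simp
      finally show "norm ((H z - H x) *v k) \<le> L * norm h * norm k" .
    qed
  qed (auto simp: dist_norm)
  then show ?thesis by (simp add: matrix_vector_right_distrib algebra_simps power2_eq_square)
qed

definition field :: "(real^'d) \<times> (real^'d) \<Rightarrow> (real^'d) \<times> (real^'d)" where
  "field z = (snd z, - g (fst z))"

lemma field_continuous: "continuous_on UNIV field"
  unfolding field_def by (intro continuous_intros continuous_on_compose2[OF g_continuous]) auto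

lemma field_Lipschitz: "norm (field z - field z') \<le> norm (z - z')"
proof -
  have "(norm (field z - field z'))\<^sup>2 \<le> (norm (z - z'))\<^sup>2"
    using power_mono[OF g_Lipschitz[of "fst z'" "fst z"], of 2]
    by (simp add: field_def norm_prod_def norm_minus_commute)
  then show ?thesis by simp
qed

lemma trajectory_iff: "hamiltonian_trajectory U z c \<longleftrightarrow>
    c 0 = z \<and> (\<forall>s. (c has_vector_derivative field (c s)) (at s))"
proof -
  have "(c has_vector_derivative field (c s)) (at s) \<longleftrightarrow>
    ((\<lambda>r. fst (c r)) has_vector_derivative snd (c s)) (at s) \<and>
    ((\<lambda>r. snd (c r)) has_vector_derivative - g (fst (c s))) (at s)" (is "?l \<longleftrightarrow> ?r") for s
  proof
    assume ?l
    then have d: "(c has_derivative (\<lambda>x. x *\<^sub>R field (c s))) (at s)" by (simp add: has_vector_derivative_def)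
    show ?r using has_derivative_fst[OF d] has_derivative_snd[OF d]
      by (simp add: has_vector_derivative_def field_def)
  next
    assume ?r
    then have "((\<lambda>r. (fst (c r), snd (c r))) has_vector_derivative (snd (c s), - g (fst (c s)))) (at s)"
      by (intro has_vector_derivative_Pair) auto
    then show ?l by (simp add: field_def)
  qed
  then show ?thesis unfolding hamiltonian_trajectory_def by auto
qed

text \<open>Gronwall covers forward times; reversing time only changes the sign of the field, which
  stays 1-Lipschitz.\<close>

lemma trajectory_diff_bound:
  assumes c: "\<And>s. (c has_vector_derivative field (c s)) (at s)"
    and d: "\<And>s. (d has_vector_derivative field (d s)) (at s)"
  shows "norm (c s - d s) \<le> exp \<bar>s\<bar> * norm (c 0 - d 0)"
proof (cases "0 \<le> s")
  case True
  show ?thesis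
    using gronwall[of "\<lambda>s. c s - d s" "\<lambda>s. field (c s) - field (d s)", OF _ field_Lipschitz True] True c d
    by (auto intro: has_vector_derivative_diff)
next
  case False
  have rev: "((\<lambda>r. c (- r)) has_vector_derivative - field (c (- r))) (at r)"
    if "\<And>s. (c has_vector_derivative field (c s)) (at s)" for c r
  proof -
    have "(uminus has_vector_derivative (-1::real)) (at r)" by (auto intro!: derivative_eq_intros)
    from vector_diff_chain_at[OF this, of c "field (c (- r))"] show ?thesis using that[of "- r"] by (simp add: o_def)
  qed
  have *: "((\<lambda>s. c (- s) - d (- s)) has_vector_derivative - field (c (- s)) - - field (d (- s))) (at s)" for s
    by (intro has_vector_derivative_diff rev c d)
  have "norm (c (- (- s)) - d (- (- s))) \<le> exp (- s) * norm (c (- 0) - d (- 0))"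
    by (rule gronwall[OF *]) (use False field_Lipschitz[of "d _" "c _"] in \<open>auto simp: norm_minus_commute\<close>)
  then show ?thesis using False by simp
qed

lemma trajectory_exists_unique: "\<exists>!c. hamiltonian_trajectory U z c"
proof -
  have "continuous_on UNIV (\<lambda>p :: real \<times> _. field (snd p))"
    by (rule continuous_on_compose2[OF field_continuous]) (auto intro: continuous_intros)
  then have "\<exists>c. c 0 = z \<and> (\<forall>s. (c has_vector_derivative field (c s)) (at s))"
    by (intro global_solution[of "\<lambda>_. field" z "norm (field z)"] field_Lipschitz) auto
  moreover have "c = d" if "hamiltonian_trajectory U z c" "hamiltonian_trajectory U z d" for c d
  proof
    fix s
    have "norm (c s - d s) \<le> exp \<bar>s\<bar> * norm (c 0 - d 0)"
      by (rule trajectory_diff_bound) (use that in \<open>auto simp: trajectory_iff\<close>)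
    moreover have "c 0 = d 0" using that by (simp add: trajectory_iff)
    ultimately show "c s = d s" by simp
  qed
  ultimately show ?thesis unfolding trajectory_iff by blast
qed

abbreviation "\<Phi> \<equiv> hamiltonian_flow U"

lemma flow_trajectory: "hamiltonian_trajectory U z (\<lambda>s. \<Phi> s z)"
  using theI'[OF trajectory_exists_unique[of z]] unfolding hamiltonian_flow_def by simp

lemma flow_0[simp]: "\<Phi> 0 z = z"
  using flow_trajectory unfolding trajectory_iff by blast

lemma flow_derivative: "((\<lambda>s. \<Phi> s z) has_vector_derivative field (\<Phi> s z)) (at s)"
  using flow_trajectory unfolding trajectory_iff by blast

lemma flow_fst: "((\<lambda>s. fst (\<Phi> s z)) has_vector_derivative snd (\<Phi> s z)) (at s)"
  and flow_snd: "((\<lambda>s. snd (\<Phi> s z)) has_vector_derivative - g (fst (\<Phi> s z))) (at s)"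
  using flow_trajectory unfolding hamiltonian_trajectory_def by blast+

lemma flow_Lipschitz: "norm (\<Phi> s z - \<Phi> s z') \<le> exp \<bar>s\<bar> * norm (z - z')"
  using trajectory_diff_bound[of "\<lambda>s. \<Phi> s z" "\<lambda>s. \<Phi> s z'"] flow_derivative by simp

lemma flow_continuous: "continuous_on UNIV (\<Phi> s)"
proof (rule lipschitz_on_continuous_on)
  show "(exp \<bar>s\<bar>)-lipschitz_on UNIV (\<Phi> s)"
    by (rule lipschitz_onI) (use flow_Lipschitz in \<open>auto simp: dist_norm\<close>)
qed

lemma flow_measurable[measurable]: "\<Phi> s \<in> borel_measurable borel"
  by (intro borel_measurable_continuous_onI flow_continuous)

lemma flow_add: "\<Phi> (s + r) z = \<Phi> s (\<Phi> r z)"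
proof -
  have "((\<lambda>s. \<Phi> (s + r) z) has_vector_derivative field (\<Phi> (s + r) z)) (at s)" for s
  proof -
    have "((\<lambda>s. s + r) has_vector_derivative 1) (at s)" by (auto intro!: derivative_eq_intros)
    from vector_diff_chain_at[OF this, of "\<lambda>s. \<Phi> s z"] flow_derivative show ?thesis by (simp add: o_def)
  qed
  then have "norm (\<Phi> (s + r) z - \<Phi> s (\<Phi> r z)) \<le> exp \<bar>s\<bar> * norm (\<Phi> (0 + r) z - \<Phi> 0 (\<Phi> r z))"
    using trajectory_diff_bound[of "\<lambda>s. \<Phi> (s + r) z" "\<lambda>s. \<Phi> s (\<Phi> r z)"] flow_derivative by simp
  then show ?thesis by simp
qed

definition energy :: "(real^'d) \<times> (real^'d) \<Rightarrow> real" where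
  "energy z = U (fst z) + (norm (snd z))\<^sup>2 / 2"

text \<open>Together with the preservation of Lebesgue measure this yields invariance of the target,
  whose density depends on the energy alone.\<close>

lemma energy_flow: "energy (\<Phi> s z) = energy z"
proof -
  have "((\<lambda>s. energy (\<Phi> s z)) has_real_derivative 0) (at s)" for s
  proof -
    have 1: "((\<lambda>s. U (fst (\<Phi> s z))) has_vector_derivative snd (\<Phi> s z) \<bullet> g (fst (\<Phi> s z))) (at s)"
      by (rule vector_derivative_diff_chain_within[OF flow_fst has_derivative_at_withinI[OF U_derivative], unfolded o_def])
    have "((\<lambda>r. snd (\<Phi> r z) \<bullet> snd (\<Phi> r z)) has_vector_derivative
        snd (\<Phi> s z) \<bullet> - g (fst (\<Phi> s z)) + - g (fst (\<Phi> s z)) \<bullet> snd (\<Phi> s z)) (at s)"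
      by (rule bounded_bilinear.has_vector_derivative[OF bounded_bilinear_inner flow_snd flow_snd])
    then have 2: "((\<lambda>r. snd (\<Phi> r z) \<bullet> snd (\<Phi> r z)) has_real_derivative - 2 * (snd (\<Phi> s z) \<bullet> g (fst (\<Phi> s z)))) (at s)"
      by (simp add: has_real_derivative_iff_has_vector_derivative inner_commute)
    show ?thesis unfolding energy_def power2_norm_eq_inner
      using 1 2 by (auto intro!: derivative_eq_intros simp: has_real_derivative_iff_has_vector_derivative[symmetric])
  qed
  then have "energy (\<Phi> s z) = energy (\<Phi> 0 z)"
    by (intro DERIV_isconst_all) auto
  then show ?thesis by simp
qed

end

section \<open>A priori bounds for first- and second-order equations\<close>

lemma first_order_bound:
  fixes y :: "real \<Rightarrow> 'a::real_normed_vector"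
  assumes y: "\<And>s. (y has_vector_derivative y' s) (at s)"
    and B: "\<And>s. 0 \<le> s \<Longrightarrow> s \<le> t \<Longrightarrow> norm (y' s) \<le> B"
    and s: "0 \<le> s" "s \<le> t"
  shows "norm (y s - y 0) \<le> B * s"
proof (cases "s = 0")
  case False
  then have "0 < s" using s by simp
  moreover have "continuous_on A y" for A
    using y by (meson continuous_at_imp_continuous_on has_vector_derivative_continuous)
  ultimately have "norm (y s - y 0) \<le> B * s - B * 0"
    by (rule differentiable_bound_general[where f'=y' and \<phi>="\<lambda>s. B * s" and \<phi>'="\<lambda>_. B"])
      (use y B s in \<open>auto intro!: continuous_intros derivative_eq_intros simp flip: has_real_derivative_iff_has_vector_derivative\<close>)
  then show ?thesis by simp
qed simp

lemma second_order_bound: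
  fixes y :: "real \<Rightarrow> 'a::real_normed_vector"
  assumes y: "\<And>s. (y has_vector_derivative y' s) (at s)"
    and y': "\<And>s. (y' has_vector_derivative y'' s) (at s)"
    and B: "\<And>s. 0 \<le> s \<Longrightarrow> s \<le> t \<Longrightarrow> norm (y'' s) \<le> B"
    and s: "0 \<le> s" "s \<le> t"
  shows "norm (y' s - y' 0) \<le> B * s" and "norm (y s - y 0 - s *\<^sub>R y' 0) \<le> B * s\<^sup>2 / 2"
proof -
  have c: "continuous_on A y" for A
    using y by (meson continuous_at_imp_continuous_on has_vector_derivative_continuous)
  have vel: "norm (y' s - y' 0) \<le> B * s" if "0 \<le> s" "s \<le> t" for s
    using first_order_bound[OF y' B that] by simp
  show "norm (y' s - y' 0) \<le> B * s" using vel s .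
  show "norm (y s - y 0 - s *\<^sub>R y' 0) \<le> B * s\<^sup>2 / 2"
  proof (cases "s = 0")
    case False
    then have "0 < s" using s by simp
    then have "norm ((y s - s *\<^sub>R y' 0) - (y 0 - 0 *\<^sub>R y' 0)) \<le> B * s\<^sup>2 / 2 - B * 0\<^sup>2 / 2"
    proof (rule differentiable_bound_general[where f'="\<lambda>r. y' r - y' 0" and \<phi>="\<lambda>s. B * s\<^sup>2 / 2" and \<phi>'="\<lambda>s. B * s"])
      fix r assume r: "0 < r" "r < s"
      show "((\<lambda>s. y s - s *\<^sub>R y' 0) has_vector_derivative y' r - y' 0) (at r)"
        by (auto intro!: derivative_eq_intros y)
      show "((\<lambda>s. B * s\<^sup>2 / 2) has_vector_derivative B * r) (at r)"
        by (auto intro!: derivative_eq_intros simp flip: has_real_derivative_iff_has_vector_derivative)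
      show "norm (y' r - y' 0) \<le> B * r" using vel r s by simp
    qed (auto intro!: continuous_intros c)
    then show ?thesis by (simp add: algebra_simps)
  qed simp
qed

text \<open>The maximum of the norm over \<open>{0..t}\<close> is attained, so the hypothesis can be
  used with \<open>M\<close> equal to it and the term \<open>c * M\<close> absorbed on the
  left.\<close>

lemma sup_bound:
  fixes y :: "real \<Rightarrow> 'a::real_normed_vector"
  assumes "continuous_on {0..t} y" "0 \<le> t"
    and le: "\<And>s M. 0 \<le> s \<Longrightarrow> s \<le> t \<Longrightarrow> (\<And>r. 0 \<le> r \<Longrightarrow> r \<le> t \<Longrightarrow> norm (y r) \<le> M) \<Longrightarrow> norm (y s) \<le> N + c * M"
    and c: "c < 1" and s: "0 \<le> s" "s \<le> t"
  shows "norm (y s) \<le> N / (1 - c)"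
proof -
  have "\<exists>x\<in>{0..t}. \<forall>r\<in>{0..t}. norm (y r) \<le> norm (y x)"
    by (rule continuous_attains_sup) (use assms in \<open>auto intro!: continuous_intros\<close>)
  then obtain x where x: "0 \<le> x" "x \<le> t" and m: "\<And>r. 0 \<le> r \<Longrightarrow> r \<le> t \<Longrightarrow> norm (y r) \<le> norm (y x)" by auto
  have "norm (y x) \<le> N + c * norm (y x)" by (rule le[OF x m])
  then have "norm (y x) \<le> N / (1 - c)" using c by (simp add: field_simps)
  then show ?thesis using m[OF s] by simp
qed

text \<open>The second derivative is controlled by \<open>y\<close> itself, so the quadratic
  remainder returns a multiple of the maximum of \<open>y\<close>. At \<open>t = 1/4\<close> the
  multiple \<open>t\<^sup>2 / 2\<close> is 1/32, and absorbing it gives the factor 32/31.\<close>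

lemma second_order_self_bound:
  fixes y :: "real \<Rightarrow> 'a::real_normed_vector"
  assumes y: "\<And>s. (y has_vector_derivative y' s) (at s)"
    and y': "\<And>s. (y' has_vector_derivative y'' s) (at s)"
    and B: "\<And>s. 0 \<le> s \<Longrightarrow> s \<le> t \<Longrightarrow> norm (y'' s) \<le> norm (y s) + B" "0 \<le> B"
    and t: "t \<le> 1/4"
    and N: "\<And>s. 0 \<le> s \<Longrightarrow> s \<le> t \<Longrightarrow> norm (y 0 + s *\<^sub>R y' 0) \<le> N"
    and s: "0 \<le> s" "s \<le> t"
  shows "norm (y s) \<le> 32/31 * (N + B * t\<^sup>2 / 2)"
proof -
  have t2: "t\<^sup>2 \<le> 1/16" using power_mono[of t "1/4" 2] t s by (simp add: power2_eq_square)
  have "norm (y s) \<le> (N + B * t\<^sup>2 / 2) / (1 - 1/32)"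
  proof (rule sup_bound[OF _ _ _ _ s])
    show "continuous_on {0..t} y"
      using y by (meson continuous_at_imp_continuous_on has_vector_derivative_continuous)
    fix s M assume s: "0 \<le> s" "s \<le> t" and M: "\<And>r. 0 \<le> r \<Longrightarrow> r \<le> t \<Longrightarrow> norm (y r) \<le> M"
    have M0: "0 \<le> M" using M[OF s] norm_ge_zero order_trans by blast
    have "norm (y s - y 0 - s *\<^sub>R y' 0) \<le> (M + B) * s\<^sup>2 / 2"
      by (rule second_order_bound(2)[OF y y' _ s]) (use B M in fastforce)
    also have "\<dots> \<le> (M + B) * t\<^sup>2 / 2"
      using s B M0 by (intro divide_right_mono mult_left_mono power_mono) auto
    finally have "norm (y s) \<le> N + (M + B) * t\<^sup>2 / 2"
      using N[OF s] norm_triangle_ineq[of "y 0 + s *\<^sub>R y' 0" "y s - y 0 - s *\<^sub>R y' 0"] by simp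
    moreover have "M * t\<^sup>2 / 2 \<le> 1/32 * M" using mult_left_mono[OF t2 M0] by simp
    ultimately show "norm (y s) \<le> (N + B * t\<^sup>2 / 2) + 1/32 * M" by (simp add: algebra_simps add_divide_distrib)
  qed (use s in auto)
  then show ?thesis by simp
qed

section \<open>The linearised flow and its dependence on the initial data\<close>

lemma bounded_linear_mult_vec: "bounded_linear (\<lambda>A::real^'n^'m. A *v h)"
proof (rule bounded_linear_intro[of _ "norm h"])
  show "(r *\<^sub>R A) *v h = r *\<^sub>R (A *v h)" for r and A :: "real^'n^'m"
    by (simp add: matrix_vector_mult_def vec_eq_iff sum_distrib_left mult_ac)
qed (simp_all add: matrix_vector_mult_add_rdistrib norm_matrix_vector_le)

lemma continuous_on_matrix_mult:
  fixes A :: "'a::topological_space \<Rightarrow> real^'k^'m" and B :: "'a \<Rightarrow> real^'n^'k"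
  assumes "continuous_on S A" "continuous_on S B"
  shows "continuous_on S (\<lambda>x. A x ** B x)"
  unfolding matrix_matrix_mult_def by (intro continuous_intros assms)

context potential
begin

text \<open>The derivative of the flow with respect to the initial momentum: the initial position
  does not vary and the initial velocity varies by the identity, hence the value
  \<open>(0, mat 1)\<close> at time 0.\<close>

definition variation :: "(real^'d) \<times> (real^'d) \<Rightarrow> real \<Rightarrow> (real^'d^'d) \<times> (real^'d^'d)" where
  "variation z = (SOME c. c 0 = (0, mat 1) \<and>
     (\<forall>s. (c has_vector_derivative (snd (c s), - (H (fst (\<Phi> s z)) ** fst (c s)))) (at s)))"

lemma H_mult_bound: "norm (H x ** A) \<le> norm (A :: real^'d^'d)"
  using norm_matrix_mult_left_le[of "H x" 1 A] H_bound by simp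

lemma variation:
  "variation z 0 = (0, mat 1)"
  "(variation z has_vector_derivative (snd (variation z s), - (H (fst (\<Phi> s z)) ** fst (variation z s)))) (at s)"
proof -
  let ?f = "\<lambda>s c. (snd c, - (H (fst (\<Phi> s z)) ** fst c)) :: (real^'d^'d) \<times> (real^'d^'d)"
  have fc: "continuous_on UNIV (\<lambda>s. fst (\<Phi> s z))"
    using flow_fst by (meson continuous_at_imp_continuous_on has_vector_derivative_continuous)
  have "\<exists>c. c 0 = (0, mat 1) \<and> (\<forall>s. (c has_vector_derivative ?f s (c s)) (at s))"
  proof (rule global_solution)
    show "continuous_on UNIV (\<lambda>p. ?f (fst p) (snd p))"
      by (intro continuous_intros continuous_on_matrix_mult continuous_on_compose2[OF H_continuous]
          continuous_on_compose2[OF fc]) auto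
    show "norm (?f s c - ?f s c') \<le> norm (c - c')" for s c c'
    proof -
      have "H (fst (\<Phi> s z)) ** fst c' - H (fst (\<Phi> s z)) ** fst c = H (fst (\<Phi> s z)) ** (fst c' - fst c)"
        by (simp add: matrix_matrix_mult_def vec_eq_iff right_diff_distrib sum_subtractf)
      then have "norm (H (fst (\<Phi> s z)) ** fst c' - H (fst (\<Phi> s z)) ** fst c) \<le> norm (fst c' - fst c)"
        using H_mult_bound[of "fst (\<Phi> s z)" "fst c' - fst c"] by (simp only:)
      then have "(norm (?f s c - ?f s c'))\<^sup>2 \<le> (norm (c - c'))\<^sup>2"
        using power_mono[of "norm (H (fst (\<Phi> s z)) ** fst c' - H (fst (\<Phi> s z)) ** fst c)" "norm (fst c' - fst c)" 2]
        by (simp add: norm_prod_def norm_minus_commute)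
      then show ?thesis by simp
    qed
    show "norm (?f s (0, mat 1)) \<le> norm (mat 1 :: real^'d^'d)" for s
      by (simp add: norm_prod_def matrix_matrix_mult_def zero_vec_def[symmetric])
  qed
  from someI_ex[OF this] show "variation z 0 = (0, mat 1)"
    "(variation z has_vector_derivative (snd (variation z s), - (H (fst (\<Phi> s z)) ** fst (variation z s)))) (at s)"
    unfolding variation_def by blast+
qed

definition "J z s = fst (variation z s)"
definition "J' z s = snd (variation z s)"

lemma J_0[simp]: "J z 0 = 0" "J' z 0 = mat 1"
  by (simp_all add: J_def J'_def variation)

lemma J_derivative: "(J z has_vector_derivative J' z s) (at s)"
  and J'_derivative: "(J' z has_vector_derivative - (H (fst (\<Phi> s z)) ** J z s)) (at s)"
proof -
  have d: "(variation z has_derivative (\<lambda>x. x *\<^sub>R (J' z s, - (H (fst (\<Phi> s z)) ** J z s)))) (at s)"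
    using variation(2)[of z s] by (simp add: has_vector_derivative_def J_def J'_def)
  show "(J z has_vector_derivative J' z s) (at s)"
    "(J' z has_vector_derivative - (H (fst (\<Phi> s z)) ** J z s)) (at s)"
    using has_derivative_fst[OF d] has_derivative_snd[OF d]
    unfolding J_def[abs_def] J'_def[abs_def] by (simp_all add: has_vector_derivative_def)
qed

lemma Jv_derivative: "((\<lambda>s. J z s *v h) has_vector_derivative J' z s *v h) (at s)"
  and J'v_derivative: "((\<lambda>s. J' z s *v h) has_vector_derivative - (H (fst (\<Phi> s z)) *v (J z s *v h))) (at s)"
proof -
  show "((\<lambda>s. J z s *v h) has_vector_derivative J' z s *v h) (at s)"
    by (rule bounded_linear.has_vector_derivative[OF bounded_linear_mult_vec J_derivative])
  have "(- A) *v h = - (A *v h)" for A :: "real^'d^'d"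
    by (simp add: matrix_vector_mult_def vec_eq_iff sum_negf)
  then show "((\<lambda>s. J' z s *v h) has_vector_derivative - (H (fst (\<Phi> s z)) *v (J z s *v h))) (at s)"
    using bounded_linear.has_vector_derivative[OF bounded_linear_mult_vec[of h] J'_derivative[of z s]]
    by (simp add: matrix_vector_mul_assoc)
qed

lemma J_bound:
  assumes "0 \<le> s" "s \<le> t" "t \<le> 1/4"
  shows "norm (J z s *v h) \<le> 32/31 * t * norm h"
proof -
  have "norm (J z s *v h) \<le> 32/31 * (t * norm h + 0 * t\<^sup>2 / 2)"
    by (rule second_order_self_bound[OF Jv_derivative J'v_derivative])
      (use assms in \<open>auto simp: H_bound intro: mult_right_mono\<close>)
  then show ?thesis by simp
qed

text \<open>Free motion would give exactly \<open>t *\<^sub>R h\<close>. Two integrations of the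
  force, bounded through \<open>J_bound\<close>, leave \<open>16/31 * t * t\<^sup>2\<close>, and
  \<open>t\<^sup>2\<close> is at most 1/16.\<close>

lemma J_near_scaling:
  assumes "0 \<le> t" "t \<le> 1/4"
  shows "norm (J z t *v h - t *\<^sub>R h) \<le> t / 31 * norm h"
proof -
  have "norm (J z t *v h - J z 0 *v h - t *\<^sub>R (J' z 0 *v h)) \<le> (32/31 * t * norm h) * t\<^sup>2 / 2"
    by (rule second_order_bound(2)[OF Jv_derivative J'v_derivative _ assms(1) order_refl])
      (rule order_trans[OF _ J_bound[OF _ _ assms(2), where z=z]], auto simp: H_bound)
  also have "\<dots> = (16/31 * t * norm h) * t\<^sup>2" by simp
  also have "\<dots> \<le> (16/31 * t * norm h) * (1/16)"
    using power_mono[OF assms(2,1), of 2] assms by (intro mult_left_mono) (auto simp: power2_eq_square)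
  finally show ?thesis by simp
qed

definition \<psi> :: "real \<Rightarrow> real^'d \<Rightarrow> real^'d \<Rightarrow> real^'d" where
  "\<psi> t x p = fst (\<Phi> t (x, p))"

lemma position_diff:
  "((\<lambda>s. fst (\<Phi> s z') - fst (\<Phi> s z)) has_vector_derivative snd (\<Phi> s z') - snd (\<Phi> s z)) (at s)"
  and velocity_diff:
  "((\<lambda>s. snd (\<Phi> s z') - snd (\<Phi> s z)) has_vector_derivative g (fst (\<Phi> s z)) - g (fst (\<Phi> s z'))) (at s)"
  by (auto intro!: derivative_eq_intros flow_fst flow_snd)

lemma g_diff_bound: "norm (g x - g y) \<le> norm (y - x)"
  using g_Lipschitz[of x y] by (simp add: norm_minus_commute)

lemma position_diff_bound:
  assumes "0 \<le> s" "s \<le> t" "t \<le> 1/4"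
    and "\<And>r. 0 \<le> r \<Longrightarrow> r \<le> t \<Longrightarrow> norm (fst z' - fst z + r *\<^sub>R (snd z' - snd z)) \<le> N"
  shows "norm (fst (\<Phi> s z') - fst (\<Phi> s z)) \<le> 32/31 * N"
proof -
  have "norm (fst (\<Phi> s z') - fst (\<Phi> s z)) \<le> 32/31 * (N + 0 * t\<^sup>2 / 2)"
    by (rule second_order_self_bound[OF position_diff velocity_diff]) (use assms g_diff_bound in auto)
  then show ?thesis by simp
qed

text \<open>\<open>g\<close> is 1-Lipschitz, so the forces differ by at most \<open>M\<close>.
  Integrating once or twice measures how far the velocities and the positions deviate from free
  motion.\<close>

lemma flow_diff_errors:
  assumes "0 \<le> t" and M: "\<And>s. 0 \<le> s \<Longrightarrow> s \<le> t \<Longrightarrow> norm (fst (\<Phi> s z') - fst (\<Phi> s z)) \<le> M"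
  shows "norm (snd (\<Phi> t z') - snd (\<Phi> t z) - (snd z' - snd z)) \<le> M * t"
    and "norm (fst (\<Phi> t z') - fst (\<Phi> t z) - (fst z' - fst z) - t *\<^sub>R (snd z' - snd z)) \<le> M * t\<^sup>2 / 2"
proof -
  have B: "norm (g (fst (\<Phi> s z)) - g (fst (\<Phi> s z'))) \<le> M" if "0 \<le> s" "s \<le> t" for s
    using g_diff_bound M[OF that] order_trans by blast
  show "norm (snd (\<Phi> t z') - snd (\<Phi> t z) - (snd z' - snd z)) \<le> M * t"
    "norm (fst (\<Phi> t z') - fst (\<Phi> t z) - (fst z' - fst z) - t *\<^sub>R (snd z' - snd z)) \<le> M * t\<^sup>2 / 2"
    using second_order_bound[OF position_diff velocity_diff B assms(1) order_refl] by simp_all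
qed

text \<open>The linearisation error \<open>y\<close> again solves a second-order equation, with zero
  initial data and with the Taylor remainder of \<open>g\<close> as forcing; hence it is quadratic
  in \<open>q - p\<close>.\<close>

lemma \<psi>_derivative:
  assumes t: "0 \<le> t" "t \<le> 1/4"
  shows "(\<psi> t x has_derivative (*v) (J (x, p) t)) (at p)"
proof (rule has_derivativeI_sandwich[of 1])
  fix q :: "real^'d" assume "q \<noteq> p"
  define h where "h = q - p"
  define y where "y s = fst (\<Phi> s (x, q)) - fst (\<Phi> s (x, p)) - J (x, p) s *v h" for s
  define y' where "y' s = snd (\<Phi> s (x, q)) - snd (\<Phi> s (x, p)) - J' (x, p) s *v h" for s
  define y'' where "y'' s = g (fst (\<Phi> s (x, p))) - g (fst (\<Phi> s (x, q))) + H (fst (\<Phi> s (x, p))) *v (J (x, p) s *v h)" for s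
  have d: "(y has_vector_derivative y' s) (at s)" for s
    unfolding y_def y'_def by (intro has_vector_derivative_diff[OF position_diff Jv_derivative])
  have d': "(y' has_vector_derivative y'' s) (at s)" for s
    unfolding y'_def y''_def using has_vector_derivative_diff[OF velocity_diff J'v_derivative] by simp
  have "norm (y t) \<le> 32/31 * (0 + (L * (norm h)\<^sup>2) * t\<^sup>2 / 2)"
  proof (rule second_order_self_bound[OF d d'])
    fix s assume s: "0 \<le> s" "s \<le> t"
    let ?x = "fst (\<Phi> s (x, p))" and ?d = "fst (\<Phi> s (x, q)) - fst (\<Phi> s (x, p))"
    have "norm ?d \<le> 32/31 * (t * norm h)"
      by (rule position_diff_bound[OF s t(2)]) (auto simp: h_def intro: mult_right_mono)
    also have "\<dots> \<le> norm h" using mult_right_mono[OF t(2) norm_ge_zero[of h]] norm_ge_zero[of h] by linarith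
    finally have dh: "norm ?d \<le> norm h" .
    have "y'' s = - (g (?x + ?d) - g ?x - H ?x *v ?d) - H ?x *v (y s)"
      by (simp add: y''_def y_def matrix_vector_mult_diff_distrib)
    then have "norm (y'' s) \<le> norm (g (?x + ?d) - g ?x - H ?x *v ?d) + norm (H ?x *v (y s))"
      by (metis norm_minus_cancel norm_triangle_ineq4)
    also have "\<dots> \<le> L * (norm ?d)\<^sup>2 + norm (y s)" by (intro add_mono g_Taylor H_bound)
    also have "\<dots> \<le> norm (y s) + L * (norm h)\<^sup>2"
      using mult_left_mono[OF power_mono[OF dh norm_ge_zero, of 2] less_imp_le[OF L]] by linarith
    finally show "norm (y'' s) \<le> norm (y s) + L * (norm h)\<^sup>2" .
    show "norm (y 0 + s *\<^sub>R y' 0) \<le> 0" by (simp add: y_def y'_def h_def)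
  qed (use t L in auto)
  also have "\<dots> = (L * (norm h)\<^sup>2) * (16/31 * t\<^sup>2)" by simp
  also have "\<dots> \<le> (L * (norm h)\<^sup>2) * 1"
    using power_mono[OF t(2,1), of 2] L by (intro mult_left_mono) (auto simp: power2_eq_square)
  finally have "norm (y t) \<le> L * norm (q - p) * norm (q - p)" by (simp add: h_def power2_eq_square)
  then show "norm (\<psi> t x q - \<psi> t x p - J (x, p) t *v (q - p)) / norm (q - p) \<le> L * norm (q - p)"
    using \<open>q \<noteq> p\<close> by (simp add: y_def h_def \<psi>_def divide_le_eq)
next
  show "((\<lambda>q. L * norm (q - p)) \<longlongrightarrow> 0) (at p)"
    by (auto intro!: tendsto_eq_intros)
qed (auto simp: matrix_vector_mul_bounded_linear)

text \<open>The difference of the Jacobians has zero initial data and is driven by the change of the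
  Hessian, measured in Frobenius norm, times a Jacobian, measured in operator norm; so no dimension
  enters. The constant is \<open>(32/31)\<^sup>2 / 2\<close>, rounded up.\<close>

lemma J_diff_bound:
  assumes t: "0 \<le> t" "t \<le> 1/4" and M: "\<And>s. 0 \<le> s \<Longrightarrow> s \<le> t \<Longrightarrow> norm (fst (\<Phi> s z') - fst (\<Phi> s z)) \<le> M"
  shows "norm (J z' t - J z t) \<le> 27/50 * L * M * t ^ 3"
proof -
  define B where "B = L * M * (32/31 * t)"
  have M0: "0 \<le> M" using M[of 0] t norm_ge_zero order_trans by blast
  have B0: "0 \<le> B" using L M0 t by (simp add: B_def)
  have "norm (J z' t - J z t) \<le> 32/31 * (0 + B * t\<^sup>2 / 2)"
  proof (rule second_order_self_bound)
    show "((\<lambda>s. J z' s - J z s) has_vector_derivative J' z' s - J' z s) (at s)" for s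
      by (intro has_vector_derivative_diff J_derivative)
    show "((\<lambda>s. J' z' s - J' z s) has_vector_derivative
      - (H (fst (\<Phi> s z')) ** J z' s) - - (H (fst (\<Phi> s z)) ** J z s)) (at s)" for s
      by (intro has_vector_derivative_diff J'_derivative)
    fix s assume s: "0 \<le> s" "s \<le> t"
    let ?H' = "H (fst (\<Phi> s z'))" and ?H = "H (fst (\<Phi> s z))"
    have eq: "- (?H' ** J z' s) - - (?H ** J z s) = - (?H' ** (J z' s - J z s)) - (?H' - ?H) ** J z s"
      by (simp add: matrix_matrix_mult_def vec_eq_iff right_diff_distrib left_diff_distrib sum_subtractf)
    have "norm ((?H' - ?H) ** J z s) \<le> (32/31 * t) * norm (?H' - ?H)"
      by (rule norm_matrix_mult_right_le) (use J_bound[OF s t(2)] t in auto)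
    also have "\<dots> \<le> (32/31 * t) * (L * M)"
      using mult_left_mono[OF M[OF s], of L] L H_Lipschitz[of "fst (\<Phi> s z')" "fst (\<Phi> s z)"] t
      by (intro mult_left_mono) (auto intro: order_trans)
    finally have "norm ((?H' - ?H) ** J z s) \<le> B" by (simp add: B_def mult_ac)
    then show "norm (- (?H' ** J z' s) - - (?H ** J z s)) \<le> norm (J z' s - J z s) + B"
      unfolding eq using norm_triangle_ineq4[of "- (?H' ** (J z' s - J z s))" "(?H' - ?H) ** J z s"]
        H_mult_bound[of "fst (\<Phi> s z')" "J z' s - J z s"] by simp
  qed (use t B0 in auto)
  also have "\<dots> = (512/961) * (L * M * t ^ 3)" by (simp add: B_def power2_eq_square power3_eq_cube)
  also have "\<dots> \<le> (27/50) * (L * M * t ^ 3)" using L M0 t by (intro mult_right_mono) auto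
  finally show ?thesis by simp
qed

end

section \<open>Matching end positions by a change of momentum\<close>

context potential
begin

lemma \<psi>_near_scaling:
  assumes t: "0 \<le> t" "t \<le> 1/4"
  shows "norm (\<psi> t x p - \<psi> t x q - t *\<^sub>R (p - q)) \<le> t / 31 * norm (p - q)"
proof -
  have "norm (fst (\<Phi> s (x, p)) - fst (\<Phi> s (x, q))) \<le> 32/31 * (t * norm (p - q))" if "0 \<le> s" "s \<le> t" for s
    by (rule position_diff_bound[OF that t(2)]) (auto intro: mult_right_mono)
  from flow_diff_errors(2)[OF t(1) this]
  have "norm (\<psi> t x p - \<psi> t x q - t *\<^sub>R (p - q)) \<le> (16/31 * t * norm (p - q)) * t\<^sup>2"
    by (simp add: \<psi>_def)
  also have "\<dots> \<le> (16/31 * t * norm (p - q)) * (1/16)"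
    using power_mono[OF t(2,1), of 2] t by (intro mult_left_mono) (auto simp: power2_eq_square)
  finally show ?thesis by simp
qed

lemma \<psi>_expanding:
  assumes t: "0 \<le> t" "t \<le> 1/4"
  shows "30/31 * t * norm (p - q) \<le> norm (\<psi> t x p - \<psi> t x q)"
proof -
  have "norm (t *\<^sub>R (p - q)) = t * norm (p - q)" using t by simp
  moreover have "norm (t *\<^sub>R (p - q)) \<le> norm (\<psi> t x p - \<psi> t x q) + norm (\<psi> t x p - \<psi> t x q - t *\<^sub>R (p - q))"
    by (metis norm_minus_commute norm_triangle_sub)
  moreover note \<psi>_near_scaling[OF t, of x p q]
  ultimately show ?thesis by linarith
qed

text \<open>After division by \<open>t\<close>, the map differs from the identity by a contraction
  with constant 1/31. Its lower Lipschitz bound gives injectivity, and a fixed point of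
  \<open>T\<close> is a preimage of \<open>y\<close>.\<close>

lemma \<psi>_bij:
  assumes t: "0 < t" "t \<le> 1/4"
  shows "bij (\<psi> t x)"
proof (rule bijI)
  have t0: "0 \<le> t" using t by simp
  show "inj (\<psi> t x)"
  proof (rule injI)
    fix p q assume "\<psi> t x p = \<psi> t x q"
    then have "30/31 * t * norm (p - q) \<le> 0" using \<psi>_expanding[OF t0 t(2), of p q x] by simp
    then show "p = q" using t by (simp add: mult_le_0_iff)
  qed
  have "\<exists>p. \<psi> t x p = y" for y
  proof -
    define T where "T p = p + (1 / t) *\<^sub>R (y - \<psi> t x p)" for p
    have "dist (T p) (T q) \<le> 1/31 * dist p q" for p q
    proof -
      have "T p - T q = - (1 / t) *\<^sub>R (\<psi> t x p - \<psi> t x q - t *\<^sub>R (p - q))"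
        using t by (simp add: T_def algebra_simps)
      then have "norm (T p - T q) = norm (\<psi> t x p - \<psi> t x q - t *\<^sub>R (p - q)) / t" using t by simp
      also have "\<dots> \<le> (t / 31 * norm (p - q)) / t"
        using \<psi>_near_scaling[OF t0 t(2), of x p q] t by (intro divide_right_mono) auto
      finally show ?thesis using t by (simp add: dist_norm)
    qed
    then obtain p where "T p = p" using banach_fix_type[of "1/31" T] by auto
    then show ?thesis using t by (auto simp: T_def)
  qed
  then show "surj (\<psi> t x)" by (metis surjI surj_def)
qed

text \<open>As a function of \<open>p\<close>, this is the nonlinear transport of the last step:
  started at \<open>x'\<close> with this momentum, the flow ends at the position reached from
  \<open>(x, p)\<close>.\<close>

definition steer :: "real \<Rightarrow> real^'d \<Rightarrow> real^'d \<Rightarrow> real^'d \<Rightarrow> real^'d" where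
  "steer t x x' p = inv (\<psi> t x') (\<psi> t x p)"

lemma \<psi>_steer:
  assumes t: "0 < t" "t \<le> 1/4"
  shows "\<psi> t x' (steer t x x' p) = \<psi> t x p"
  unfolding steer_def using \<psi>_bij[OF t] by (simp add: bij_is_surj surj_f_inv_f)

text \<open>The momentum difference is unknown, but the final position difference is 0.
  Interpolating between the two ends eliminates the momentum and leaves two force errors of at most
  \<open>M * t\<^sup>2 / 2\<close> each; together they are at most \<open>M / 16\<close>, hence the
  factor \<open>1 / (1 - 1/16)\<close>.\<close>

lemma steer_position_bound:
  assumes t: "0 < t" "t \<le> 1/4" and s: "0 \<le> s" "s \<le> t"
  shows "norm (fst (\<Phi> s (x', steer t x x' p)) - fst (\<Phi> s (x, p))) \<le> 16/15 * norm (x' - x)"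
proof -
  let ?y = "\<lambda>s. fst (\<Phi> s (x', steer t x x' p)) - fst (\<Phi> s (x, p))"
  let ?w = "steer t x x' p - p"
  have yt: "?y t = 0" using \<psi>_steer[OF t, of x' x p] by (simp add: \<psi>_def)
  have "norm (?y s) \<le> norm (x' - x) / (1 - 1/16)"
  proof (rule sup_bound[OF _ _ _ _ s])
    show "continuous_on {0..t} ?y"
      using position_diff by (meson continuous_at_imp_continuous_on has_vector_derivative_continuous)
    fix s M assume s: "0 \<le> s" "s \<le> t" and M: "\<And>r. 0 \<le> r \<Longrightarrow> r \<le> t \<Longrightarrow> norm (?y r) \<le> M"
    have M0: "0 \<le> M" using M[OF s] norm_ge_zero order_trans by blast
    have e: "norm (?y r - (x' - x) - r *\<^sub>R ?w) \<le> M * t\<^sup>2 / 2" if "0 \<le> r" "r \<le> t" for r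
    proof -
      have "norm (?y r - (x' - x) - r *\<^sub>R ?w) \<le> M * r\<^sup>2 / 2"
        using flow_diff_errors(2)[OF that(1), of "(x', steer t x x' p)" "(x, p)" M] M that by simp
      also have "\<dots> \<le> M * t\<^sup>2 / 2" using that M0 by (intro divide_right_mono mult_left_mono power_mono) auto
      finally show ?thesis .
    qed
    have eq: "?y s = (1 - s / t) *\<^sub>R (x' - x) + (?y s - (x' - x) - s *\<^sub>R ?w) - (s / t) *\<^sub>R (?y t - (x' - x) - t *\<^sub>R ?w)"
      unfolding yt using t by (simp add: algebra_simps)
    have st: "0 \<le> s / t" "s / t \<le> 1" using s t by auto
    have "norm (?y s) \<le> norm ((1 - s / t) *\<^sub>R (x' - x)) + norm (?y s - (x' - x) - s *\<^sub>R ?w) + norm ((s / t) *\<^sub>R (?y t - (x' - x) - t *\<^sub>R ?w))"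
      by (subst eq) (meson norm_triangle_ineq4 norm_triangle_ineq order_trans add_right_mono)
    also have "\<dots> \<le> 1 * norm (x' - x) + M * t\<^sup>2 / 2 + 1 * (M * t\<^sup>2 / 2)"
    proof (intro add_mono e s)
      show "norm ((1 - s / t) *\<^sub>R (x' - x)) \<le> 1 * norm (x' - x)"
        using st by (simp add: mult_left_le_one_le)
      have "norm ((s / t) *\<^sub>R (?y t - (x' - x) - t *\<^sub>R ?w)) = (s / t) * norm (?y t - (x' - x) - t *\<^sub>R ?w)"
        using s t by simp
      also have "\<dots> \<le> 1 * (M * t\<^sup>2 / 2)"
        using st t by (intro mult_mono e) auto
      finally show "norm ((s / t) *\<^sub>R (?y t - (x' - x) - t *\<^sub>R ?w)) \<le> 1 * (M * t\<^sup>2 / 2)" .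
    qed
    also have "\<dots> = norm (x' - x) + t\<^sup>2 * M" by simp
    also have "t\<^sup>2 * M \<le> 1/16 * M"
      using power_mono[OF t(2), of 2] t M0 by (intro mult_right_mono) (auto simp: power2_eq_square)
    finally show "norm (?y s) \<le> norm (x' - x) + 1/16 * M" by simp
  qed (use t in auto)
  then show ?thesis by simp
qed

text \<open>To first order the momentum has to compensate \<open>x' - x\<close> over time
  \<open>t\<close>. The correction is the force error of the position for
  \<open>M = 16/15 * norm (x' - x)\<close>, divided by \<open>t\<close>.\<close>

lemma steer_momentum:
  assumes t: "0 < t" "t \<le> 1/4"
  shows "norm (steer t x x' p - p + (1 / t) *\<^sub>R (x' - x)) \<le> 8/15 * t * norm (x' - x)"
proof -
  let ?w = "steer t x x' p - p"
  have "norm (fst (\<Phi> t (x', steer t x x' p)) - fst (\<Phi> t (x, p)) - (x' - x) - t *\<^sub>R ?w) \<le> (16/15 * norm (x' - x)) * t\<^sup>2 / 2"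
    using flow_diff_errors(2)[OF less_imp_le[OF t(1)] steer_position_bound[OF t, where x=x and x'=x' and p=p]] by simp
  moreover have "fst (\<Phi> t (x', steer t x x' p)) - fst (\<Phi> t (x, p)) = 0"
    using \<psi>_steer[OF t, of x' x p] by (simp add: \<psi>_def)
  ultimately have le: "norm (0 - (x' - x) - t *\<^sub>R ?w) \<le> (8/15 * t * norm (x' - x)) * t" by (simp add: power2_eq_square mult_ac)
  have "0 - (x' - x) - t *\<^sub>R ?w = - t *\<^sub>R (?w + (1 / t) *\<^sub>R (x' - x))" using t by (simp add: algebra_simps)
  then have "t * norm (?w + (1 / t) *\<^sub>R (x' - x)) \<le> (8/15 * t * norm (x' - x)) * t" using le t by simp
  then show ?thesis using t by (simp add: mult.commute[of _ t])
qed

lemma steer_velocity: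
  assumes t: "0 < t" "t \<le> 1/4"
  shows "norm (snd (\<Phi> t (x', steer t x x' p)) - snd (\<Phi> t (x, p)) - (steer t x x' p - p)) \<le> 16/15 * t * norm (x' - x)"
  using flow_diff_errors(1)[OF less_imp_le[OF t(1)] steer_position_bound[OF t, where x=x and x'=x' and p=p]] by (simp add: mult_ac)

text \<open>The derivative is \<open>B ** ?J - mat 1 = B ** (?J - ?K)\<close> with \<open>B\<close>
  the inverse of \<open>?K\<close>. Both Jacobians are within \<open>t / 31\<close> of
  \<open>t\<close> times the identity, which settles the operator bound; the Frobenius bound comes
  from \<open>J_diff_bound\<close>, and with it the Lipschitz constant of the Hessian.\<close>

lemma steer_derivative:
  assumes t: "0 < t" "t \<le> 1/4"
  obtains A where "((\<lambda>p. steer t x x' p - p) has_derivative (*v) A) (at p)"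
    "\<And>h. norm (A *v h) \<le> norm h / 2" "norm A \<le> 3/5 * L * norm (x' - x) * t\<^sup>2"
proof -
  let ?q = "steer t x x' p"
  let ?J = "J (x, p) t" and ?K = "J (x', ?q) t"
  have t0: "0 \<le> t" using t by simp
  have K: "30/31 * t * norm h \<le> norm (?K *v h)" for h
  proof -
    have "norm (t *\<^sub>R h) \<le> norm (?K *v h) + norm (?K *v h - t *\<^sub>R h)"
      by (metis norm_minus_commute norm_triangle_sub)
    then show ?thesis using J_near_scaling[OF t0 t(2), of "(x', ?q)" h] t by simp
  qed
  have "inj ((*v) ?K)"
  proof (rule injI)
    fix h k assume "?K *v h = ?K *v k"
    then have "30/31 * t * norm (h - k) \<le> 0" using K[of "h - k"] by (simp add: matrix_vector_mult_diff_distrib)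
    then show "h = k" using t by (simp add: mult_le_0_iff)
  qed
  then have "invertible ?K" by (metis invertible_left_inverse matrix_left_invertible_injective)
  then obtain B where KB: "?K ** B = mat 1" and BK: "B ** ?K = mat 1" unfolding invertible_def by blast
  have Bn: "norm (B *v h) \<le> 31/30 / t * norm h" for h
    using K[of "B *v h"] KB t by (simp add: matrix_vector_mul_assoc field_simps)
  have cont: "continuous (at y) (inv (\<psi> t x'))" for y
  proof -
    have "(31/30 / t)-lipschitz_on UNIV (inv (\<psi> t x'))"
    proof (rule lipschitz_onI)
      fix y z
      have "30/31 * t * norm (inv (\<psi> t x') y - inv (\<psi> t x') z) \<le> norm (y - z)"
        using \<psi>_expanding[OF t0 t(2), of "inv (\<psi> t x') y" "inv (\<psi> t x') z" x'] \<psi>_bij[OF t, of x']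
        by (simp add: bij_is_surj surj_f_inv_f)
      then show "dist (inv (\<psi> t x') y) (inv (\<psi> t x') z) \<le> 31/30 / t * dist y z"
        using t by (simp add: dist_norm field_simps)
    qed (use t in auto)
    then show ?thesis using lipschitz_on_continuous_on continuous_on_eq_continuous_at open_UNIV by blast
  qed
  have "(inv (\<psi> t x') has_derivative (*v) B) (at (\<psi> t x p))"
  proof (rule has_derivative_inverse_basic[of "\<psi> t x'" "(*v) ?K" _ _ _ UNIV])
    show "(\<psi> t x' has_derivative (*v) ?K) (at (inv (\<psi> t x') (\<psi> t x p)))"
      using \<psi>_derivative[OF t0 t(2), of x' ?q] by (simp add: steer_def)
    show "(*v) B \<circ> (*v) ?K = id" using BK by (simp add: fun_eq_iff matrix_vector_mul_assoc)
    show "\<psi> t x' (inv (\<psi> t x') z) = z" for z using \<psi>_bij[OF t, of x'] by (simp add: bij_is_surj surj_f_inv_f)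
  qed (auto simp: matrix_vector_mul_bounded_linear cont)
  from has_derivative_compose[OF \<psi>_derivative[OF t0 t(2)] this]
  have "(steer t x x' has_derivative (\<lambda>h. B *v (?J *v h))) (at p)"
    by (simp add: steer_def[abs_def])
  then have d: "((\<lambda>p. steer t x x' p - p) has_derivative (\<lambda>h. B *v (?J *v h) - h)) (at p)"
    by (intro has_derivative_diff has_derivative_ident)
  define A where "A = B ** (?J - ?K)"
  have Ah: "A *v h = B *v (?J *v h) - h" for h
    using BK by (simp add: A_def matrix_vector_mult_diff_rdistrib matrix_vector_mult_diff_distrib
        flip: matrix_vector_mul_assoc) (simp add: matrix_vector_mul_assoc)
  show ?thesis
  proof
    show "((\<lambda>p. steer t x x' p - p) has_derivative (*v) A) (at p)" using d by (simp add: Ah[abs_def])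
    fix h
    have "norm ((?J - ?K) *v h) \<le> norm (?J *v h - t *\<^sub>R h) + norm (?K *v h - t *\<^sub>R h)"
      unfolding matrix_vector_mult_diff_rdistrib using norm_triangle_ineq4[of "?J *v h - t *\<^sub>R h" "?K *v h - t *\<^sub>R h"] by simp
    also have "\<dots> \<le> 2 * t / 31 * norm h"
      using J_near_scaling[OF t0 t(2), of "(x, p)" h] J_near_scaling[OF t0 t(2), of "(x', ?q)" h] by simp
    finally have "norm (A *v h) \<le> 31/30 / t * (2 * t / 31 * norm h)"
      unfolding A_def matrix_vector_mul_assoc[symmetric] using t
      by (intro order_trans[OF Bn] mult_left_mono) auto
    also have "\<dots> \<le> norm h / 2" using t by simp
    finally show "norm (A *v h) \<le> norm h / 2" .
  next
    have "norm A \<le> 31/30 / t * norm (?J - ?K)"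
      unfolding A_def using Bn t by (intro norm_matrix_mult_left_le) auto
    also have "\<dots> \<le> 31/30 / t * (27/50 * L * (16/15 * norm (x' - x)) * t ^ 3)"
      using J_diff_bound[OF t0 t(2) steer_position_bound[OF t, where x=x and x'=x' and p=p]] t
      by (intro mult_left_mono) (auto simp: norm_minus_commute[of ?J ?K])
    \<comment> \<open>The number is the product of 31/30, 27/50 and 16/15.\<close>
    also have "\<dots> = (1488/2500) * (L * norm (x' - x) * t\<^sup>2)" using t by (simp add: power2_eq_square power3_eq_cube)
    also have "\<dots> \<le> (3/5) * (L * norm (x' - x) * t\<^sup>2)" using L by (intro mult_right_mono) auto
    finally show "norm A \<le> 3/5 * L * norm (x' - x) * t\<^sup>2" by (simp add: mult_ac)
  qed
qed

end

section \<open>Liouville's theorem\<close>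

lemma nn_integral_lborel_shift:
  fixes f :: "'a::euclidean_space \<Rightarrow> ennreal"
  assumes [measurable]: "f \<in> borel_measurable borel"
  shows "(\<integral>\<^sup>+x. f (x + a) \<partial>lborel) = (\<integral>\<^sup>+x. f x \<partial>lborel)"
proof -
  have "(\<integral>\<^sup>+x. f x \<partial>lborel) = (\<integral>\<^sup>+x. f x \<partial>distr lborel borel ((+) a))" by (simp add: lborel_distr_plus)
  then show ?thesis by (simp add: nn_integral_distr add.commute)
qed

lemma bounded_support_integrable:
  fixes f :: "'a::euclidean_space \<Rightarrow> real"
  assumes [measurable]: "f \<in> borel_measurable borel" and b: "\<And>z. \<bar>f z\<bar> \<le> B" and s: "\<And>z. f z \<noteq> 0 \<Longrightarrow> norm z \<le> R"
  shows "integrable lborel f"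
proof (rule Bochner_Integration.integrable_bound)
  show "integrable lborel (\<lambda>z::'a. B * indicator (cball 0 R) z)"
    using emeasure_bounded_finite[of "cball (0::'a) R"] by (intro integrable_mult_right) (auto simp: integrable_indicator_iff)
  show "AE z in lborel. norm (f z) \<le> norm (B * indicator (cball 0 R) z)"
    using b s by (intro AE_I2) (fastforce simp: indicator_def dist_norm intro: order_trans)
qed simp

context potential
begin

lemma g_measurable[measurable]: "g \<in> borel_measurable borel"
  by (intro borel_measurable_continuous_onI g_continuous)

text \<open>A symplectic Euler step: a shear of the positions followed by a shear of the velocities,
  with the force taken at the new position.\<close>

definition leapfrog :: "real \<Rightarrow> (real^'d) \<times> (real^'d) \<Rightarrow> (real^'d) \<times> (real^'d)" where
  "leapfrog h z = (let x = fst z + h *\<^sub>R snd z in (x, snd z - h *\<^sub>R g x))"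

lemma leapfrog_measurable[measurable]: "leapfrog h \<in> borel_measurable borel"
  unfolding leapfrog_def[abs_def] Let_def borel_prod[symmetric] by measurable

text \<open>Each shear is a translation in one variable with the other one fixed, so Fubini and
  translation invariance suffice.\<close>

lemma nn_integral_leapfrog:
  fixes f :: "(real^'d) \<times> (real^'d) \<Rightarrow> ennreal"
  assumes f[measurable]: "f \<in> borel_measurable borel"
  shows "(\<integral>\<^sup>+z. f (leapfrog h z) \<partial>lborel) = (\<integral>\<^sup>+z. f z \<partial>lborel)"
proof -
  have f'[measurable]: "f \<in> borel_measurable (borel \<Otimes>\<^sub>M borel)" using f by (simp add: borel_prod)
  have "(\<integral>\<^sup>+z. f (leapfrog h z) \<partial>lborel) =
      (\<integral>\<^sup>+v. \<integral>\<^sup>+x. f (x + h *\<^sub>R v, v - h *\<^sub>R g (x + h *\<^sub>R v)) \<partial>lborel \<partial>lborel)"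
    unfolding lborel_prod[symmetric] by (subst lborel_pair.nn_integral_snd[symmetric]) (auto simp: leapfrog_def Let_def)
  also have "\<dots> = (\<integral>\<^sup>+v. \<integral>\<^sup>+x. f (x, v - h *\<^sub>R g x) \<partial>lborel \<partial>lborel)"
    by (intro nn_integral_cong nn_integral_lborel_shift[of "\<lambda>x. f (x, _ - h *\<^sub>R g x)"]) measurable
  also have "\<dots> = (\<integral>\<^sup>+x. \<integral>\<^sup>+v. f (x, v + - (h *\<^sub>R g x)) \<partial>lborel \<partial>lborel)"
    by (subst lborel_pair.Fubini') auto
  also have "\<dots> = (\<integral>\<^sup>+x. \<integral>\<^sup>+v. f (x, v) \<partial>lborel \<partial>lborel)"
    by (intro nn_integral_cong nn_integral_lborel_shift) measurable
  also have "\<dots> = (\<integral>\<^sup>+z. f z \<partial>lborel)"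
    unfolding lborel_prod[symmetric] by (subst lborel.nn_integral_fst) auto
  finally show ?thesis .
qed

text \<open>Used for both signs of \<open>s\<close>: it confines the images of balls and, through
  the reversed flow, their preimages. The factor 3 bounds \<open>exp 1\<close>.\<close>

lemma flow_norm_bound: "\<exists>K\<ge>0. \<forall>s z. \<bar>s\<bar> \<le> 1 \<longrightarrow> norm (\<Phi> s z) \<le> 3 * norm z + K"
proof -
  have "continuous_on UNIV (\<lambda>s. \<Phi> s 0)"
    using flow_derivative by (meson continuous_at_imp_continuous_on has_vector_derivative_continuous)
  then have "compact ((\<lambda>s. \<Phi> s 0) ` {-1..1})"
    by (intro compact_continuous_image) (auto intro: continuous_on_subset)
  then obtain K where K: "0 < K" "\<forall>y\<in>(\<lambda>s. \<Phi> s 0) ` {-1..1}. norm y \<le> K"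
    using compact_imp_bounded bounded_pos by blast
  then have K: "0 \<le> K" "\<And>s. \<bar>s\<bar> \<le> 1 \<Longrightarrow> norm (\<Phi> s 0) \<le> K" by (auto simp: abs_le_iff)
  have "norm (\<Phi> s z) \<le> 3 * norm z + K" if "\<bar>s\<bar> \<le> 1" for s z
  proof -
    have "norm (\<Phi> s z) \<le> norm (\<Phi> s z - \<Phi> s 0) + norm (\<Phi> s 0)" by (metis norm_triangle_sub add.commute)
    also have "\<dots> \<le> exp \<bar>s\<bar> * norm (z - 0) + K" using flow_Lipschitz K(2)[OF that] by (rule add_mono)
    also have "\<dots> \<le> 3 * norm z + K"
      using that exp_le order_trans[OF exp_le_cancel_iff[THEN iffD2, OF that] exp_le] by (auto intro: mult_right_mono)
    finally show ?thesis .
  qed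
  then show ?thesis using K(1) by blast
qed

text \<open>Local consistency of the step, uniformly on balls. A quadratic local error suffices
  because the number of steps to be summed is of order \<open>1 / h\<close>.\<close>

lemma flow_leapfrog_error:
  "\<exists>C\<ge>0. \<forall>z h. norm z \<le> R \<longrightarrow> 0 \<le> h \<longrightarrow> h \<le> 1 \<longrightarrow> norm (\<Phi> h z - leapfrog h z) \<le> C * h\<^sup>2"
proof -
  obtain K where K: "0 \<le> K" "\<And>s z. \<bar>s\<bar> \<le> 1 \<Longrightarrow> norm (\<Phi> s z) \<le> 3 * norm z + K" using flow_norm_bound by blast
  define R' where "R' = 3 * \<bar>R\<bar> + K"
  define G where "G = R' + norm (g 0)"
  have R': "0 \<le> R'" "\<bar>R\<bar> \<le> R'" using K by (auto simp: R'_def)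
  have "norm (\<Phi> h z - leapfrog h z) \<le> (G / 2 + 2 * R') * h\<^sup>2" if z: "norm z \<le> R" and h: "0 \<le> h" "h \<le> 1" for z h
  proof -
    have b: "norm (\<Phi> s z) \<le> R'" if "0 \<le> s" "s \<le> h" for s
      using K(2)[of s z] that z h by (simp add: R'_def)
    have bx: "norm (fst (\<Phi> s z)) \<le> R'" and bv: "norm (snd (\<Phi> s z)) \<le> R'" if "0 \<le> s" "s \<le> h" for s
      using b[OF that] norm_fst_le[of "fst (\<Phi> s z)" "snd (\<Phi> s z)"] norm_snd_le[of "snd (\<Phi> s z)" "fst (\<Phi> s z)"] by auto
    have bg: "norm (- g (fst (\<Phi> s z))) \<le> G" if "0 \<le> s" "s \<le> h" for s
      using g_Lipschitz[of "fst (\<Phi> s z)" 0] bx[OF that] norm_triangle_sub[of "g (fst (\<Phi> s z))" "g 0"] by (simp add: G_def)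
    let ?x = "fst z + h *\<^sub>R snd z"
    have 1: "norm (fst (\<Phi> h z) - ?x) \<le> G * h\<^sup>2 / 2"
      using second_order_bound(2)[OF flow_fst flow_snd bg h(1) order_refl] by (simp add: diff_diff_eq)
    have "norm (g ?x - g (fst (\<Phi> s z))) \<le> 2 * R' * h" if s: "0 \<le> s" "s \<le> h" for s
    proof -
      have "norm (fst (\<Phi> s z) - fst (\<Phi> 0 z)) \<le> R' * s"
        by (rule first_order_bound[OF flow_fst bv s])
      also have "\<dots> \<le> R' * h" using s R' by (intro mult_left_mono) auto
      finally have "norm (fst (\<Phi> s z) - fst z) \<le> R' * h" by simp
      moreover have "norm (h *\<^sub>R snd z) \<le> R' * h"
        using bv[of 0] h by (simp add: mult.commute[of R'] mult_left_mono)
      moreover have "?x - fst (\<Phi> s z) = h *\<^sub>R snd z - (fst (\<Phi> s z) - fst z)" by simp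
      moreover from this have "norm (?x - fst (\<Phi> s z)) \<le> norm (h *\<^sub>R snd z) + norm (fst (\<Phi> s z) - fst z)"
        by (simp only: norm_triangle_ineq4)
      ultimately have "norm (?x - fst (\<Phi> s z)) \<le> 2 * R' * h" by linarith
      then show ?thesis using g_Lipschitz order_trans by blast
    qed
    moreover have "((\<lambda>s. snd (\<Phi> s z) + s *\<^sub>R g ?x) has_vector_derivative g ?x - g (fst (\<Phi> s z))) (at s)" for s
      by (auto intro!: derivative_eq_intros flow_snd)
    ultimately have "norm (snd (\<Phi> h z) + h *\<^sub>R g ?x - (snd (\<Phi> 0 z) + 0 *\<^sub>R g ?x)) \<le> 2 * R' * h * h"
      by (intro first_order_bound[where y="\<lambda>s. snd (\<Phi> s z) + s *\<^sub>R g ?x" and t=h]) (use h in auto)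
    then have 2: "norm (snd (\<Phi> h z) - (snd z - h *\<^sub>R g ?x)) \<le> 2 * R' * h\<^sup>2"
      by (simp add: power2_eq_square algebra_simps)
    have "norm (\<Phi> h z - leapfrog h z) \<le> norm (fst (\<Phi> h z) - ?x) + norm (snd (\<Phi> h z) - (snd z - h *\<^sub>R g ?x))"
      using norm_Pair_le[of "fst (\<Phi> h z) - ?x" "snd (\<Phi> h z) - (snd z - h *\<^sub>R g ?x)"]
      by (simp add: leapfrog_def Let_def minus_prod_def)
    also have "\<dots> \<le> (G / 2 + 2 * R') * h\<^sup>2" using 1 2 by (simp add: algebra_simps)
    finally show ?thesis .
  qed
  moreover have "0 \<le> G / 2 + 2 * R'" using R' by (simp add: G_def)
  ultimately show ?thesis by blast
qed

text \<open>The step can be inverted explicitly, velocity first, so points that are mapped into a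
  ball come from a ball whose radius does not depend on \<open>h\<close>.\<close>

lemma leapfrog_norm_bound: "\<exists>K\<ge>0. \<forall>z h. 0 \<le> h \<longrightarrow> h \<le> 1 \<longrightarrow> norm z \<le> 6 * norm (leapfrog h z) + K"
proof -
  have "norm z \<le> 6 * norm (leapfrog h z) + 2 * norm (g 0)" if h: "0 \<le> h" "h \<le> 1" for z h
  proof -
    let ?x = "fst (leapfrog h z)" and ?v = "snd (leapfrog h z)"
    have xv: "norm ?x \<le> norm (leapfrog h z)" "norm ?v \<le> norm (leapfrog h z)"
      using norm_fst_le[of ?x ?v] norm_snd_le[of ?v ?x] by auto
    have v: "snd z = ?v + h *\<^sub>R g ?x" and x: "fst z = ?x - h *\<^sub>R snd z" by (auto simp: leapfrog_def Let_def)
    have "norm (h *\<^sub>R g ?x) \<le> norm (g ?x)" using h by (simp add: mult_left_le_one_le)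
    moreover have "norm (g ?x) \<le> norm ?x + norm (g 0)"
      using g_Lipschitz[of ?x 0] norm_triangle_sub[of "g ?x" "g 0"] by simp
    ultimately have nv: "norm (snd z) \<le> 2 * norm (leapfrog h z) + norm (g 0)"
      using v xv norm_triangle_ineq[of ?v "h *\<^sub>R g ?x"] by simp
    have "norm (h *\<^sub>R snd z) \<le> norm (snd z)" using h by (simp add: mult_left_le_one_le)
    then have nx: "norm (fst z) \<le> 3 * norm (leapfrog h z) + norm (g 0)"
      using x xv nv norm_triangle_ineq4[of ?x "h *\<^sub>R snd z"] by simp
    have "norm z \<le> norm (fst z) + norm (snd z)" using norm_Pair_le[of "fst z" "snd z"] by simp
    then show ?thesis using nv nx norm_ge_zero[of "leapfrog h z"] by linarith
  qed
  then show ?thesis by (intro exI[of _ "2 * norm (g 0)"]) auto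
qed

text \<open>Replacing one flow step of length \<open>h\<close> by a leapfrog step changes the
  integral by order \<open>h\<^sup>2\<close>, and the leapfrog step itself leaves the integral
  unchanged. Over \<open>n\<close> steps of length \<open>t / n\<close> the total error is of order
  \<open>1 / n\<close>.\<close>

lemma flow_integral_Lipschitz:
  assumes lip: "\<And>z z'. \<bar>f z - f z'\<bar> \<le> B * norm (z - z')" and b: "\<And>z. \<bar>f z\<bar> \<le> B"
    and supp: "\<And>z. f z \<noteq> 0 \<Longrightarrow> norm z \<le> R" and t: "0 \<le> t" "t \<le> 1"
  shows "(\<integral>z. f (\<Phi> t z) \<partial>lborel) = (\<integral>z. f z \<partial>lborel)"
proof -
  have B0: "0 \<le> B" using b[of 0] by linarith
  have R0: "norm z \<le> \<bar>R\<bar>" if "f z \<noteq> 0" for z using supp[OF that] by linarith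
  obtain K where K: "0 \<le> K" "\<And>s z. \<bar>s\<bar> \<le> 1 \<Longrightarrow> norm (\<Phi> s z) \<le> 3 * norm z + K" using flow_norm_bound by blast
  obtain K' where K': "0 \<le> K'" "\<And>z h. 0 \<le> h \<Longrightarrow> h \<le> 1 \<Longrightarrow> norm z \<le> 6 * norm (leapfrog h z) + K'"
    using leapfrog_norm_bound by blast
  have pre: "norm z \<le> 3 * norm (\<Phi> s z) + K" if "\<bar>s\<bar> \<le> 1" for s z
    using K(2)[of "- s" "\<Phi> s z"] that flow_add[of "- s" s z] by simp
  \<comment> \<open>\<open>R1\<close> bounds the support of \<open>f\<close> composed with the flow
    up to time 1; \<open>R2\<close> still bounds it after one more flow or leapfrog step.\<close>
  define R1 where "R1 = 3 * \<bar>R\<bar> + K"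
  define R2 where "R2 = 6 * R1 + K + K'"
  have R1: "0 \<le> R1" using K by (simp add: R1_def)
  obtain C where C: "0 \<le> C" "\<And>z h. norm z \<le> R2 \<Longrightarrow> 0 \<le> h \<Longrightarrow> h \<le> 1 \<Longrightarrow> norm (\<Phi> h z - leapfrog h z) \<le> C * h\<^sup>2"
    using flow_leapfrog_error by blast
  have contf: "continuous_on UNIV f"
    by (rule lipschitz_on_continuous_on[of B], rule lipschitz_onI) (use lip B0 in \<open>auto simp: dist_norm\<close>)
  then have fm[measurable]: "f \<in> borel_measurable borel" by (rule borel_measurable_continuous_onI)
  define V where "V = measure lborel (cball 0 R2 :: ((real^'d) \<times> (real^'d)) set)"
  \<comment> \<open>The short step is taken first and the long flow afterwards, so the local error
    is magnified only by the Lipschitz constant of the long flow, at most 3.\<close>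
  have step: "\<bar>(\<integral>z. f (\<Phi> (s + h) z) \<partial>lborel) - (\<integral>z. f (\<Phi> s z) \<partial>lborel)\<bar> \<le> 3 * B * C * V * h\<^sup>2"
    if s: "0 \<le> s" "s \<le> 1" and h: "0 \<le> h" "h \<le> 1" for s h
  proof -
    let ?F = "\<lambda>z. f (\<Phi> s z)"
    have F[measurable]: "?F \<in> borel_measurable borel" by measurable
    have Fs: "norm z \<le> R1" if "?F z \<noteq> 0" for z
      using pre[of s z] R0[OF that] s by (simp add: R1_def)
    have s1: "norm z \<le> R2" if "?F (\<Phi> h z) \<noteq> 0" for z
      using Fs[OF that] pre[of h z] h R1 K' by (simp add: R2_def)
    have s2: "norm z \<le> R2" if "?F (leapfrog h z) \<noteq> 0" for z
      using Fs[OF that] K'(2)[OF h, of z] R1 K by (simp add: R2_def)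
    have i1: "integrable lborel (\<lambda>z. ?F (\<Phi> h z))" and i2: "integrable lborel (\<lambda>z. ?F (leapfrog h z))"
      and i0: "integrable lborel ?F"
      by (rule bounded_support_integrable[OF _ b]; use s1 s2 Fs in \<open>(measurable)?\<close>; blast)+
    have le: "\<bar>?F (\<Phi> h z) - ?F (leapfrog h z)\<bar> \<le> (3 * B * C * h\<^sup>2) * indicator (cball 0 R2) z" for z
    proof (cases "norm z \<le> R2")
      case True
      have "\<bar>?F (\<Phi> h z) - ?F (leapfrog h z)\<bar> \<le> B * norm (\<Phi> s (\<Phi> h z) - \<Phi> s (leapfrog h z))" by (rule lip)
      also have "\<dots> \<le> B * (exp \<bar>s\<bar> * norm (\<Phi> h z - leapfrog h z))"
        using flow_Lipschitz B0 by (rule mult_left_mono)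
      also have "\<dots> \<le> B * (3 * (C * h\<^sup>2))"
      proof -
        have "exp \<bar>s\<bar> \<le> exp 1" using s by simp
        then have "exp \<bar>s\<bar> \<le> 3" using exp_le by linarith
        then show ?thesis using C(2)[OF True h] B0 C(1) by (intro mult_left_mono mult_mono) auto
      qed
      finally show ?thesis using True by (simp add: dist_norm mult_ac)
    next
      case False
      then have "?F (\<Phi> h z) = 0" "?F (leapfrog h z) = 0" using s1 s2 by blast+
      then show ?thesis using B0 C(1) by simp
    qed
    have ii: "integrable lborel (\<lambda>z::(real^'d) \<times> (real^'d). (3 * B * C * h\<^sup>2) * indicator (cball 0 R2) z)"
      using emeasure_bounded_finite[of "cball (0::(real^'d) \<times> (real^'d)) R2"] by (intro integrable_mult_right) (auto simp: integrable_indicator_iff)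
    have "(\<integral>z. ?F (leapfrog h z) \<partial>lborel) = (\<integral>z. ?F z \<partial>lborel)"
    proof -
      have "distr lborel borel (leapfrog h) = (lborel :: ((real^'d) \<times> (real^'d)) measure)"
      proof (rule measure_eqI)
        fix A assume "A \<in> sets (distr lborel borel (leapfrog h))"
        then have [measurable]: "A \<in> sets borel" by simp
        have "emeasure (distr lborel borel (leapfrog h)) A = (\<integral>\<^sup>+z. indicator A (leapfrog h z) \<partial>lborel)"
          by (subst nn_integral_indicator[symmetric]) (auto simp: nn_integral_distr simp del: nn_integral_indicator)
        then show "emeasure (distr lborel borel (leapfrog h)) A = emeasure lborel A"
          by (subst (asm) nn_integral_leapfrog) auto
      qed simp
      then show ?thesis using integral_distr[of "leapfrog h" lborel borel ?F] by simp
    qed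
    then have "\<bar>(\<integral>z. ?F (\<Phi> h z) \<partial>lborel) - (\<integral>z. ?F z \<partial>lborel)\<bar> = \<bar>\<integral>z. ?F (\<Phi> h z) - ?F (leapfrog h z) \<partial>lborel\<bar>"
      using i1 i2 by simp
    also have "\<dots> \<le> (\<integral>z. \<bar>?F (\<Phi> h z) - ?F (leapfrog h z)\<bar> \<partial>lborel)" by (rule integral_abs_bound)
    also have "\<dots> \<le> (\<integral>z. (3 * B * C * h\<^sup>2) * indicator (cball (0::(real^'d) \<times> (real^'d)) R2) z \<partial>lborel)"
      by (intro integral_mono ii le) (use i1 i2 in auto)
    also have "\<dots> = 3 * B * C * V * h\<^sup>2" by (simp add: V_def)
    finally show ?thesis by (simp add: flow_add)
  qed
  have tele: "\<bar>(\<integral>z. f (\<Phi> (real k * h) z) \<partial>lborel) - (\<integral>z. f z \<partial>lborel)\<bar> \<le> real k * (3 * B * C * V * h\<^sup>2)"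
    if "0 \<le> h" "h \<le> 1" "real k * h \<le> 1" for k h
    using that(3)
  proof (induction k)
    case (Suc k)
    have kh: "real k * h \<le> 1" using Suc.prems that(1) by (simp add: algebra_simps)
    have "real (Suc k) * h = real k * h + h" by (simp add: algebra_simps)
    then show ?case using Suc.IH[OF kh] step[of "real k * h" h] kh that by (simp add: algebra_simps)
  qed simp
  let ?d = "\<bar>(\<integral>z. f (\<Phi> t z) \<partial>lborel) - (\<integral>z. f z \<partial>lborel)\<bar>"
  have "?d \<le> 3 * B * C * V * t\<^sup>2 * (1 / real (Suc n))" for n
  proof -
    have "real (Suc n) * (t / real (Suc n)) = t" by simp
    moreover have "0 \<le> t / real (Suc n)" "t / real (Suc n) \<le> 1" using t by (auto simp: divide_le_eq)
    moreover have "real (Suc n) * (3 * B * C * V * (t / real (Suc n))\<^sup>2) = 3 * B * C * V * t\<^sup>2 * (1 / real (Suc n))"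
      by (simp add: power_divide power2_eq_square del: of_nat_Suc)
    ultimately show ?thesis using tele[of "t / real (Suc n)" "Suc n"] t by (simp del: of_nat_Suc)
  qed
  moreover have "(\<lambda>n. 3 * B * C * V * t\<^sup>2 * (1 / real (Suc n))) \<longlonglongrightarrow> 3 * B * C * V * t\<^sup>2 * 0"
    using LIMSEQ_inverse_real_of_nat by (intro tendsto_mult_left) (simp add: inverse_eq_divide)
  ultimately have "?d \<le> 0" by (intro LIMSEQ_le_const[of "\<lambda>n. 3 * B * C * V * t\<^sup>2 * (1 / real (Suc n))"]) (auto intro: exI[of _ 0])
  then show ?thesis by simp
qed

lemma liouville:
  assumes t: "0 \<le> t" "t \<le> 1"
  shows "distr lborel borel (\<Phi> t) = lborel"
proof (rule lborel_eqI[symmetric])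
  fix l u :: "(real^'d) \<times> (real^'d)" assume lu: "\<And>b. b \<in> Basis \<Longrightarrow> l \<bullet> b \<le> u \<bullet> b"
  let ?A = "- box l u"
  obtain R where R: "\<And>z. z \<in> box l u \<Longrightarrow> norm z \<le> R" using bounded_box[of l u] unfolding bounded_iff by blast
  have ne: "?A \<noteq> {}" using bounded_box[of l u] not_bounded_UNIV by (metis Compl_empty_eq double_compl)
  \<comment> \<open>Lipschitz functions of bounded support that increase to the indicator of the
    open box.\<close>
  define f where "f n z = min 1 (real n * infdist z ?A)" for n z
  have f0: "f n z = 0" if "z \<notin> box l u" for n z using that by (simp add: f_def)
  have fpos: "0 \<le> f n z" for n z by (simp add: f_def infdist_nonneg)
  have lip: "\<bar>f n z - f n z'\<bar> \<le> (real n + 1) * norm (z - z')" for n z z'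
  proof -
    have "\<bar>infdist z ?A - infdist z' ?A\<bar> \<le> norm (z - z')"
      using infdist_triangle[of z ?A z'] infdist_triangle[of z' ?A z] by (simp add: dist_norm norm_minus_commute)
    then have "real n * \<bar>infdist z ?A - infdist z' ?A\<bar> \<le> real n * norm (z - z')" by (rule mult_left_mono) simp
    moreover have "\<bar>f n z - f n z'\<bar> \<le> \<bar>real n * infdist z ?A - real n * infdist z' ?A\<bar>" unfolding f_def by linarith
    moreover have "\<bar>real n * infdist z ?A - real n * infdist z' ?A\<bar> = real n * \<bar>infdist z ?A - infdist z' ?A\<bar>"
      by (simp add: abs_mult flip: right_diff_distrib)
    moreover have "0 \<le> norm (z - z')" by simp
    ultimately show ?thesis by (simp only: distrib_right)
  qed
  have bd: "\<bar>f n z\<bar> \<le> real n + 1" for n z using fpos[of n z] unfolding f_def by linarith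
  have supp: "norm z \<le> R" if "f n z \<noteq> 0" for n z using f0[of z n] that R by blast
  have [measurable]: "f n \<in> borel_measurable borel" for n
    unfolding f_def by (intro borel_measurable_continuous_onI continuous_intros)
  have eq: "(\<integral>\<^sup>+z. ennreal (f n (\<Phi> t z)) \<partial>lborel) = (\<integral>\<^sup>+z. ennreal (f n z) \<partial>lborel)" for n
  proof -
    obtain K where K: "\<And>s z. \<bar>s\<bar> \<le> 1 \<Longrightarrow> norm (\<Phi> s z) \<le> 3 * norm z + K" using flow_norm_bound by blast
    have "norm z \<le> 3 * R + K" if "f n (\<Phi> t z) \<noteq> 0" for z
      using K[of "- t" "\<Phi> t z"] supp[OF that] t flow_add[of "- t" t z] by simp
    then have "integrable lborel (\<lambda>z. f n (\<Phi> t z))"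
      by (intro bounded_support_integrable[of _ "real n + 1" "3 * R + K"] bd) auto
    moreover have "integrable lborel (f n)" by (intro bounded_support_integrable[of _ "real n + 1" R] bd supp) auto
    ultimately show ?thesis
      using flow_integral_Lipschitz[OF lip bd supp t] fpos by (simp add: nn_integral_eq_integral)
  qed
  have inc: "incseq (\<lambda>n. ennreal (f n z))" for z
    unfolding f_def by (intro incseq_SucI ennreal_leI) (auto simp: infdist_nonneg algebra_simps intro: min.coboundedI2)
  have sup: "(SUP n. ennreal (f n z)) = indicator (box l u) z" for z
  proof (cases "z \<in> box l u")
    case True
    have "0 < infdist z ?A"
      using True in_closed_iff_infdist_zero[of ?A z] ne infdist_nonneg[of z ?A] by (auto simp: closed_def less_le)
    then obtain N where "1 < real N * infdist z ?A" using reals_Archimedean3 by blast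
    then have "f N z = 1" by (simp add: f_def)
    moreover have "f n z \<le> 1" for n by (simp add: f_def)
    ultimately have "(SUP n. ennreal (f n z)) = 1"
      by (intro antisym SUP_least) (auto simp: ennreal_le_1 intro!: SUP_upper2[of N])
    then show ?thesis using True by simp
  qed (simp add: f0)
  have m: "(\<integral>\<^sup>+z. (SUP n. ennreal (f n (T z))) \<partial>lborel) = (SUP n. (\<integral>\<^sup>+z. ennreal (f n (T z)) \<partial>lborel))"
    if [measurable]: "T \<in> borel_measurable borel" for T :: "(real^'d) \<times> (real^'d) \<Rightarrow> (real^'d) \<times> (real^'d)"
    by (intro nn_integral_monotone_convergence_SUP) (use inc in \<open>auto simp: incseq_def le_fun_def\<close>)
  have "emeasure (distr lborel borel (\<Phi> t)) (box l u) = (\<integral>\<^sup>+z. indicator (box l u) (\<Phi> t z) \<partial>lborel)"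
    by (subst nn_integral_indicator[symmetric]) (auto simp: nn_integral_distr simp del: nn_integral_indicator)
  also have "\<dots> = (\<integral>\<^sup>+z. indicator (box l u) z \<partial>lborel)"
    using m[of "\<Phi> t"] m[of "\<lambda>z. z"] unfolding sup eq by simp
  also have "\<dots> = (\<Prod>b\<in>Basis. (u - l) \<bullet> b)" using lu by simp
  finally show "emeasure (distr lborel borel (\<Phi> t)) (box l u) = (\<Prod>b\<in>Basis. (u - l) \<bullet> b)" .
qed simp

end

section \<open>Gaussian refreshment\<close>

lemma nn_integral_lborel_affine:
  fixes F :: "'a::euclidean_space \<Rightarrow> ennreal"
  assumes [measurable]: "F \<in> borel_measurable borel" and "0 < \<sigma>"
  shows "(\<integral>\<^sup>+y. F y \<partial>lborel) = ennreal (\<sigma> ^ DIM('a)) * (\<integral>\<^sup>+x. F (a + \<sigma> *\<^sub>R x) \<partial>lborel)"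
proof -
  have "(\<integral>\<^sup>+y. F y \<partial>lborel) = (\<integral>\<^sup>+y. F y \<partial>density (distr lborel borel (\<lambda>x. a + \<sigma> *\<^sub>R x)) (\<lambda>_. \<bar>\<sigma>\<bar> ^ DIM('a)))"
    using lborel_affine[of \<sigma> a] assms(2) by simp
  also have "\<dots> = (\<integral>\<^sup>+x. ennreal (\<sigma> ^ DIM('a)) * F (a + \<sigma> *\<^sub>R x) \<partial>lborel)"
    using assms(2) by (simp add: nn_integral_density nn_integral_distr)
  finally show ?thesis by (simp add: nn_integral_cmult)
qed

lemma nn_integral_gauss_density: "(\<integral>\<^sup>+x. ennreal (gauss_density (x::real^'d)) \<partial>lborel) = 1"
  using gauss_density_integral[where 'd='d] by (simp add: nn_integral_eq_integral has_bochner_integral_iff)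

lemma nn_integral_std_gaussian:
  "f \<in> borel_measurable borel \<Longrightarrow> (\<integral>\<^sup>+x. f x \<partial>std_gaussian) = (\<integral>\<^sup>+x. ennreal (gauss_density x) * f x \<partial>lborel)"
  by (simp add: std_gaussian_eq nn_integral_density)

text \<open>Completing the square: the kernel of the refreshment is symmetric in its two velocities.\<close>

lemma gauss_density_swap:
  fixes v y :: "real^'d"
  assumes \<eta>: "0 < \<sigma>" "\<sigma>\<^sup>2 = 1 - \<eta>\<^sup>2"
  shows "gauss_density v * gauss_density ((1 / \<sigma>) *\<^sub>R (y - \<eta> *\<^sub>R v)) =
    gauss_density y * gauss_density ((1 / \<sigma>) *\<^sub>R (v - \<eta> *\<^sub>R y))"
proof -
  have n: "(norm ((1 / \<sigma>) *\<^sub>R (y - \<eta> *\<^sub>R v)))\<^sup>2 = (y \<bullet> y - 2 * \<eta> * (y \<bullet> v) + \<eta>\<^sup>2 * (v \<bullet> v)) / \<sigma>\<^sup>2" for y v :: "real^'d"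
  proof -
    have "(norm ((1 / \<sigma>) *\<^sub>R (y - \<eta> *\<^sub>R v)))\<^sup>2 = (norm (y - \<eta> *\<^sub>R v))\<^sup>2 / \<sigma>\<^sup>2"
      by (simp add: power_divide)
    also have "(norm (y - \<eta> *\<^sub>R v))\<^sup>2 = y \<bullet> y - 2 * \<eta> * (y \<bullet> v) + \<eta>\<^sup>2 * (v \<bullet> v)"
      unfolding power2_norm_eq_inner
      by (simp add: inner_diff_left inner_diff_right inner_commute[of v y] power2_eq_square algebra_simps)
    finally show ?thesis .
  qed
  have "(norm v)\<^sup>2 + (norm ((1 / \<sigma>) *\<^sub>R (y - \<eta> *\<^sub>R v)))\<^sup>2 = (norm y)\<^sup>2 + (norm ((1 / \<sigma>) *\<^sub>R (v - \<eta> *\<^sub>R y)))\<^sup>2"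
  proof -
    have "\<sigma>\<^sup>2 * (v \<bullet> v) + (y \<bullet> y - 2 * \<eta> * (y \<bullet> v) + \<eta>\<^sup>2 * (v \<bullet> v)) = \<sigma>\<^sup>2 * (y \<bullet> y) + (v \<bullet> v - 2 * \<eta> * (y \<bullet> v) + \<eta>\<^sup>2 * (y \<bullet> y))"
      unfolding \<eta>(2) by (simp add: algebra_simps)
    then have "((\<sigma>\<^sup>2 * (v \<bullet> v) + (y \<bullet> y - 2 * \<eta> * (y \<bullet> v) + \<eta>\<^sup>2 * (v \<bullet> v))) / \<sigma>\<^sup>2)
        = ((\<sigma>\<^sup>2 * (y \<bullet> y) + (v \<bullet> v - 2 * \<eta> * (y \<bullet> v) + \<eta>\<^sup>2 * (y \<bullet> y))) / \<sigma>\<^sup>2)" by simp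
    then show ?thesis unfolding n unfolding power2_norm_eq_inner
      using \<eta>(1) by (simp add: add_divide_distrib inner_commute[of v y])
  qed
  then have "exp (- (norm v)\<^sup>2 / 2) * exp (- (norm ((1 / \<sigma>) *\<^sub>R (y - \<eta> *\<^sub>R v)))\<^sup>2 / 2)
    = exp (- (norm y)\<^sup>2 / 2) * exp (- (norm ((1 / \<sigma>) *\<^sub>R (v - \<eta> *\<^sub>R y)))\<^sup>2 / 2)"
    unfolding exp_add[symmetric] by (intro arg_cong[where f=exp]) (simp add: field_simps)
  then show ?thesis
    unfolding gauss_density_exp[of v] gauss_density_exp[of y] gauss_density_exp[of "(1 / \<sigma>) *\<^sub>R _"] by (simp add: mult_ac)
qed

text \<open>Invariance of the Gaussian under refreshment: after a change of variables the two
  velocities enter through a symmetric kernel, so their roles can be exchanged. Nonnegative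
  integrals make Fubini unconditional, and the Jacobian factor \<open>?c\<close> appears on both
  sides and cancels.\<close>

lemma nn_integral_std_gaussian_rotation:
  fixes f :: "real^'d \<Rightarrow> ennreal"
  assumes f[measurable]: "f \<in> borel_measurable borel" and \<sigma>: "0 < \<sigma>" "\<sigma>\<^sup>2 = 1 - \<eta>\<^sup>2"
  shows "(\<integral>\<^sup>+v. \<integral>\<^sup>+x. f (\<eta> *\<^sub>R v + \<sigma> *\<^sub>R x) \<partial>std_gaussian \<partial>std_gaussian) = (\<integral>\<^sup>+x. f x \<partial>std_gaussian)"
proof -
  let ?c = "ennreal (\<sigma> ^ DIM(real^'d))"
  let ?\<phi> = "\<lambda>x::real^'d. ennreal (gauss_density x)"
  have inner: "?c * (\<integral>\<^sup>+x. f (\<eta> *\<^sub>R v + \<sigma> *\<^sub>R x) \<partial>std_gaussian) = (\<integral>\<^sup>+y. ?\<phi> ((1 / \<sigma>) *\<^sub>R (y - \<eta> *\<^sub>R v)) * f y \<partial>lborel)" for v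
    using nn_integral_lborel_affine[of "\<lambda>y. ?\<phi> ((1 / \<sigma>) *\<^sub>R (y - \<eta> *\<^sub>R v)) * f y" \<sigma> "\<eta> *\<^sub>R v"] \<sigma>
    by (simp add: nn_integral_std_gaussian)
  have mass: "(\<integral>\<^sup>+v. ?\<phi> ((1 / \<sigma>) *\<^sub>R (v - \<eta> *\<^sub>R y)) \<partial>lborel) = ?c" for y
    using nn_integral_lborel_affine[of "\<lambda>v. ?\<phi> ((1 / \<sigma>) *\<^sub>R (v - \<eta> *\<^sub>R y))" \<sigma> "\<eta> *\<^sub>R y"] \<sigma>
    by (simp add: nn_integral_gauss_density)
  interpret S: prob_space "std_gaussian :: (real^'d) measure" by (rule prob_space_std_gaussian)
  have "?c * (\<integral>\<^sup>+v. \<integral>\<^sup>+x. f (\<eta> *\<^sub>R v + \<sigma> *\<^sub>R x) \<partial>std_gaussian \<partial>std_gaussian)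
    = (\<integral>\<^sup>+v. ?c * (\<integral>\<^sup>+x. f (\<eta> *\<^sub>R v + \<sigma> *\<^sub>R x) \<partial>std_gaussian) \<partial>std_gaussian)"
    by (intro nn_integral_cmult[symmetric]) measurable
  also have "\<dots> = (\<integral>\<^sup>+v. \<integral>\<^sup>+y. ?\<phi> v * (?\<phi> ((1 / \<sigma>) *\<^sub>R (y - \<eta> *\<^sub>R v)) * f y) \<partial>lborel \<partial>lborel)"
    unfolding inner by (simp add: nn_integral_std_gaussian nn_integral_cmult)
  also have "\<dots> = (\<integral>\<^sup>+v. \<integral>\<^sup>+y. (?\<phi> y * f y) * ?\<phi> ((1 / \<sigma>) *\<^sub>R (v - \<eta> *\<^sub>R y)) \<partial>lborel \<partial>lborel)"
  proof (intro nn_integral_cong)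
    fix v y :: "real^'d"
    have "?\<phi> v * ?\<phi> ((1 / \<sigma>) *\<^sub>R (y - \<eta> *\<^sub>R v)) = ?\<phi> y * ?\<phi> ((1 / \<sigma>) *\<^sub>R (v - \<eta> *\<^sub>R y))"
      using gauss_density_swap[OF \<sigma>, of v y] by (simp flip: ennreal_mult)
    then show "?\<phi> v * (?\<phi> ((1 / \<sigma>) *\<^sub>R (y - \<eta> *\<^sub>R v)) * f y) = (?\<phi> y * f y) * ?\<phi> ((1 / \<sigma>) *\<^sub>R (v - \<eta> *\<^sub>R y))"
      by (simp add: mult_ac)
  qed
  also have "\<dots> = (\<integral>\<^sup>+y. \<integral>\<^sup>+v. (?\<phi> y * f y) * ?\<phi> ((1 / \<sigma>) *\<^sub>R (v - \<eta> *\<^sub>R y)) \<partial>lborel \<partial>lborel)"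
    by (rule lborel_pair.Fubini') measurable
  also have "\<dots> = (\<integral>\<^sup>+y. ?c * (?\<phi> y * f y) \<partial>lborel)"
    by (simp add: nn_integral_cmult mass mult.commute)
  also have "\<dots> = ?c * (\<integral>\<^sup>+x. f x \<partial>std_gaussian)"
    by (simp add: nn_integral_std_gaussian nn_integral_cmult)
  finally show ?thesis
    using \<sigma> by (simp add: ennreal_mult_cancel_left)
qed

lemma distr_std_gaussian_rotation:
  assumes \<sigma>: "0 < \<sigma>" "\<sigma>\<^sup>2 = 1 - \<eta>\<^sup>2"
  shows "distr (std_gaussian \<Otimes>\<^sub>M std_gaussian) borel (\<lambda>(v, x). \<eta> *\<^sub>R v + \<sigma> *\<^sub>R x) = (std_gaussian :: (real^'d) measure)"
proof (rule measure_eqI)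
  interpret S: prob_space "std_gaussian :: (real^'d) measure" by (rule prob_space_std_gaussian)
  interpret pair_sigma_finite "std_gaussian :: (real^'d) measure" "std_gaussian :: (real^'d) measure" ..
  fix A :: "(real^'d) set" assume "A \<in> sets (distr (std_gaussian \<Otimes>\<^sub>M std_gaussian) borel (\<lambda>(v, x). \<eta> *\<^sub>R v + \<sigma> *\<^sub>R x))"
  then have [measurable]: "A \<in> sets borel" by simp
  let ?D = "distr (std_gaussian \<Otimes>\<^sub>M std_gaussian) borel (\<lambda>(v :: real^'d, x). \<eta> *\<^sub>R v + \<sigma> *\<^sub>R x)"
  have "emeasure ?D A = (\<integral>\<^sup>+p. indicator A (\<eta> *\<^sub>R fst p + \<sigma> *\<^sub>R snd p) \<partial>(std_gaussian \<Otimes>\<^sub>M std_gaussian))"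
  proof -
    have "emeasure ?D A = (\<integral>\<^sup>+y. indicator A y \<partial>?D)" by simp
    also have "\<dots> = (\<integral>\<^sup>+p. indicator A (\<eta> *\<^sub>R fst p + \<sigma> *\<^sub>R snd p) \<partial>(std_gaussian \<Otimes>\<^sub>M std_gaussian))"
      by (subst nn_integral_distr) (auto simp: split_beta)
    finally show ?thesis .
  qed
  also have "\<dots> = (\<integral>\<^sup>+v. \<integral>\<^sup>+x. indicator A (\<eta> *\<^sub>R v + \<sigma> *\<^sub>R x) \<partial>std_gaussian \<partial>std_gaussian)"
    by (subst S.nn_integral_fst[symmetric]) auto
  also have "\<dots> = emeasure std_gaussian A"
    by (subst nn_integral_std_gaussian_rotation[OF _ \<sigma>]) auto
  finally show "emeasure (distr (std_gaussian \<Otimes>\<^sub>M std_gaussian) borel (\<lambda>(v, x). \<eta> *\<^sub>R v + \<sigma> *\<^sub>R x)) A = emeasure std_gaussian A" .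
qed simp

section \<open>Markov operators and their action on measures\<close>

definition bounded_borel :: "('a::topological_space \<Rightarrow> real) \<Rightarrow> bool" where
  "bounded_borel f \<longleftrightarrow> f \<in> borel_measurable borel \<and> bounded (range f)"

lemma bounded_borelI: "f \<in> borel_measurable borel \<Longrightarrow> (\<And>x. \<bar>f x\<bar> \<le> B) \<Longrightarrow> bounded_borel f"
  unfolding bounded_borel_def bounded_iff by auto

lemma bounded_borel_measurable[measurable_dest]: "bounded_borel f \<Longrightarrow> f \<in> borel_measurable borel"
  by (simp add: bounded_borel_def)

lemma bounded_borelE:
  assumes "bounded_borel f"
  obtains B where "\<And>x. \<bar>f x\<bar> \<le> B"
  using assms unfolding bounded_borel_def bounded_iff by auto

lemma (in prob_space) bounded_borel_integrable:
  assumes "bounded_borel f" and X: "X \<in> measurable M borel"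
  shows "integrable M (\<lambda>x. f (X x))"
proof -
  obtain B where "\<And>x. \<bar>f x\<bar> \<le> B" using assms(1) bounded_borelE by blast
  moreover have "(\<lambda>x. f (X x)) \<in> borel_measurable M"
    using X bounded_borel_measurable[OF assms(1)] by measurable
  ultimately show ?thesis by (intro integrable_const_bound[of _ B]) auto
qed

text \<open>The second clause provides a witness for the definite description in
  \<open>markov_act\<close>; it can be checked for each factor of the operator and passes to
  compositions.\<close>

definition is_markov :: "(('z::topological_space \<Rightarrow> real) \<Rightarrow> 'z \<Rightarrow> real) \<Rightarrow> bool" where
  "is_markov K \<longleftrightarrow> (\<forall>f. bounded_borel f \<longrightarrow> bounded_borel (K f)) \<and>
     (\<forall>\<nu>. prob_space \<nu> \<and> sets \<nu> = sets borel \<longrightarrow>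
        (\<exists>\<rho>. prob_space \<rho> \<and> sets \<rho> = sets borel \<and> (\<forall>f. bounded_borel f \<longrightarrow> (\<integral>z. f z \<partial>\<rho>) = (\<integral>z. K f z \<partial>\<nu>))))"

lemma is_markov_id: "is_markov id"
  unfolding is_markov_def by auto

lemma is_markov_compose:
  assumes K: "is_markov K" and K': "is_markov K'"
  shows "is_markov (K \<circ> K')"
  unfolding is_markov_def
proof (intro conjI allI impI)
  show "bounded_borel ((K \<circ> K') f)" if "bounded_borel f" for f
    using that K K' unfolding is_markov_def by simp
  fix \<nu> :: "'a measure" assume "prob_space \<nu> \<and> sets \<nu> = sets borel"
  then obtain \<rho> where \<rho>: "prob_space \<rho>" "sets \<rho> = sets borel" "\<And>f. bounded_borel f \<Longrightarrow> (\<integral>z. f z \<partial>\<rho>) = (\<integral>z. K f z \<partial>\<nu>)"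
    using K unfolding is_markov_def by blast
  then obtain \<rho>' where \<rho>': "prob_space \<rho>'" "sets \<rho>' = sets borel" "\<And>f. bounded_borel f \<Longrightarrow> (\<integral>z. f z \<partial>\<rho>') = (\<integral>z. K' f z \<partial>\<rho>)"
    using K' unfolding is_markov_def by blast
  have "(\<integral>z. f z \<partial>\<rho>') = (\<integral>z. (K \<circ> K') f z \<partial>\<nu>)" if "bounded_borel f" for f
    using \<rho>'(3)[OF that] \<rho>(3)[of "K' f"] K' that unfolding is_markov_def by simp
  then show "\<exists>\<rho>. prob_space \<rho> \<and> sets \<rho> = sets borel \<and> (\<forall>f. bounded_borel f \<longrightarrow> (\<integral>z. f z \<partial>\<rho>) = (\<integral>z. (K \<circ> K') f z \<partial>\<nu>))"
    using \<rho>'(1,2) by blast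
qed

lemma is_markov_funpow: "is_markov K \<Longrightarrow> is_markov (K ^^ n)"
  by (induction n) (auto simp: is_markov_id is_markov_compose)

lemma markov_act:
  assumes K: "is_markov K" and \<nu>: "prob_space \<nu>" "sets \<nu> = sets borel"
  shows "prob_space (markov_act \<nu> K)" "sets (markov_act \<nu> K) = sets borel"
    "\<And>f. bounded_borel f \<Longrightarrow> (\<integral>z. f z \<partial>markov_act \<nu> K) = (\<integral>z. K f z \<partial>\<nu>)"
proof -
  let ?P = "\<lambda>\<rho>. prob_space \<rho> \<and> sets \<rho> = sets borel \<and>
     (\<forall>f \<in> borel_measurable borel. bounded (range f) \<longrightarrow> (\<integral>z. f z \<partial>\<rho>) = (\<integral>z. K f z \<partial>\<nu>))"
  have "\<exists>\<rho>. prob_space \<rho> \<and> sets \<rho> = sets borel \<and> (\<forall>f. bounded_borel f \<longrightarrow> (\<integral>z. f z \<partial>\<rho>) = (\<integral>z. K f z \<partial>\<nu>))"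
    using K \<nu> unfolding is_markov_def by simp
  then obtain \<rho> where "prob_space \<rho>" "sets \<rho> = sets borel"
    "\<forall>f. bounded_borel f \<longrightarrow> (\<integral>z. f z \<partial>\<rho>) = (\<integral>z. K f z \<partial>\<nu>)" by (elim exE conjE)
  then have \<rho>: "?P \<rho>" by (simp add: bounded_borel_def)
  \<comment> \<open>Indicators of Borel sets are among the test functions, so two candidates agree
    on all sets.\<close>
  have uniq: "\<rho>' = \<rho>" if "?P \<rho>'" for \<rho>'
  proof (rule measure_eqI)
    fix A assume "A \<in> sets \<rho>'"
    then have [measurable]: "A \<in> sets borel" using that by simp
    have b: "bounded (range (indicator A :: _ \<Rightarrow> real))"
      unfolding bounded_iff by (auto simp: indicator_def intro: exI[of _ 1])
    have m: "(indicator A :: _ \<Rightarrow> real) \<in> borel_measurable borel" by simp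
    have "(\<integral>z. indicator A z \<partial>\<rho>') = (\<integral>z. K (indicator A) z \<partial>\<nu>)" using that m b by blast
    also have "\<dots> = (\<integral>z. indicator A z \<partial>\<rho>)" using \<rho> m b by metis
    finally have "(\<integral>z. indicator A z \<partial>\<rho>') = (\<integral>z. indicator A z \<partial>\<rho> :: real)" .
    moreover have "space \<rho> = UNIV" "space \<rho>' = UNIV"
      using that \<rho> sets_eq_imp_space_eq[of _ borel] by auto
    ultimately have "measure \<rho>' A = measure \<rho> A" by simp
    then show "emeasure \<rho>' A = emeasure \<rho> A"
      using that \<rho> finite_measure.emeasure_eq_measure prob_space.finite_measure by metis
  qed (use that \<rho> in auto)
  have "?P (markov_act \<nu> K)"
    unfolding markov_act_def by (rule theI[of ?P, OF \<rho> uniq])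
  then show "prob_space (markov_act \<nu> K)" "sets (markov_act \<nu> K) = sets borel"
    "\<And>f. bounded_borel f \<Longrightarrow> (\<integral>z. f z \<partial>markov_act \<nu> K) = (\<integral>z. K f z \<partial>\<nu>)"
    by (simp_all add: bounded_borel_def)
qed

lemma refresh_op_eq: "refresh_op \<eta> f z = (\<integral>x. f (fst z, \<eta> *\<^sub>R snd z + sqrt (1 - \<eta>\<^sup>2) *\<^sub>R x) \<partial>std_gaussian)"
  by (simp add: refresh_op_def split_beta)

lemma refresh_op_between:
  fixes f :: "(real^'d) \<times> (real^'d) \<Rightarrow> real"
  assumes [measurable]: "f \<in> borel_measurable borel" and ab: "\<And>z. a \<le> f z" "\<And>z. f z \<le> b"
  shows "a \<le> refresh_op \<eta> f z" "refresh_op \<eta> f z \<le> b"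
proof -
  interpret S: prob_space "std_gaussian :: (real^'d) measure" by (rule prob_space_std_gaussian)
  have m: "f \<in> borel_measurable (borel \<Otimes>\<^sub>M borel)" by (simp add: borel_prod)
  have "\<bar>f z\<bar> \<le> \<bar>a\<bar> + \<bar>b\<bar>" for z using ab[of z] by linarith
  then have i: "integrable std_gaussian (\<lambda>x. f (fst z, \<eta> *\<^sub>R snd z + sqrt (1 - \<eta>\<^sup>2) *\<^sub>R x))"
    using m by (intro S.integrable_const_bound[of _ "\<bar>a\<bar> + \<bar>b\<bar>"]) auto
  show "a \<le> refresh_op \<eta> f z" "refresh_op \<eta> f z \<le> b"
    unfolding refresh_op_eq using i ab by (auto intro: S.integral_ge_const S.integral_le_const)
qed

lemma refresh_op_measurable[measurable]:
  fixes f :: "(real^'d) \<times> (real^'d) \<Rightarrow> real"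
  assumes "f \<in> borel_measurable borel"
  shows "refresh_op \<eta> f \<in> borel_measurable borel"
proof -
  interpret S: prob_space "std_gaussian :: (real^'d) measure" by (rule prob_space_std_gaussian)
  have [measurable]: "f \<in> borel_measurable (borel \<Otimes>\<^sub>M borel)" using assms by (simp add: borel_prod)
  have "(\<lambda>z. \<integral>x. f (fst z, \<eta> *\<^sub>R snd z + sqrt (1 - \<eta>\<^sup>2) *\<^sub>R x) \<partial>std_gaussian) \<in> borel_measurable (borel \<Otimes>\<^sub>M borel)"
    by (rule S.borel_measurable_lebesgue_integral) measurable
  then show ?thesis by (simp add: borel_prod refresh_op_eq[abs_def])
qed

lemma bounded_borel_refresh: "bounded_borel f \<Longrightarrow> bounded_borel (refresh_op \<eta> f)"
proof -
  assume f: "bounded_borel f"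
  then obtain B where B: "\<And>x. \<bar>f x\<bar> \<le> B" using bounded_borelE by blast
  have fB: "- B \<le> f x" "f x \<le> B" for x using B[of x] by linarith+
  note m = bounded_borel_measurable[OF f]
  show ?thesis
  proof (rule bounded_borelI)
    show "\<bar>refresh_op \<eta> f z\<bar> \<le> B" for z
      using refresh_op_between[OF m fB, of \<eta> z] by linarith
  qed (use m in measurable)
qed

lemma is_markov_refresh: "is_markov (refresh_op \<eta> :: ((real^'d) \<times> (real^'d) \<Rightarrow> real) \<Rightarrow> _)"
  unfolding is_markov_def
proof (intro conjI allI impI bounded_borel_refresh)
  fix \<nu> :: "((real^'d) \<times> (real^'d)) measure" assume \<nu>: "prob_space \<nu> \<and> sets \<nu> = sets borel"
  interpret S: prob_space "std_gaussian :: (real^'d) measure" by (rule prob_space_std_gaussian)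
  interpret N: prob_space \<nu> using \<nu> by simp
  interpret P: pair_prob_space \<nu> "std_gaussian :: (real^'d) measure" ..
  have [measurable_cong]: "sets \<nu> = sets (borel \<Otimes>\<^sub>M borel)" using \<nu> unfolding borel_prod by simp
  \<comment> \<open>The witness is the law of the refreshed point when the starting point and the
    Gaussian are independent.\<close>
  define T :: "((real^'d) \<times> (real^'d)) \<times> (real^'d) \<Rightarrow> (real^'d) \<times> (real^'d)"
    where "T p = (fst (fst p), \<eta> *\<^sub>R snd (fst p) + sqrt (1 - \<eta>\<^sup>2) *\<^sub>R snd p)" for p
  have "T \<in> measurable (\<nu> \<Otimes>\<^sub>M std_gaussian) (borel \<Otimes>\<^sub>M borel)" unfolding T_def by measurable
  then have T[measurable]: "T \<in> measurable (\<nu> \<Otimes>\<^sub>M std_gaussian) borel" by (simp add: borel_prod)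
  let ?\<rho> = "distr (\<nu> \<Otimes>\<^sub>M std_gaussian) borel T"
  have "prob_space ?\<rho>" by (rule P.prob_space_distr) (rule T)
  moreover have "(\<integral>z. f z \<partial>?\<rho>) = (\<integral>z. refresh_op \<eta> f z \<partial>\<nu>)" if f: "bounded_borel f" for f
  proof -
    have "(\<integral>z. f z \<partial>?\<rho>) = (\<integral>p. f (T p) \<partial>(\<nu> \<Otimes>\<^sub>M std_gaussian))"
      by (rule integral_distr) (use f in \<open>auto dest: bounded_borel_measurable\<close>)
    also have "\<dots> = (\<integral>z. \<integral>x. f (T (z, x)) \<partial>std_gaussian \<partial>\<nu>)"
      by (rule P.integral_fst'[symmetric]) (rule P.bounded_borel_integrable[OF f T])
    finally show ?thesis by (simp add: T_def refresh_op_eq)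
  qed
  ultimately show "\<exists>\<rho>. prob_space \<rho> \<and> sets \<rho> = sets borel \<and> (\<forall>f. bounded_borel f \<longrightarrow> (\<integral>z. f z \<partial>\<rho>) = (\<integral>z. refresh_op \<eta> f z \<partial>\<nu>))"
    by (intro exI[of _ ?\<rho>]) simp
qed

lemma is_markov_flow:
  assumes m: "hamiltonian_flow U t \<in> borel_measurable borel"
  shows "is_markov (flow_op U t)"
  unfolding is_markov_def
proof (intro conjI allI impI)
  show "bounded_borel (flow_op U t f)" if f: "bounded_borel f" for f
  proof -
    obtain B where "\<And>x. \<bar>f x\<bar> \<le> B" using f bounded_borelE by blast
    then show ?thesis
      using measurable_compose[OF m bounded_borel_measurable[OF f]] unfolding flow_op_def
      by (intro bounded_borelI[of _ B]) auto
  qed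
  fix \<nu> :: "('a \<times> 'a) measure" assume \<nu>: "prob_space \<nu> \<and> sets \<nu> = sets borel"
  then have m': "hamiltonian_flow U t \<in> measurable \<nu> borel" using m measurable_cong_sets by blast
  let ?\<rho> = "distr \<nu> borel (hamiltonian_flow U t)"
  have "prob_space ?\<rho>" using \<nu> m' by (intro prob_space.prob_space_distr) auto
  moreover have "(\<integral>z. f z \<partial>?\<rho>) = (\<integral>z. flow_op U t f z \<partial>\<nu>)" if "bounded_borel f" for f
    unfolding flow_op_def by (rule integral_distr[OF m' bounded_borel_measurable[OF that]])
  ultimately show "\<exists>\<rho>. prob_space \<rho> \<and> sets \<rho> = sets borel \<and> (\<forall>f. bounded_borel f \<longrightarrow> (\<integral>z. f z \<partial>\<rho>) = (\<integral>z. flow_op U t f z \<partial>\<nu>))"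
    by (intro exI[of _ ?\<rho>]) simp
qed

lemma (in prob_space) jensen_ln:
  fixes k :: "'a \<Rightarrow> real"
  assumes [measurable]: "k \<in> borel_measurable M" and a: "0 < a" and ab: "\<And>x. a \<le> k x" "\<And>x. k x \<le> b"
  shows "expectation (\<lambda>x. ln (k x)) \<le> ln (expectation k)"
    and "integrable M (\<lambda>x. ln (k x))" and "integrable M k" and "a \<le> expectation k"
proof -
  have pos: "0 < k x" for x using a ab(1)[of x] by linarith
  have "\<bar>ln (k x)\<bar> \<le> \<bar>ln a\<bar> + \<bar>ln b\<bar>" for x
  proof -
    have "ln a \<le> ln (k x)" "ln (k x) \<le> ln b"
      using a ab[of x] pos[of x] by (subst ln_le_cancel_iff; linarith)+
    then show ?thesis by linarith
  qed
  then show il: "integrable M (\<lambda>x. ln (k x))"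
    by (intro integrable_const_bound[of _ "\<bar>ln a\<bar> + \<bar>ln b\<bar>"]) auto
  show ik: "integrable M k"
    using ab pos by (intro integrable_const_bound[of _ b]) (auto simp: abs_of_pos)
  show "a \<le> expectation k" using ik ab by (intro integral_ge_const) auto
  have "exp (expectation (\<lambda>x. ln (k x))) \<le> expectation k"
    using exp_expectation_le[OF il] ik pos by simp
  then show "expectation (\<lambda>x. ln (k x)) \<le> ln (expectation k)"
    by (metis exp_gt_zero exp_le_cancel_iff exp_ln less_le_trans)
qed

section \<open>Log-Harnack inequalities\<close>

locale hmc = potential U L for U :: "real^'d \<Rightarrow> real" and L +
  fixes t \<eta> :: real
  assumes t: "0 < t" "t \<le> 1/4" and \<eta>: "0 \<le> \<eta>" "\<eta> < 1" and prob: "prob_space (gibbs U)"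
begin

definition "\<sigma> = sqrt (1 - \<eta>\<^sup>2)"

lemma \<eta>2: "\<eta>\<^sup>2 < 1"
  using \<eta> by (simp add: power_less_one_iff abs_square_less_1)

lemma \<sigma>: "0 < \<sigma>" "\<sigma>\<^sup>2 = 1 - \<eta>\<^sup>2"
  using \<eta>2 by (auto simp: \<sigma>_def)

abbreviation "\<mu> \<equiv> gibbs U \<Otimes>\<^sub>M (std_gaussian :: (real^'d) measure)"
abbreviation "\<D> \<equiv> refresh_op \<eta>"
abbreviation "Q \<equiv> hmc_op U \<eta> t"

sublocale G: prob_space "std_gaussian :: (real^'d) measure" by (rule prob_space_std_gaussian)
sublocale \<pi>: prob_space "gibbs U" by (rule prob)
sublocale \<mu>: pair_prob_space "gibbs U" "std_gaussian :: (real^'d) measure" ..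

lemma sets_gibbs[simp, measurable_cong]: "sets (gibbs U) = sets borel"
  by (simp add: gibbs_def)

lemma sets_\<mu>: "sets \<mu> = sets borel"
proof -
  have "sets \<mu> = sets (borel \<Otimes>\<^sub>M borel)" by (intro sets_pair_measure_cong) simp_all
  then show ?thesis unfolding borel_prod .
qed

lemma U_measurable[measurable]: "U \<in> borel_measurable borel"
  using U_derivative by (intro borel_measurable_continuous_onI) (meson continuous_at_imp_continuous_on has_derivative_continuous)

lemma energy_measurable[measurable]: "energy \<in> borel_measurable borel"
  unfolding energy_def[abs_def] borel_prod[symmetric] by measurable

lemma \<mu>_density: "\<exists>c. \<mu> = density lborel (\<lambda>z. ennreal (c * exp (- energy z)))"
proof -
  define Z where "Z = (\<integral>y. exp (- U y) \<partial>lborel)"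
  have Z: "0 \<le> Z" unfolding Z_def by simp
  have "\<mu> = density (lborel \<Otimes>\<^sub>M lborel) (\<lambda>(x, v). ennreal (exp (- U x) / Z) * ennreal (gauss_density v))"
    unfolding gibbs_def std_gaussian_eq Z_def[symmetric]
    by (intro pair_measure_density) (auto simp: std_gaussian_eq[symmetric] intro: G.sigma_finite_measure_axioms lborel.sigma_finite_measure_axioms)
  also have "\<dots> = density (lborel \<Otimes>\<^sub>M lborel) (\<lambda>z. ennreal (gauss_density (0::real^'d) / Z * exp (- energy z)))"
  proof (intro arg_cong[where f="density _"] ext)
    fix z :: "(real^'d) \<times> (real^'d)"
    obtain x v where z: "z = (x, v)" by (cases z)
    have "exp (- energy z) = exp (- U x) * exp (- (norm v)\<^sup>2 / 2)"
      unfolding exp_add[symmetric] by (simp add: z energy_def)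
    then have "exp (- U x) / Z * gauss_density v = gauss_density (0::real^'d) / Z * exp (- energy z)"
      unfolding gauss_density_exp[of v] by simp
    then show "(case z of (x, v) \<Rightarrow> ennreal (exp (- U x) / Z) * ennreal (gauss_density v)) = ennreal (gauss_density (0::real^'d) / Z * exp (- energy z))"
      using Z by (simp add: z flip: ennreal_mult)
  qed
  finally show ?thesis unfolding lborel_prod by blast
qed

text \<open>The density is a function of the conserved energy, so it can be pulled through the
  push-forward; Liouville's theorem then applies to the remaining Lebesgue measure.\<close>

lemma \<mu>_flow: "distr \<mu> borel (\<Phi> t) = \<mu>"
proof -
  obtain c where c: "\<mu> = density lborel (\<lambda>z. ennreal (c * exp (- energy z)))" using \<mu>_density by blast
  let ?\<rho> = "\<lambda>z. ennreal (c * exp (- energy z))"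
  have "distr \<mu> borel (\<Phi> t) = distr (density lborel (\<lambda>z. ?\<rho> (\<Phi> t z))) borel (\<Phi> t)"
    unfolding c energy_flow ..
  also have "\<dots> = density (distr lborel borel (\<Phi> t)) ?\<rho>"
    by (rule density_distr[symmetric]) auto
  also have "\<dots> = \<mu>" using liouville[of t] t c by simp
  finally show ?thesis .
qed

lemma \<mu>_measurable: "f \<in> borel_measurable borel \<Longrightarrow> f \<in> borel_measurable \<mu>"
  using measurable_cong_sets[OF sets_\<mu> refl] by blast

lemma bounded_borel_flow: "bounded_borel f \<Longrightarrow> bounded_borel (flow_op U t f)"
  using is_markov_flow[OF flow_measurable] unfolding is_markov_def by blast

lemma integral_\<mu>_flow:
  assumes "bounded_borel f"
  shows "(\<integral>z. flow_op U t f z \<partial>\<mu>) = (\<integral>z. f z \<partial>\<mu>)"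
proof -
  have "(\<integral>z. f z \<partial>\<mu>) = (\<integral>z. f z \<partial>distr \<mu> borel (\<Phi> t))" by (simp add: \<mu>_flow)
  also have "\<dots> = (\<integral>z. f (\<Phi> t z) \<partial>\<mu>)"
    by (rule integral_distr[OF \<mu>_measurable[OF flow_measurable] bounded_borel_measurable[OF assms]])
  finally show ?thesis by (simp add: flow_op_def)
qed

lemma integral_\<mu>_refresh:
  assumes f: "bounded_borel f"
  shows "(\<integral>z. \<D> f z \<partial>\<mu>) = (\<integral>z. f z \<partial>\<mu>)"
proof -
  interpret GG: pair_prob_space "std_gaussian :: (real^'d) measure" "std_gaussian :: (real^'d) measure" ..
  have fm[measurable]: "f \<in> borel_measurable (borel \<Otimes>\<^sub>M borel)"
    using bounded_borel_measurable[OF f] by (simp add: borel_prod)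
  have int: "integrable \<mu> h" if "bounded_borel h" for h
    by (rule \<mu>.bounded_borel_integrable[OF that \<mu>_measurable[OF measurable_ident_sets[OF refl]]])
  have bf: "bounded_borel (\<lambda>v. f (x, v))" for x
  proof -
    obtain B where "\<And>x. \<bar>f x\<bar> \<le> B" using f bounded_borelE by blast
    then show ?thesis by (intro bounded_borelI[of _ B]) auto
  qed
  have inner: "(\<integral>v. \<D> f (x, v) \<partial>std_gaussian) = (\<integral>v. f (x, v) \<partial>std_gaussian)" for x
  proof -
    let ?T = "\<lambda>(v :: real^'d, y). \<eta> *\<^sub>R v + \<sigma> *\<^sub>R y"
    have T: "?T \<in> measurable (std_gaussian \<Otimes>\<^sub>M std_gaussian) borel" by measurable
    have "(\<integral>v. f (x, v) \<partial>std_gaussian) = (\<integral>v. f (x, v) \<partial>distr (std_gaussian \<Otimes>\<^sub>M std_gaussian) borel ?T)"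
      by (simp add: distr_std_gaussian_rotation[OF \<sigma>])
    also have "\<dots> = (\<integral>p. f (x, ?T p) \<partial>(std_gaussian \<Otimes>\<^sub>M std_gaussian))"
      by (rule integral_distr[OF T bounded_borel_measurable[OF bf]])
    also have "\<dots> = (\<integral>v. \<integral>y. f (x, ?T (v, y)) \<partial>std_gaussian \<partial>std_gaussian)"
      by (rule GG.integral_fst'[symmetric]) (rule GG.bounded_borel_integrable[OF bf T])
    finally show ?thesis by (simp add: refresh_op_eq \<sigma>_def)
  qed
  have "(\<integral>z. \<D> f z \<partial>\<mu>) = (\<integral>x. \<integral>v. \<D> f (x, v) \<partial>std_gaussian \<partial>gibbs U)"
    by (rule \<mu>.integral_fst'[symmetric]) (intro int bounded_borel_refresh f)
  also have "\<dots> = (\<integral>z. f z \<partial>\<mu>)"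
    unfolding inner by (rule \<mu>.integral_fst') (intro int f)
  finally show ?thesis .
qed

lemma Q_eq: "Q f = \<D> (flow_op U t (\<D> f))"
  by (simp add: hmc_op_def)

lemma is_markov_Q: "is_markov Q"
  unfolding hmc_op_def by (intro is_markov_compose is_markov_refresh is_markov_flow flow_measurable)

lemma bounded_borel_Q: "bounded_borel f \<Longrightarrow> bounded_borel ((Q ^^ n) f)"
  using is_markov_funpow[OF is_markov_Q] unfolding is_markov_def by blast

lemma integral_\<mu>_Q: "bounded_borel f \<Longrightarrow> (\<integral>z. (Q ^^ n) f z \<partial>\<mu>) = (\<integral>z. f z \<partial>\<mu>)"
proof (induction n)
  case (Suc n)
  have "(\<integral>z. (Q ^^ Suc n) f z \<partial>\<mu>) = (\<integral>z. \<D> (flow_op U t (\<D> ((Q ^^ n) f))) z \<partial>\<mu>)"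
    by (simp add: Q_eq)
  also have "\<dots> = (\<integral>z. (Q ^^ n) f z \<partial>\<mu>)"
    using bounded_borel_Q[OF Suc.prems, of n]
    by (simp add: integral_\<mu>_flow integral_\<mu>_refresh bounded_borel_refresh bounded_borel_flow)
  finally show ?case using Suc by simp
qed simp

text \<open>The functions \<open>k = exp f\<close> for bounded Borel \<open>f\<close>.\<close>

definition between :: "real \<Rightarrow> real \<Rightarrow> ((real^'d) \<times> (real^'d) \<Rightarrow> real) \<Rightarrow> bool" where
  "between a b k \<longleftrightarrow> k \<in> borel_measurable borel \<and> (\<forall>z. a \<le> k z \<and> k z \<le> b)"

lemma between_refresh: "between a b k \<Longrightarrow> between a b (\<D> k)"
  unfolding between_def using refresh_op_between[of k a b] by auto

lemma between_flow: "between a b k \<Longrightarrow> between a b (flow_op U t k)"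
  unfolding between_def flow_op_def by (auto simp del: split_paired_All)

lemma between_Q: "between a b k \<Longrightarrow> between a b (Q k)"
  unfolding Q_eq by (intro between_refresh between_flow)

lemma between_Q_funpow: "between a b k \<Longrightarrow> between a b ((Q ^^ n) k)"
  by (induction n) (auto intro: between_Q)

lemma between_bounded_borel: "between a b k \<Longrightarrow> bounded_borel k"
  unfolding between_def by (intro bounded_borelI[of _ "\<bar>a\<bar> + \<bar>b\<bar>"]) (auto simp: abs_if, smt+)

lemma between_ln: "0 < a \<Longrightarrow> between a b k \<Longrightarrow> between (ln a) (ln b) (\<lambda>z. ln (k z))"
  unfolding between_def by (auto intro!: ln_mono elim: order_less_le_trans dest: spec)

lemma Q_integral: "Q f (x, v) = (\<integral>y. \<D> f (\<Phi> t (x, \<eta> *\<^sub>R v + \<sigma> *\<^sub>R y)) \<partial>std_gaussian)"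
  by (simp add: Q_eq refresh_op_eq[of _ _ "(x, v)"] flow_op_def \<sigma>_def)

end

context hmc
begin

lemma between_curry_measurable:
  assumes "between a b k" "T \<in> measurable M borel"
  shows "(\<lambda>y. k (T y)) \<in> borel_measurable M"
  using assms measurable_compose unfolding between_def by blast

lemma affine_pair_measurable: "(\<lambda>y. (x, c + s *\<^sub>R y)) \<in> measurable borel (borel :: ((real^'d) \<times> (real^'d)) measure)"
  unfolding borel_prod[symmetric] by measurable

text \<open>The two points share their position, so translating the noise by
  \<open>(\<eta> / \<sigma>) *\<^sub>R (v - v')\<close> makes the refreshed points coincide.\<close>

lemma refresh_shift:
  assumes k: "between a b k" and a: "0 < a"
  shows "\<D> (\<lambda>z. ln (k z)) (x, v) \<le> ln (\<D> k (x, v')) + \<eta>\<^sup>2 * (norm (v - v'))\<^sup>2 / (2 * \<sigma>\<^sup>2)"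
proof -
  define K where "K y = k (x, \<eta> *\<^sub>R v' + \<sigma> *\<^sub>R y)" for y
  define h where "h = (\<eta> / \<sigma>) *\<^sub>R (v - v')"
  have Km: "K \<in> borel_measurable borel"
    unfolding K_def by (rule between_curry_measurable[OF k affine_pair_measurable])
  have "K (y + h) = k (x, \<eta> *\<^sub>R v + \<sigma> *\<^sub>R y)" for y
    using \<sigma> by (simp add: K_def h_def algebra_simps)
  moreover have "(\<integral>y. ln (K (y + h)) \<partial>std_gaussian) \<le> ln (\<integral>y. K y \<partial>std_gaussian) + (norm h)\<^sup>2 / 2"
    by (rule gaussian_shift[OF Km a]) (use k in \<open>auto simp: K_def between_def\<close>)
  moreover have "(norm h)\<^sup>2 / 2 = \<eta>\<^sup>2 * (norm (v - v'))\<^sup>2 / (2 * \<sigma>\<^sup>2)"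
    by (simp add: h_def power_mult_distrib power_divide)
  ultimately show ?thesis by (simp add: refresh_op_eq K_def \<sigma>_def[symmetric])
qed

text \<open>Both copies use the same noise in the second refreshment, where \<open>le\<close>
  applies pointwise. In the first one, the noise of the second copy is translated so that its
  momentum is that of the first copy plus \<open>w\<close>; as \<open>w\<close> does not depend on
  the noise, only a translation is paid for.\<close>

lemma predictable_step:
  assumes F: "bounded_borel F" and K: "between a b K" and a: "0 < a"
    and le: "\<And>p y. F (fst (\<Phi> t (x, p)), \<eta> *\<^sub>R snd (\<Phi> t (x, p)) + \<sigma> *\<^sub>R y)
      \<le> ln (K (fst (\<Phi> t (x', p + w)), \<eta> *\<^sub>R snd (\<Phi> t (x', p + w)) + \<sigma> *\<^sub>R y)) + C"
  shows "Q F (x, v) \<le> ln (Q K (x', v')) + C + (norm (w - \<eta> *\<^sub>R (v' - v)))\<^sup>2 / (2 * \<sigma>\<^sup>2)"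
proof -
  have step: "\<D> F (\<Phi> t (x, p)) \<le> ln (\<D> K (\<Phi> t (x', p + w))) + C" for p
  proof -
    let ?z = "\<Phi> t (x, p)" and ?z' = "\<Phi> t (x', p + w)"
    let ?K = "\<lambda>y. K (fst ?z', \<eta> *\<^sub>R snd ?z' + \<sigma> *\<^sub>R y)"
    have Km: "?K \<in> borel_measurable std_gaussian"
      using between_curry_measurable[OF K affine_pair_measurable] by simp
    have Kab: "a \<le> ?K y" "?K y \<le> b" for y using K by (auto simp: between_def)
    note J = G.jensen_ln[of ?K a b, OF Km a Kab]
    have iF: "integrable std_gaussian (\<lambda>y. F (fst ?z, \<eta> *\<^sub>R snd ?z + \<sigma> *\<^sub>R y))"
      by (rule G.bounded_borel_integrable[OF F]) (use affine_pair_measurable in simp)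
    have "\<D> F ?z \<le> (\<integral>y. ln (?K y) + C \<partial>std_gaussian)"
      unfolding refresh_op_eq \<sigma>_def[symmetric] by (intro integral_mono iF le) (use J(2) in auto)
    also have "\<dots> = (\<integral>y. ln (?K y) \<partial>std_gaussian) + C"
      using J(2) G.prob_space by simp
    also have "\<dots> \<le> ln (\<D> K ?z') + C"
      using J(1) by (simp add: refresh_op_eq \<sigma>_def[symmetric])
    finally show ?thesis .
  qed
  define M where "M y = \<D> K (\<Phi> t (x', \<eta> *\<^sub>R v' + \<sigma> *\<^sub>R y))" for y
  define h where "h = (1 / \<sigma>) *\<^sub>R (w - \<eta> *\<^sub>R (v' - v))"
  have DK: "between a b (\<D> K)" by (rule between_refresh[OF K])
  have Mm: "M \<in> borel_measurable borel"
    unfolding M_def by (rule between_curry_measurable[OF DK measurable_compose[OF affine_pair_measurable flow_measurable]])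
  have Mab: "a \<le> M y" "M y \<le> b" for y using DK by (auto simp: between_def M_def simp del: split_paired_All)
  have Mh: "M (y + h) = \<D> K (\<Phi> t (x', \<eta> *\<^sub>R v + \<sigma> *\<^sub>R y + w))" for y
    using \<sigma> by (simp add: M_def h_def algebra_simps)
  have iD: "integrable std_gaussian (\<lambda>y. \<D> F (\<Phi> t (x, \<eta> *\<^sub>R v + \<sigma> *\<^sub>R y)))"
    by (rule G.bounded_borel_integrable[OF bounded_borel_refresh[OF F]])
      (use measurable_compose[OF affine_pair_measurable flow_measurable] in simp)
  have iM: "integrable std_gaussian (\<lambda>y. ln (M (y + h)))"
    by (rule G.jensen_ln(2)[of _ a b]) (use Mm Mab a in auto)
  have "Q F (x, v) \<le> (\<integral>y. ln (M (y + h)) + C \<partial>std_gaussian)"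
    unfolding Q_integral Mh by (intro integral_mono iD step) (use iM Mh in auto)
  also have "\<dots> = (\<integral>y. ln (M (y + h)) \<partial>std_gaussian) + C" using iM G.prob_space by simp
  also have "\<dots> \<le> ln (\<integral>y. M y \<partial>std_gaussian) + (norm h)\<^sup>2 / 2 + C"
    using gaussian_shift[OF Mm a Mab] by simp
  also have "(\<integral>y. M y \<partial>std_gaussian) = Q K (x', v')" by (simp add: Q_integral M_def)
  also have "(norm h)\<^sup>2 / 2 = (norm (w - \<eta> *\<^sub>R (v' - v)))\<^sup>2 / (2 * \<sigma>\<^sup>2)"
    by (simp add: h_def power_mult_distrib power_divide)
  finally show ?thesis by simp
qed

text \<open>A predictable step with equal starting points and \<open>w = 0\<close> costs nothing.
  This is what allows steps beyond the steering phase to be added for free.\<close>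

lemma Q_jensen:
  assumes k: "between a b k" and a: "0 < a"
  shows "(Q ^^ n) (\<lambda>z. ln (k z)) z \<le> ln ((Q ^^ n) k z)"
proof (induction n arbitrary: z)
  case (Suc n)
  obtain x v where z: "z = (x, v)" by (cases z)
  have "Q ((Q ^^ n) (\<lambda>z. ln (k z))) (x, v) \<le> ln (Q ((Q ^^ n) k) (x, v)) + 0 + (norm (0 - \<eta> *\<^sub>R (v - v)))\<^sup>2 / (2 * \<sigma>\<^sup>2)"
    by (rule predictable_step[where a=a and b=b])
      (use Suc.IH a k in \<open>auto intro!: bounded_borel_Q between_Q_funpow between_bounded_borel[OF between_ln]\<close>)
  then show ?case by (simp add: z)
qed simp

text \<open>In the first refreshment the momentum of the second copy is transported by
  \<open>steer\<close>, so that the positions agree after the flow; \<open>W\<close> bounds this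
  displacement. The remaining velocity difference is paid for in the second refreshment, through
  \<open>refresh_shift\<close>.\<close>

lemma final_step:
  assumes k: "between a b k" and a: "0 < a"
    and W: "\<And>p. norm (steer t x x' p - p - \<eta> *\<^sub>R (v' - v)) \<le> W"
  shows "Q (\<lambda>z. ln (k z)) (x, v) \<le> ln (Q k (x', v')) + W\<^sup>2 / (2 * \<sigma>\<^sup>2)
     + \<eta>\<^sup>2 * (11/10 * norm (x' - x) / t)\<^sup>2 / (2 * \<sigma>\<^sup>2) + 36/25 * (L * norm (x' - x) * t\<^sup>2)\<^sup>2"
proof -
  define C where "C = \<eta>\<^sup>2 * (11/10 * norm (x' - x) / t)\<^sup>2 / (2 * \<sigma>\<^sup>2)"
  have lnk: "between (ln a) (ln b) (\<lambda>z. ln (k z))" by (rule between_ln[OF a k])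
  have step: "\<D> (\<lambda>z. ln (k z)) (\<Phi> t (x, p)) \<le> ln (\<D> k (\<Phi> t (x', steer t x x' p))) + C" for p
  proof -
    let ?z = "\<Phi> t (x, p)" and ?z' = "\<Phi> t (x', steer t x x' p)"
    let ?w = "steer t x x' p - p"
    have fz: "fst ?z' = fst ?z" using \<psi>_steer[OF t, of x' x p] by (simp add: \<psi>_def)
    have "norm (snd ?z - snd ?z') \<le> norm (snd ?z' - snd ?z - ?w) + norm (?w + (1 / t) *\<^sub>R (x' - x)) + norm ((1 / t) *\<^sub>R (x' - x))"
    proof -
      have "snd ?z - snd ?z' = (1 / t) *\<^sub>R (x' - x) - (?w + (1 / t) *\<^sub>R (x' - x)) - (snd ?z' - snd ?z - ?w)" by simp
      then show ?thesis
        using norm_triangle_ineq4[of "(1 / t) *\<^sub>R (x' - x) - (?w + (1 / t) *\<^sub>R (x' - x))" "snd ?z' - snd ?z - ?w"]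
          norm_triangle_ineq4[of "(1 / t) *\<^sub>R (x' - x)" "?w + (1 / t) *\<^sub>R (x' - x)"] by simp
    qed
    also have "\<dots> \<le> 16/15 * t * norm (x' - x) + 8/15 * t * norm (x' - x) + norm (x' - x) / t"
      using steer_velocity[OF t, of x' x p] steer_momentum[OF t, of x x' p] t by (intro add_mono) auto
    \<comment> \<open>\<open>16/15 + 8/15 = 8/5\<close>, which \<open>t\<^sup>2 \<le> 1/16\<close>
      turns into 1/10.\<close>
    also have "\<dots> \<le> 11/10 * norm (x' - x) / t"
    proof -
      have "t\<^sup>2 \<le> 1/16" using power_mono[of t "1/4" 2] t by (simp add: power2_eq_square)
      then have "t\<^sup>2 * norm (x' - x) \<le> 1/16 * norm (x' - x)" by (intro mult_right_mono) auto
      then show ?thesis using t by (simp add: field_simps power2_eq_square)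
    qed
    finally have "(norm (snd ?z - snd ?z'))\<^sup>2 \<le> (11/10 * norm (x' - x) / t)\<^sup>2" by (intro power_mono) auto
    then have "\<eta>\<^sup>2 * (norm (snd ?z - snd ?z'))\<^sup>2 / (2 * \<sigma>\<^sup>2) \<le> C"
      unfolding C_def by (intro divide_right_mono mult_left_mono) auto
    moreover have "\<D> (\<lambda>z. ln (k z)) (fst ?z, snd ?z) \<le> ln (\<D> k (fst ?z, snd ?z')) + \<eta>\<^sup>2 * (norm (snd ?z - snd ?z'))\<^sup>2 / (2 * \<sigma>\<^sup>2)"
      by (rule refresh_shift[OF k a])
    moreover have "(fst ?z, snd ?z') = ?z'" using fz by (metis prod.collapse)
    ultimately show ?thesis by simp
  qed
  define M where "M y = \<D> k (\<Phi> t (x', \<eta> *\<^sub>R v' + \<sigma> *\<^sub>R y))" for y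
  have Dk: "between a b (\<D> k)" by (rule between_refresh[OF k])
  have Mm[measurable]: "M \<in> borel_measurable borel"
    unfolding M_def by (rule between_curry_measurable[OF Dk measurable_compose[OF affine_pair_measurable flow_measurable]])
  have Mab: "a \<le> M y" "M y \<le> b" for y using Dk by (auto simp: between_def M_def simp del: split_paired_All)
  define w where "w p = steer t x x' p - p" for p
  \<comment> \<open>The displacement of the noise that gives the second copy the momentum produced
    by \<open>steer\<close>. Scaling in by \<sigma> and out by \<open>1 / \<sigma>\<close> leaves
    its Jacobian equal to that of \<open>w\<close>.\<close>
  define u where "u y = (1 / \<sigma>) *\<^sub>R (w (\<eta> *\<^sub>R v + \<sigma> *\<^sub>R y) - \<eta> *\<^sub>R (v' - v))" for y
  have Mu: "M (y + u y) = \<D> k (\<Phi> t (x', steer t x x' (\<eta> *\<^sub>R v + \<sigma> *\<^sub>R y)))" for y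
    using \<sigma> by (simp add: M_def u_def w_def algebra_simps)
  have "\<forall>p. \<exists>A. (w has_derivative (*v) A) (at p) \<and> (\<forall>h. norm (A *v h) \<le> norm h / 2) \<and> norm A \<le> 3/5 * L * norm (x' - x) * t\<^sup>2"
    unfolding w_def by (metis (no_types, lifting) steer_derivative[OF t])
  then obtain A where A: "\<And>p. (w has_derivative (*v) (A p)) (at p)"
    "\<And>p h. norm (A p *v h) \<le> norm h / 2" "\<And>p. norm (A p) \<le> 3/5 * L * norm (x' - x) * t\<^sup>2"
    by metis
  have du: "(u has_derivative (*v) (A (\<eta> *\<^sub>R v + \<sigma> *\<^sub>R y))) (at y)" for y
  proof -
    let ?p = "\<eta> *\<^sub>R v + \<sigma> *\<^sub>R y"
    have "((\<lambda>y. \<eta> *\<^sub>R v + \<sigma> *\<^sub>R y) has_derivative (\<lambda>h. \<sigma> *\<^sub>R h)) (at y)"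
      by (auto intro!: derivative_eq_intros)
    from has_derivative_compose[OF this A(1)]
    have "((\<lambda>y. w (\<eta> *\<^sub>R v + \<sigma> *\<^sub>R y)) has_derivative (\<lambda>h. A ?p *v (\<sigma> *\<^sub>R h))) (at y)" .
    then have "(u has_derivative (\<lambda>h. (1 / \<sigma>) *\<^sub>R (A ?p *v (\<sigma> *\<^sub>R h)))) (at y)"
      unfolding u_def by (auto intro!: derivative_eq_intros)
    moreover have "(1 / \<sigma>) *\<^sub>R (A ?p *v (\<sigma> *\<^sub>R h)) = A ?p *v h" for h
      using \<sigma> by (simp add: matrix_vector_mult_scaleR)
    ultimately show ?thesis by simp
  qed
  have um[measurable]: "u \<in> borel_measurable borel"
    using du by (intro borel_measurable_continuous_onI) (meson continuous_at_imp_continuous_on has_derivative_continuous)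
  have "norm (u y) \<le> W / \<sigma>" for y
    using W[of "\<eta> *\<^sub>R v + \<sigma> *\<^sub>R y"] \<sigma>(1) by (simp add: u_def w_def divide_right_mono)
  then have T: "(\<integral>y. ln (M (y + u y)) \<partial>std_gaussian) \<le> ln (\<integral>y. M y \<partial>std_gaussian) + (W / \<sigma>)\<^sup>2 / 2 + 4 * (3/5 * L * norm (x' - x) * t\<^sup>2)\<^sup>2"
    by (intro gaussian_transport[where A="\<lambda>y. A (\<eta> *\<^sub>R v + \<sigma> *\<^sub>R y)" and a=a and b=b] du A(2,3) Mm a Mab)
  have iM: "integrable std_gaussian (\<lambda>y. ln (M (y + u y)))"
    by (rule G.jensen_ln(2)[of _ a b]) (use Mab a in auto)
  have iD: "integrable std_gaussian (\<lambda>y. \<D> (\<lambda>z. ln (k z)) (\<Phi> t (x, \<eta> *\<^sub>R v + \<sigma> *\<^sub>R y)))"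
    by (rule G.bounded_borel_integrable[OF bounded_borel_refresh[OF between_bounded_borel[OF lnk]]])
      (use measurable_compose[OF affine_pair_measurable flow_measurable] in simp)
  have "Q (\<lambda>z. ln (k z)) (x, v) \<le> (\<integral>y. ln (M (y + u y)) + C \<partial>std_gaussian)"
    unfolding Q_integral Mu by (intro integral_mono iD step) (use iM Mu in auto)
  also have "\<dots> = (\<integral>y. ln (M (y + u y)) \<partial>std_gaussian) + C" using iM G.prob_space by simp
  also have "\<dots> \<le> ln (\<integral>y. M y \<partial>std_gaussian) + (W / \<sigma>)\<^sup>2 / 2 + 4 * (3/5 * L * norm (x' - x) * t\<^sup>2)\<^sup>2 + C"
    using T by simp
  also have "(\<integral>y. M y \<partial>std_gaussian) = Q k (x', v')" by (simp add: Q_integral M_def)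
  also have "4 * (3/5 * L * norm (x' - x) * t\<^sup>2)\<^sup>2 = 36/25 * (L * norm (x' - x) * t\<^sup>2)\<^sup>2"
    by (simp add: power_mult_distrib power2_eq_square)
  finally show ?thesis by (simp add: C_def power_divide)
qed

end

section \<open>Steering over several steps along a prescribed path\<close>

lemma norm_diff_diff_le: "norm (a - b - c) \<le> norm a + norm b + norm (c :: 'a::real_normed_vector)"
  using norm_triangle_ineq4[of "a - b" c] norm_triangle_ineq4[of a b] by linarith

context hmc
begin

text \<open>The difference of the positions is steered along the path \<open>P\<close>, whose successive slopes are
  \<open>S 1, S 2, \<dots>\<close>; at each step the momentum is shifted so that, up to the force error, the position
  difference lands on \<open>P\<close> again. Only the last step has to hit its target exactly.\<close>

lemma steering_log_Harnack:
  fixes P S :: "nat \<Rightarrow> real^'d"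
  assumes k: "between a b k" and a: "0 < a" and N: "1 \<le> N"
    and P: "\<And>j. j \<le> N \<Longrightarrow> norm (P j) \<le> A0" "P N = 0"
    and S: "\<And>j. j < N \<Longrightarrow> P (Suc j) = P j + t *\<^sub>R S (Suc j)" "\<And>j. j \<le> N \<Longrightarrow> norm (S j) \<le> A1"
    and dS: "\<And>j. j < N \<Longrightarrow> norm (S (Suc j) - S j) \<le> t * A2" "norm (S N) \<le> t * A2"
    and init: "fst z' - fst z = P 0" "\<eta> *\<^sub>R (snd z' - snd z) = S 0"
  defines "M \<equiv> 16/15 * A0"
  defines "c \<equiv> (t * (A2 + 3 * M) + \<sigma>\<^sup>2 * A1)\<^sup>2 / (2 * \<sigma>\<^sup>2)"
  shows "(Q ^^ N) (\<lambda>z. ln (k z)) z \<le> ln ((Q ^^ N) k z') + (real N + 5/4) * c + 36/25 * (L * (31/30 * A0) * t\<^sup>2)\<^sup>2"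
proof -
  \<comment> \<open>The budget of the last step: \<open>c\<close> for the transport,
    \<open>5/4 * c\<close> for the velocity mismatch, and the Jacobian term.\<close>
  define Cf where "Cf = 9/4 * c + 36/25 * (L * (31/30 * A0) * t\<^sup>2)\<^sup>2"
  have A0: "0 \<le> A0" using P(1)[of 0] norm_ge_zero order_trans by blast
  have A1: "0 \<le> A1" using S(2)[of 0] norm_ge_zero order_trans by blast
  have A2: "0 \<le> A2" using dS(2) norm_ge_zero[of "S N"] t(1) by (metis order_trans zero_le_mult_iff linorder_not_le)
  have M0: "0 \<le> M" using A0 by (simp add: M_def)
  have t2: "t\<^sup>2 \<le> 1/16" using power_mono[of t "1/4" 2] t by (simp add: power2_eq_square)
  have \<sigma>1: "\<eta>\<^sup>2 = 1 - \<sigma>\<^sup>2" "0 < \<sigma>\<^sup>2" "\<sigma>\<^sup>2 \<le> 1" using \<sigma>(2) \<eta>2 by auto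
  have tM0: "0 \<le> t * M" and sA0: "0 \<le> \<sigma>\<^sup>2 * A1" using t M0 A1 by simp_all
  \<comment> \<open>This keeps the actual position difference within
    \<open>31/30 * A0\<close>.\<close>
  have EM: "t\<^sup>2 * M / 2 \<le> A0 / 30" using mult_right_mono[OF t2 M0] by (simp add: M_def)
  \<comment> \<open>The induction runs over the remaining steps with two invariants: the position
    difference misses \<open>P j\<close> by the force error of one step, and the contracted velocity
    difference misses the last slope \<open>S j\<close>. In the latter, \<open>t * M\<close> comes
    from the force, \<open>t * M / 2\<close> from having corrected the position, and
    \<open>\<sigma>\<^sup>2 * A1\<close> from the damping of the slope.\<close>
  have main: "(Q ^^ (N - j)) (\<lambda>z. ln (k z)) q \<le> ln ((Q ^^ (N - j)) k q') + (real (N - j) - 1) * c + Cf"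
    if j: "j < N" and pos: "norm (fst q' - fst q - P j) \<le> t\<^sup>2 * M / 2"
      and vel: "norm (\<eta> *\<^sub>R (snd q' - snd q) - S j) \<le> 3/2 * t * M + \<sigma>\<^sup>2 * A1" for j q q'
    using j pos vel
  proof (induction "N - j" arbitrary: j q q')
    case (Suc m)
    obtain x v where z: "q = (x, v)" by (cases q)
    obtain x' v' where z': "q' = (x', v')" by (cases q')
    let ?d = "x' - x" and ?y = "\<eta> *\<^sub>R (v' - v)"
    have pos: "norm (?d - P j) \<le> t\<^sup>2 * M / 2" and vel: "norm (?y - S j) \<le> 3/2 * t * M + \<sigma>\<^sup>2 * A1"
      using Suc.prems by (simp_all add: z z')
    have d: "norm ?d \<le> 31/30 * A0"
      using pos P(1)[OF less_imp_le[OF Suc.prems(1)]] EM norm_triangle_sub[of ?d "P j"] by linarith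
    have slope: "(1 / t) *\<^sub>R (P (Suc j) - ?d) = S (Suc j) - (1 / t) *\<^sub>R (?d - P j)"
      using S(1)[OF Suc.prems(1)] t by (simp add: algebra_simps)
    have err: "norm ((1 / t) *\<^sub>R (?d - P j)) \<le> t * M / 2"
    proof -
      have "norm ((1 / t) *\<^sub>R (?d - P j)) = norm (?d - P j) / t" using t by simp
      also have "\<dots> \<le> (t\<^sup>2 * M / 2) / t" using pos t by (intro divide_right_mono) auto
      finally show ?thesis using t by (simp add: power2_eq_square)
    qed
    have shift: "norm ((1 / t) *\<^sub>R (P (Suc j) - ?d) - ?y) \<le> t * (A2 + 2 * M) + \<sigma>\<^sup>2 * A1"
    proof -
      have "(1 / t) *\<^sub>R (P (Suc j) - ?d) - ?y = (S (Suc j) - S j) - (1 / t) *\<^sub>R (?d - P j) - (?y - S j)"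
        unfolding slope by simp
      then have "norm ((1 / t) *\<^sub>R (P (Suc j) - ?d) - ?y) \<le> norm (S (Suc j) - S j) + norm ((1 / t) *\<^sub>R (?d - P j)) + norm (?y - S j)"
        by (simp only: norm_diff_diff_le)
      also have "\<dots> \<le> t * A2 + t * M / 2 + (3/2 * t * M + \<sigma>\<^sup>2 * A1)"
        by (intro add_mono dS(1) Suc.prems(1) err vel)
      finally show ?thesis by (simp add: algebra_simps)
    qed
    show ?case
    proof (cases "Suc j = N")
      case True
      have Pd: "(1 / t) *\<^sub>R (P (Suc j) - ?d) = - ((1 / t) *\<^sub>R ?d)"
      proof -
        have "P (Suc j) - ?d = - ?d" using P(2) True by simp
        then show ?thesis by (simp only: scaleR_minus_right)
      qed
      let ?W = "t * (A2 + 3 * M) + \<sigma>\<^sup>2 * A1"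
      have W: "norm (steer t x x' p - p - ?y) \<le> ?W" for p
      proof -
        have "norm (steer t x x' p - p + (1 / t) *\<^sub>R ?d) \<le> 8/15 * t * norm ?d" by (rule steer_momentum[OF t])
        also have "\<dots> \<le> 8/15 * t * (31/30 * A0)" using d t by (intro mult_left_mono) auto
        also have "\<dots> \<le> t * M" using t A0 by (simp add: M_def mult_left_mono)
        finally have "norm (steer t x x' p - p + (1 / t) *\<^sub>R ?d) \<le> t * M" .
        moreover have "steer t x x' p - p - ?y = (steer t x x' p - p + (1 / t) *\<^sub>R ?d) + ((1 / t) *\<^sub>R (P (Suc j) - ?d) - ?y)"
          unfolding Pd by simp
        ultimately have "norm (steer t x x' p - p - ?y) \<le> t * M + (t * (A2 + 2 * M) + \<sigma>\<^sup>2 * A1)"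
          using shift norm_triangle_ineq[of "steer t x x' p - p + (1 / t) *\<^sub>R ?d" "(1 / t) *\<^sub>R (P (Suc j) - ?d) - ?y"]
          by (simp only:)
        then show ?thesis by (simp add: algebra_simps)
      qed
      \<comment> \<open>The path arrives with a slope of order \<open>t\<close>, so the last
        position difference is of order \<open>t\<^sup>2\<close>, and the velocity mismatch it
        causes is comparable to the translation bound \<open>?W\<close>.\<close>
      have dt: "norm ?d / t \<le> t * (A2 + M / 2)"
      proof -
        have "norm ((1 / t) *\<^sub>R ?d) \<le> norm (S N) + norm ((1 / t) *\<^sub>R (?d - P j))"
          using slope Pd True norm_triangle_ineq4[of "S N" "(1 / t) *\<^sub>R (?d - P j)"] by (metis norm_minus_cancel)
        moreover have "norm ((1 / t) *\<^sub>R ?d) = norm ?d / t" using t by simp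
        moreover have "t * (A2 + M / 2) = t * A2 + t * M / 2" by (simp add: algebra_simps)
        ultimately show ?thesis using dS(2) err by linarith
      qed
      have "\<eta>\<^sup>2 * (11/10 * norm ?d / t)\<^sup>2 \<le> 5/4 * ?W\<^sup>2 - ?W\<^sup>2 * 0"
      proof -
        have "norm ?d / t \<le> ?W" using dt tM0 sA0 by (simp add: algebra_simps)
        then have "(11/10 * norm ?d / t)\<^sup>2 \<le> (11/10 * ?W)\<^sup>2" using t by (intro power_mono) auto
        also have "(11/10 * r)\<^sup>2 \<le> 5/4 * r\<^sup>2" for r :: real by (simp add: power_mult_distrib power2_eq_square)
        finally have "\<eta>\<^sup>2 * (11/10 * norm ?d / t)\<^sup>2 \<le> 1 * (5/4 * ?W\<^sup>2)"
          using \<eta>2 by (intro mult_mono) auto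
        then show ?thesis by simp
      qed
      then have c2: "\<eta>\<^sup>2 * (11/10 * norm ?d / t)\<^sup>2 / (2 * \<sigma>\<^sup>2) \<le> 5/4 * c"
        unfolding c_def using divide_right_mono[of "\<eta>\<^sup>2 * (11/10 * norm ?d / t)\<^sup>2" "5/4 * ?W\<^sup>2" "2 * \<sigma>\<^sup>2"] \<sigma>1 by simp
      have c3: "(L * norm ?d * t\<^sup>2)\<^sup>2 \<le> (L * (31/30 * A0) * t\<^sup>2)\<^sup>2"
        using d L by (intro power_mono mult_right_mono mult_left_mono) auto
      have N1: "N - j = 1" using True by simp
      show ?thesis
        unfolding N1 using final_step[OF k a W] c2 c3 by (simp add: z z' Cf_def c_def)
    next
      case False
      then have jN: "Suc j < N" using Suc.prems(1) by simp
      \<comment> \<open>Under free motion this momentum shift takes the position difference exactly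
        to \<open>P (Suc j)\<close>; it depends only on the state before the noise is drawn.\<close>
      define w where "w = (1 / t) *\<^sub>R (P (Suc j) - ?d)"
      have dw: "?d + t *\<^sub>R w = P (Suc j)" using t by (simp add: w_def)
      have path: "norm (?d + r *\<^sub>R w) \<le> 31/30 * A0" if r: "0 \<le> r" "r \<le> t" for r
      proof -
        have rt: "0 \<le> r / t" "r / t \<le> 1" using r t by auto
        have "?d + r *\<^sub>R w = (1 - r / t) *\<^sub>R ?d + (r / t) *\<^sub>R P (Suc j)"
          unfolding dw[symmetric] using t by (simp add: algebra_simps)
        then have "norm (?d + r *\<^sub>R w) \<le> norm ((1 - r / t) *\<^sub>R ?d) + norm ((r / t) *\<^sub>R P (Suc j))"
          by (metis norm_triangle_ineq)
        also have "\<dots> = (1 - r / t) * norm ?d + (r / t) * norm (P (Suc j))" using rt by (simp only: norm_scaleR abs_of_nonneg diff_ge_0_iff_ge)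
        also have "\<dots> \<le> (1 - r / t) * (31/30 * A0) + (r / t) * (31/30 * A0)"
          using rt d P(1)[of "Suc j"] jN A0 by (intro add_mono mult_left_mono) auto
        also have "(1 - q) * B + q * B = B" for q B :: real by (simp add: algebra_simps)
        finally show ?thesis .
      qed
      \<comment> \<open>The constant in \<open>M\<close> is
        \<open>32/31 * 31/30 = 16/15\<close>.\<close>
      have Mb: "norm (fst (\<Phi> r (x', p + w)) - fst (\<Phi> r (x, p))) \<le> M" if "0 \<le> r" "r \<le> t" for r p
        using position_diff_bound[OF that t(2), of "(x', p + w)" "(x, p)" "31/30 * A0"] path by (simp add: M_def)
      let ?m = "N - Suc j"
      have m: "N - j = Suc ?m" using jN by simp
      have step: "(Q ^^ ?m) (\<lambda>z. ln (k z)) (fst (\<Phi> t (x, p)), \<eta> *\<^sub>R snd (\<Phi> t (x, p)) + \<sigma> *\<^sub>R y)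
         \<le> ln ((Q ^^ ?m) k (fst (\<Phi> t (x', p + w)), \<eta> *\<^sub>R snd (\<Phi> t (x', p + w)) + \<sigma> *\<^sub>R y)) + ((real ?m - 1) * c + Cf)" for p y
      proof -
        let ?Z = "\<Phi> t (x, p)" and ?Z' = "\<Phi> t (x', p + w)"
        note e = flow_diff_errors[OF less_imp_le[OF t(1)] Mb, of p]
        have 1: "norm (fst ?Z' - fst ?Z - P (Suc j)) \<le> t\<^sup>2 * M / 2"
          using e(2) by (simp add: dw[symmetric] diff_diff_eq add.assoc mult.commute)
        have e1: "norm (snd ?Z' - snd ?Z - w) \<le> M * t" using e(1) by simp
        have wS: "norm (w - S (Suc j)) \<le> t * M / 2" unfolding w_def slope using err by simp
        \<comment> \<open>One factor \<eta> is the second refreshment of this step, the other the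
          first refreshment of the next step. Writing \<open>\<eta>\<^sup>2\<close> as
          \<open>1 - \<sigma>\<^sup>2\<close> isolates the loss of slope.\<close>
        have "\<eta> *\<^sub>R (\<eta> *\<^sub>R (snd ?Z' - snd ?Z)) - S (Suc j)
            = \<eta>\<^sup>2 *\<^sub>R ((snd ?Z' - snd ?Z - w) + (w - S (Suc j))) - \<sigma>\<^sup>2 *\<^sub>R S (Suc j)"
        proof -
          have one: "\<eta>\<^sup>2 *\<^sub>R S (Suc j) + \<sigma>\<^sup>2 *\<^sub>R S (Suc j) = S (Suc j)"
            by (simp add: \<sigma>(2) flip: scaleR_add_left)
          have "\<eta>\<^sup>2 *\<^sub>R ((snd ?Z' - snd ?Z - w) + (w - S (Suc j))) - \<sigma>\<^sup>2 *\<^sub>R S (Suc j)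
              = \<eta>\<^sup>2 *\<^sub>R (snd ?Z' - snd ?Z) - (\<eta>\<^sup>2 *\<^sub>R S (Suc j) + \<sigma>\<^sup>2 *\<^sub>R S (Suc j))"
            by (simp add: scaleR_diff_right scaleR_add_right)
          also have "\<dots> = \<eta> *\<^sub>R (\<eta> *\<^sub>R (snd ?Z' - snd ?Z)) - S (Suc j)"
            unfolding one by (simp add: power2_eq_square)
          finally show ?thesis by simp
        qed
        then have "norm (\<eta> *\<^sub>R (\<eta> *\<^sub>R (snd ?Z' - snd ?Z)) - S (Suc j))
            \<le> norm (\<eta>\<^sup>2 *\<^sub>R ((snd ?Z' - snd ?Z - w) + (w - S (Suc j)))) + norm (\<sigma>\<^sup>2 *\<^sub>R S (Suc j))"
          by (metis norm_triangle_ineq4)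
        also have "\<dots> \<le> 1 * (M * t + t * M / 2) + \<sigma>\<^sup>2 * A1"
        proof (rule add_mono)
          have "norm (\<eta>\<^sup>2 *\<^sub>R ((snd ?Z' - snd ?Z - w) + (w - S (Suc j)))) = \<eta>\<^sup>2 * norm ((snd ?Z' - snd ?Z - w) + (w - S (Suc j)))"
            by simp
          also have "\<dots> \<le> 1 * (M * t + t * M / 2)"
          proof (rule mult_mono)
            show "norm ((snd ?Z' - snd ?Z - w) + (w - S (Suc j))) \<le> M * t + t * M / 2"
              by (rule order_trans[OF norm_triangle_ineq add_mono[OF e1 wS]])
          qed (use \<eta>2 in auto)
          finally show "norm (\<eta>\<^sup>2 *\<^sub>R ((snd ?Z' - snd ?Z - w) + (w - S (Suc j)))) \<le> 1 * (M * t + t * M / 2)" .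
          show "norm (\<sigma>\<^sup>2 *\<^sub>R S (Suc j)) \<le> \<sigma>\<^sup>2 * A1" using S(2)[of "Suc j"] jN by (simp add: mult_left_mono)
        qed
        finally have 2: "norm (\<eta> *\<^sub>R (\<eta> *\<^sub>R (snd ?Z' - snd ?Z)) - S (Suc j)) \<le> 3/2 * t * M + \<sigma>\<^sup>2 * A1"
          by (simp add: algebra_simps)
        have mm: "m = N - Suc j" using Suc.hyps(2) m by simp
        have "(Q ^^ ?m) (\<lambda>z. ln (k z)) (fst ?Z, \<eta> *\<^sub>R snd ?Z + \<sigma> *\<^sub>R y)
            \<le> ln ((Q ^^ ?m) k (fst ?Z', \<eta> *\<^sub>R snd ?Z' + \<sigma> *\<^sub>R y)) + (real ?m - 1) * c + Cf"
          by (rule Suc.hyps(1)[OF mm jN]) (use 1 2 in \<open>simp_all add: scaleR_diff_right\<close>)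
        then show ?thesis by simp
      qed
      have "Q ((Q ^^ ?m) (\<lambda>z. ln (k z))) (x, v) \<le> ln (Q ((Q ^^ ?m) k) (x', v')) + ((real ?m - 1) * c + Cf) + (norm (w - ?y))\<^sup>2 / (2 * \<sigma>\<^sup>2)"
        by (rule predictable_step[OF _ between_Q_funpow[OF k] a step]) (intro bounded_borel_Q between_bounded_borel[OF between_ln[OF a k]])
      moreover have "(norm (w - ?y))\<^sup>2 / (2 * \<sigma>\<^sup>2) \<le> c"
      proof -
        have "norm (w - ?y) \<le> t * (A2 + 3 * M) + \<sigma>\<^sup>2 * A1" using shift tM0 by (simp add: w_def algebra_simps)
        then show ?thesis unfolding c_def by (intro divide_right_mono power_mono) auto
      qed
      ultimately show ?thesis unfolding m by (simp add: z z' algebra_simps)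
    qed
  qed simp
  from main[of 0 z' z] show ?thesis
    using N init M0 tM0 sA0 by (simp add: Cf_def algebra_simps)
qed

end

text \<open>Difference quotients of the cubic Hermite basis \<open>(1 - u)\<^sup>2 (1 + 2 u)\<close>, \<open>u (1 - u)\<^sup>2\<close>.\<close>

definition hermite1 :: "real \<Rightarrow> real \<Rightarrow> real" where
  "hermite1 u v = - 3 * (u + v) + 2 * (u\<^sup>2 + u * v + v\<^sup>2)"

definition hermite2 :: "real \<Rightarrow> real \<Rightarrow> real" where
  "hermite2 u v = 1 - 2 * (u + v) + (u\<^sup>2 + u * v + v\<^sup>2)"

lemma hermite_quotients:
  "(1 - v)\<^sup>2 * (1 + 2 * v) - (1 - u)\<^sup>2 * (1 + 2 * u) = (v - u) * hermite1 u v"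
  "v * (1 - v)\<^sup>2 - u * (1 - u)\<^sup>2 = (v - u) * hermite2 u v"
  by (simp_all add: hermite1_def hermite2_def algebra_simps power2_eq_square)

text \<open>The lower bounds come from centering at the minima, \<open>(1/2, 1/2)\<close> and
  \<open>(2/3, 2/3)\<close>, where the positive quadratic form
  \<open>x\<^sup>2 + x * y + y\<^sup>2\<close> remains. The upper bounds use
  \<open>u\<^sup>2 \<le> u\<close> and its analogues on the unit square.\<close>

lemma hermite_bounds:
  assumes "0 \<le> u" "u \<le> 1" "0 \<le> v" "v \<le> 1"
  shows "\<bar>hermite1 u v\<bar> \<le> 3/2" "\<bar>hermite2 u v\<bar> \<le> 1"
proof -
  have quad: "0 \<le> x\<^sup>2 + x * y + y\<^sup>2" for x y :: real
  proof -
    have "x\<^sup>2 + x * y + y\<^sup>2 = (x + y / 2)\<^sup>2 + 3/4 * y\<^sup>2" by (simp add: power2_eq_square algebra_simps)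
    then show ?thesis by simp
  qed
  have sq: "u\<^sup>2 \<le> u" "v\<^sup>2 \<le> v" "u * v \<le> u" "u * v \<le> v"
    using assms by (auto simp: power2_eq_square mult_left_le mult_left_le_one_le)
  have "hermite1 u v + 3/2 = 2 * ((u - 1/2)\<^sup>2 + (u - 1/2) * (v - 1/2) + (v - 1/2)\<^sup>2)"
    by (simp add: hermite1_def power2_eq_square algebra_simps)
  then have "0 \<le> hermite1 u v + 3/2" using quad[of "u - 1/2" "v - 1/2"] by simp
  moreover have "hermite1 u v = 2 * (u\<^sup>2 - u) + 2 * (v\<^sup>2 - v) + (u * v - u) + (u * v - v)"
    by (simp add: hermite1_def algebra_simps)
  then have "hermite1 u v \<le> 0" using sq by simp
  ultimately show "\<bar>hermite1 u v\<bar> \<le> 3/2" by linarith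
  have "hermite2 u v + 1 = ((u - 2/3)\<^sup>2 + (u - 2/3) * (v - 2/3) + (v - 2/3)\<^sup>2) + 2/3"
    by (simp add: hermite2_def power2_eq_square algebra_simps)
  then have "0 \<le> hermite2 u v + 1" using quad[of "u - 2/3" "v - 2/3"] by simp
  moreover have "hermite2 u v = 1 + (u\<^sup>2 - u) + (v\<^sup>2 - v) + (u * v - u) - v"
    by (simp add: hermite2_def algebra_simps)
  then have "hermite2 u v \<le> 1" using sq assms by simp
  ultimately show "\<bar>hermite2 u v\<bar> \<le> 1" by linarith
qed

lemma norm_combination_le:
  assumes "\<bar>p\<bar> \<le> a" "\<bar>q\<bar> \<le> b"
  shows "norm (p *\<^sub>R x + q *\<^sub>R y) \<le> a * norm x + b * norm y"
  using norm_triangle_ineq[of "p *\<^sub>R x" "q *\<^sub>R y"] mult_right_mono[OF assms(1) norm_ge_zero[of x]]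
    mult_right_mono[OF assms(2) norm_ge_zero[of y]] by simp

context hmc
begin

text \<open>The cubic path starts at \<alpha> with slope \<beta> and reaches 0 with slope 0 at time
  \<open>s\<close>. The bounds reflect the size of the path, of its slope and of its second
  derivative; the last one makes consecutive slopes differ by order \<open>t\<close>.\<close>

lemma hermite_plan:
  fixes \<alpha> \<beta> :: "real^'d"
  assumes N: "1 \<le> N"
  defines "s \<equiv> real N * t"
  obtains P S where "P 0 = \<alpha>" "P N = 0" "S 0 = \<beta>"
    "\<And>j. j \<le> N \<Longrightarrow> norm (P j) \<le> norm \<alpha> + s * norm \<beta>"
    "\<And>j. j < N \<Longrightarrow> P (Suc j) = P j + t *\<^sub>R S (Suc j)"
    "\<And>j. j \<le> N \<Longrightarrow> norm (S j) \<le> 3/2 / s * norm \<alpha> + norm \<beta>"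
    "\<And>j. j < N \<Longrightarrow> norm (S (Suc j) - S j) \<le> t * (6 / s\<^sup>2 * norm \<alpha> + 4 / s * norm \<beta>)"
    "norm (S N) \<le> t * (6 / s\<^sup>2 * norm \<alpha> + 4 / s * norm \<beta>)"
proof -
  define u where "u j = real j / real N" for j
  define h where "h = 1 / real N"
  define P where "P j = ((1 - u j)\<^sup>2 * (1 + 2 * u j)) *\<^sub>R \<alpha> + (s * (u j * (1 - u j)\<^sup>2)) *\<^sub>R \<beta>" for j
  \<comment> \<open>\<open>S (Suc i)\<close> is the difference quotient between the nodes
    \<open>i\<close> and \<open>Suc i\<close>, whereas \<open>S 0\<close> is the derivative at the
    start, which has to be the prescribed \<beta>.\<close>
  define S where "S j = (case j of 0 \<Rightarrow> \<beta> | Suc i \<Rightarrow> (hermite1 (u i) (u (Suc i)) / s) *\<^sub>R \<alpha> + hermite2 (u i) (u (Suc i)) *\<^sub>R \<beta>)" for j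
  have N0: "0 < real N" using N by simp
  have s: "0 < s" using N0 t by (simp add: s_def)
  have h: "0 < h" "h \<le> 1" "h = t / s" using N N0 t by (auto simp: h_def s_def)
  have u: "0 \<le> u j" "j \<le> N \<Longrightarrow> u j \<le> 1" "u (Suc j) = u j + h" for j
    using N0 by (auto simp: u_def h_def add_divide_distrib)
  have uN: "u N = 1" "u 0 = 0" using N0 by (auto simp: u_def)
  have scale: "\<bar>h * p\<bar> \<le> h * b" if "\<bar>p\<bar> \<le> b" for p b
    using that h(1) by (simp add: abs_mult)
  have rate: "h * (6 / s) = t * (6 / s\<^sup>2)" "h * 4 = t * (4 / s)"
    using h(3) s by (auto simp: power2_eq_square)
  show ?thesis
  proof
    show "P 0 = \<alpha>" "P N = 0" "S 0 = \<beta>" by (simp_all add: P_def S_def uN)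
    show "norm (P j) \<le> norm \<alpha> + s * norm \<beta>" if "j \<le> N" for j
    proof -
      have v: "0 \<le> u j" "u j \<le> 1" using u that by auto
      have "(1 - u j)\<^sup>2 * (1 + 2 * u j) = 1 - (u j)\<^sup>2 * (3 - 2 * u j)" by (simp add: power2_eq_square algebra_simps)
      moreover have "0 \<le> (u j)\<^sup>2 * (3 - 2 * u j)" "0 \<le> (1 - u j)\<^sup>2 * (1 + 2 * u j)" using v by simp_all
      ultimately have 1: "\<bar>(1 - u j)\<^sup>2 * (1 + 2 * u j)\<bar> \<le> 1" by linarith
      have "0 \<le> u j * (1 - u j)\<^sup>2" "u j * (1 - u j)\<^sup>2 \<le> 1"
        using v by (auto intro!: mult_le_one power_le_one)
      then have 2: "\<bar>s * (u j * (1 - u j)\<^sup>2)\<bar> \<le> s" using s by (simp add: abs_mult mult_left_le)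
      show ?thesis unfolding P_def using norm_combination_le[OF 1 2] by simp
    qed
    show "P (Suc j) = P j + t *\<^sub>R S (Suc j)" for j
    proof -
      have th: "t / s = h" using h by simp
      have "P (Suc j) - P j = ((1 - u (Suc j))\<^sup>2 * (1 + 2 * u (Suc j)) - (1 - u j)\<^sup>2 * (1 + 2 * u j)) *\<^sub>R \<alpha>
        + (s * (u (Suc j) * (1 - u (Suc j))\<^sup>2 - u j * (1 - u j)\<^sup>2)) *\<^sub>R \<beta>"
        by (simp add: P_def algebra_simps)
      also have "\<dots> = (h * hermite1 (u j) (u (Suc j))) *\<^sub>R \<alpha> + (s * (h * hermite2 (u j) (u (Suc j)))) *\<^sub>R \<beta>"
        unfolding hermite_quotients by (simp add: u(3))
      also have "\<dots> = t *\<^sub>R S (Suc j)" using h(3) s by (simp add: S_def scaleR_add_right)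
      finally show ?thesis by (simp add: algebra_simps)
    qed
    show "norm (S j) \<le> 3/2 / s * norm \<alpha> + norm \<beta>" if "j \<le> N" for j
    proof (cases j)
      case 0
      then show ?thesis using s by (simp add: S_def)
    next
      case (Suc i)
      have "\<bar>hermite1 (u i) (u (Suc i))\<bar> \<le> 3/2" "\<bar>hermite2 (u i) (u (Suc i))\<bar> \<le> 1"
        using hermite_bounds[of "u i" "u (Suc i)"] u(1)[of i] u(1)[of "Suc i"] u(2)[of i] u(2)[of "Suc i"] that Suc by auto
      then have "\<bar>hermite1 (u i) (u (Suc i)) / s\<bar> \<le> 3/2 / s" "\<bar>hermite2 (u i) (u (Suc i))\<bar> \<le> 1"
        using s divide_right_mono[of "\<bar>hermite1 (u i) (u (Suc i))\<bar>" "3/2" s] by (auto simp: abs_divide)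
      from norm_combination_le[OF this, of \<alpha> \<beta>] show ?thesis by (simp add: S_def Suc)
    qed
    have small: "norm (p *\<^sub>R \<alpha> + q *\<^sub>R \<beta>) \<le> t * (6 / s\<^sup>2 * norm \<alpha> + 4 / s * norm \<beta>)"
      if "\<bar>p\<bar> \<le> h * (6 / s)" "\<bar>q\<bar> \<le> h * 4" for p q
      using norm_combination_le[OF that, of \<alpha> \<beta>] unfolding rate by (simp add: algebra_simps)
    show "norm (S (Suc j) - S j) \<le> t * (6 / s\<^sup>2 * norm \<alpha> + 4 / s * norm \<beta>)" if "j < N" for j
    proof (cases j)
      case 0
      \<comment> \<open>The first increment compares a difference quotient with a derivative and so
        needs its own formula.\<close>
      have eq: "S (Suc 0) - S 0 = (h * ((2 * h - 3) / s)) *\<^sub>R \<alpha> + (h * (h - 2)) *\<^sub>R \<beta>"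
        by (simp add: S_def uN u(3) hermite1_def hermite2_def power2_eq_square algebra_simps)
      have "\<bar>(2 * h - 3) / s\<bar> \<le> 6 / s" using h(1,2) s by (auto simp: abs_divide intro!: divide_right_mono)
      moreover have "\<bar>h - 2\<bar> \<le> 4" using h(1,2) by simp
      ultimately show ?thesis unfolding 0 eq by (intro small scale)
    next
      case (Suc i)
      have ui: "u i = u j - h" "u (Suc j) = u j + h" using u(3)[of i] u(3)[of j] Suc by auto
      have eq: "S (Suc j) - S j = (h * ((12 * u j - 6) / s)) *\<^sub>R \<alpha> + (h * (6 * u j - 4)) *\<^sub>R \<beta>"
      proof -
        have "hermite1 (u j) (u j + h) - hermite1 (u j - h) (u j) = h * (12 * u j - 6)"
          "hermite2 (u j) (u j + h) - hermite2 (u j - h) (u j) = h * (6 * u j - 4)"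
          by (simp_all add: hermite1_def hermite2_def power2_eq_square algebra_simps)
        moreover have "S (Suc j) - S j = ((hermite1 (u j) (u j + h) - hermite1 (u j - h) (u j)) / s) *\<^sub>R \<alpha>
            + (hermite2 (u j) (u j + h) - hermite2 (u j - h) (u j)) *\<^sub>R \<beta>"
        proof -
          have "S (Suc j) = (hermite1 (u j) (u j + h) / s) *\<^sub>R \<alpha> + hermite2 (u j) (u j + h) *\<^sub>R \<beta>"
            unfolding ui(2)[symmetric] by (simp add: S_def)
          moreover have "S j = (hermite1 (u j - h) (u j) / s) *\<^sub>R \<alpha> + hermite2 (u j - h) (u j) *\<^sub>R \<beta>"
            unfolding ui(1)[symmetric] by (simp add: S_def Suc)
          ultimately show ?thesis by (simp add: diff_divide_distrib scaleR_diff_left)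
        qed
        ultimately show ?thesis by simp
      qed
      have v: "0 \<le> u j" "u j \<le> 1" using u that by auto
      then have "\<bar>(12 * u j - 6) / s\<bar> \<le> 6 / s" using s by (auto simp: abs_divide abs_le_iff intro!: divide_right_mono)
      moreover have "\<bar>6 * u j - 4\<bar> \<le> 4" using v by (auto simp: abs_le_iff)
      ultimately show ?thesis unfolding eq by (intro small scale)
    qed
    obtain i where i: "N = Suc i" using N by (cases N) auto
    have ui: "u i = 1 - h" "u (Suc i) = 1" using u(3)[of i] uN i by auto
    \<comment> \<open>The cubic has slope 0 at its end, so the last difference quotient carries a
      factor \<open>h\<close> and obeys the same bound as an increment.\<close>
    have eq: "S N = (h * ((2 * h - 3) / s)) *\<^sub>R \<alpha> + (h * (h - 1)) *\<^sub>R \<beta>"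
    proof -
      have "hermite1 (1 - h) 1 = h * (2 * h - 3)" "hermite2 (1 - h) 1 = h * (h - 1)"
        by (simp_all add: hermite1_def hermite2_def power2_eq_square algebra_simps)
      then show ?thesis by (simp add: S_def i ui)
    qed
    have "\<bar>(2 * h - 3) / s\<bar> \<le> 6 / s" using h(1,2) s by (auto simp: abs_divide intro!: divide_right_mono)
    moreover have "\<bar>h - 1\<bar> \<le> 4" using h(1,2) by simp
    ultimately show "norm (S N) \<le> t * (6 / s\<^sup>2 * norm \<alpha> + 4 / s * norm \<beta>)"
      unfolding eq by (intro small scale)
  qed
qed

end

section \<open>Comparison of the costs with the stated constants\<close>

lemma cauchy_schwarz_two: "(p * X + q * Y)\<^sup>2 \<le> (p\<^sup>2 + q\<^sup>2) * (X\<^sup>2 + Y\<^sup>2)" for p q X Y :: real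
proof -
  have "(p\<^sup>2 + q\<^sup>2) * (X\<^sup>2 + Y\<^sup>2) = (p * X + q * Y)\<^sup>2 + (p * Y - q * X)\<^sup>2"
    by (simp add: power2_eq_square algebra_simps)
  then show ?thesis by simp
qed

text \<open>In the application, \<open>X\<close> and \<open>Y\<close> are the norms of the initial differences of positions and of
  contracted velocities, and \<open>s = N t\<close>.\<close>

lemma steering_cost_le:
  fixes t \<eta> s X Y r :: real
  assumes t: "0 < t" and \<eta>: "0 < \<eta>" "\<eta> < 1" and s: "2 * t \<le> s" "s \<le> 1/4"
    and XY: "0 \<le> X" "0 \<le> Y" "X\<^sup>2 + Y\<^sup>2 \<le> r" and L: "0 < L"
  defines "A0 \<equiv> X + s * Y" and "A1 \<equiv> 3/2 / s * X + Y" and "A2 \<equiv> 6 / s\<^sup>2 * X + 4 / s * Y"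
  shows "(s / t + 5/4) * ((t * (A2 + 3 * (16/15 * A0)) + (1 - \<eta>\<^sup>2) * A1)\<^sup>2 / (2 * (1 - \<eta>\<^sup>2)))
    + 36/25 * (L * (31/30 * A0) * t\<^sup>2)\<^sup>2 \<le> c_star L \<eta> ((1 - \<eta>) / t) s * r"
proof -
  define \<gamma> where "\<gamma> = (1 - \<eta>) / t"
  \<comment> \<open>\<open>\<kappa> = \<gamma> * (1 + \<eta>)\<close> lies between \<gamma> and
    \<open>2 * \<gamma>\<close>, so the noise variance per unit time can be exchanged for the
    friction.\<close>
  define \<kappa> where "\<kappa> = (1 - \<eta>\<^sup>2) / t"
  define T where "T = 12 / (\<eta> * s\<^sup>2) + 6 * \<gamma> / (\<eta> * s) + 4"
  have s0: "0 < s" using t s by linarith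
  have \<gamma>: "0 < \<gamma>" using t \<eta> by (simp add: \<gamma>_def)
  have \<kappa>eq: "\<kappa> = \<gamma> * (1 + \<eta>)" by (simp add: \<kappa>_def \<gamma>_def power2_eq_square algebra_simps)
  have \<kappa>: "\<gamma> \<le> \<kappa>" "\<kappa> \<le> 2 * \<gamma>" using \<gamma> \<eta> unfolding \<kappa>eq by (simp_all add: algebra_simps)
  have \<kappa>0: "0 < \<kappa>" using \<gamma> \<kappa> by linarith
  have r: "0 \<le> r" using XY(3) by (meson order_trans sum_power2_ge_zero)
  have e: "1 - \<eta>\<^sup>2 = t * \<kappa>" using t by (simp add: \<kappa>_def)
  \<comment> \<open>\<open>T\<close> without the factors \<open>1 / \<eta>\<close>, which can only
    enlarge it.\<close>
  define T0 where "T0 = 12 / s\<^sup>2 + 6 * \<gamma> / s + 4"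
  have T0: "0 \<le> T0" using \<gamma> s0 by (simp add: T0_def)
  have TT: "T0 \<le> T"
  proof -
    have "12 / s\<^sup>2 \<le> 12 / (\<eta> * s\<^sup>2)" "6 * \<gamma> / s \<le> 6 * \<gamma> / (\<eta> * s)"
      using \<eta> s0 \<gamma> by (auto intro!: divide_left_mono simp: mult_left_le_one_le)
    then show ?thesis by (simp add: T_def T0_def)
  qed
  \<comment> \<open>With \<open>s \<le> 1/4\<close>, constants and \<open>1 / s\<close> are absorbed
    into \<open>1 / s\<^sup>2\<close>, and \<gamma> into \<open>\<gamma> / s\<close>.\<close>
  have inv_s: "16 \<le> 1 / s\<^sup>2" "4 / s \<le> 1 / s\<^sup>2" "4 * \<gamma> \<le> \<gamma> / s"
    using s(2) s0 \<gamma> power_mono[of s "1/4" 2] by (auto simp: field_simps power2_eq_square)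
  define R where "R = A2 + 3 * (16/15 * A0) + \<kappa> * A1"
  \<comment> \<open>\<open>t * R\<close> bounds the translation of one step before division by
    \<sigma>. The weights 3/5 and 2/5 have squares of sum 13/25, so Cauchy-Schwarz afterwards loses
    no constant.\<close>
  have R: "0 \<le> R" "R \<le> T0 * (3/5 * X + 2/5 * Y)"
  proof -
    show "0 \<le> R" using XY s0 \<kappa>0 by (simp add: R_def A0_def A1_def A2_def)
    have Req: "R = (6 / s\<^sup>2 + 16/5 + \<kappa> * (3/2 / s)) * X + (4 / s + 16/5 * s + \<kappa>) * Y"
      by (simp add: R_def A0_def A1_def A2_def algebra_simps)
    have ks: "\<kappa> * (3/2 / s) \<le> 3 * (\<gamma> / s)"
      using mult_right_mono[OF \<kappa>(2), of "3/2 / s"] s0 by simp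
    have gs: "0 \<le> \<gamma> / s" using \<gamma> s0 by simp
    have T0eq: "T0 = 12 * (1 / s\<^sup>2) + 6 * (\<gamma> / s) + 4" by (simp add: T0_def)
    have "6 / s\<^sup>2 + 16/5 + \<kappa> * (3/2 / s) \<le> 3/5 * T0"
      using inv_s ks gs unfolding T0eq by simp
    moreover have "4 / s + 16/5 * s + \<kappa> \<le> 2/5 * T0"
      using inv_s gs s(2) \<kappa>(2) unfolding T0eq by simp
    ultimately have "R \<le> (3/5 * T0) * X + (2/5 * T0) * Y"
      unfolding Req using XY by (intro add_mono mult_right_mono) auto
    then show "R \<le> T0 * (3/5 * X + 2/5 * Y)" by (simp add: algebra_simps)
  qed
  have R2: "R\<^sup>2 \<le> T\<^sup>2 * r"
  proof -
    have "R\<^sup>2 \<le> (T0 * (3/5 * X + 2/5 * Y))\<^sup>2" by (rule power_mono[OF R(2) R(1)])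
    also have "\<dots> = T0\<^sup>2 * (3/5 * X + 2/5 * Y)\<^sup>2" by (rule power_mult_distrib)
    also have "\<dots> \<le> T\<^sup>2 * r"
    proof (intro mult_mono power_mono TT T0)
      have "(3/5 * X + 2/5 * Y)\<^sup>2 \<le> ((3/5)\<^sup>2 + (2/5)\<^sup>2) * (X\<^sup>2 + Y\<^sup>2)"
        by (rule cauchy_schwarz_two)
      also have "\<dots> \<le> 1 * (X\<^sup>2 + Y\<^sup>2)" by (intro mult_right_mono) (auto simp: power2_eq_square)
      finally show "(3/5 * X + 2/5 * Y)\<^sup>2 \<le> r" by (rule order_trans) (use XY(3) in simp)
    qed (use r in auto)
    finally show ?thesis .
  qed
  have st: "0 < s / t" "2 \<le> s / t" using t s by (auto simp: le_divide_eq)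
  have "(s / t + 5/4) * ((t * (A2 + 3 * (16/15 * A0)) + (1 - \<eta>\<^sup>2) * A1)\<^sup>2 / (2 * (1 - \<eta>\<^sup>2)))
    = (s / t + 5/4) * (t / (2 * \<kappa>)) * R\<^sup>2"
  proof -
    have "t * (A2 + 3 * (16/15 * A0)) + t * \<kappa> * A1 = t * R" by (simp add: R_def algebra_simps)
    then have "(t * (A2 + 3 * (16/15 * A0)) + (1 - \<eta>\<^sup>2) * A1)\<^sup>2 / (2 * (1 - \<eta>\<^sup>2)) = (t * R)\<^sup>2 / (2 * (t * \<kappa>))"
      unfolding e by (simp only:)
    also have "\<dots> = t / (2 * \<kappa>) * R\<^sup>2" using t by (simp add: power2_eq_square)
    finally show ?thesis by simp
  qed
  also have "\<dots> \<le> (s / \<gamma>) * R\<^sup>2"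
  proof (rule mult_right_mono)
    \<comment> \<open>There are at least two steps, so the fixed surcharge 5/4 is below
      \<open>s / t\<close>; the resulting factor 2 cancels against the 2 in the denominator.\<close>
    have "(s / t + 5/4) * (t / (2 * \<kappa>)) \<le> (2 * (s / t)) * (t / (2 * \<kappa>))"
      using st t \<kappa>0 by (intro mult_right_mono) auto
    also have "\<dots> = s / \<kappa>" using t \<kappa>0 by (simp add: field_simps)
    also have "\<dots> \<le> s / \<gamma>" using \<kappa> \<gamma> s0 by (intro divide_left_mono) auto
    finally show "(s / t + 5/4) * (t / (2 * \<kappa>)) \<le> s / \<gamma>" .
  qed simp
  also have "\<dots> \<le> (s / \<gamma>) * (T\<^sup>2 * r)" using R2 s0 \<gamma> by (intro mult_left_mono) auto
  finally have main: "(s / t + 5/4) * ((t * (A2 + 3 * (16/15 * A0)) + (1 - \<eta>\<^sup>2) * A1)\<^sup>2 / (2 * (1 - \<eta>\<^sup>2))) \<le> (s / \<gamma>) * T\<^sup>2 * r"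
    by simp
  have "36/25 * (L * (31/30 * A0) * t\<^sup>2)\<^sup>2 \<le> 132 * (L * s)\<^sup>2 * r"
  proof -
    have "A0 \<le> X + Y" using s XY(2) s0 by (simp add: A0_def mult_left_le_one_le)
    then have "A0\<^sup>2 \<le> (X + Y)\<^sup>2" using XY s0 by (intro power_mono) (auto simp: A0_def)
    also have "\<dots> \<le> 2 * (X\<^sup>2 + Y\<^sup>2)"
      using zero_le_power2[of "X - Y"] by (simp add: power2_eq_square algebra_simps)
    finally have A0r: "A0\<^sup>2 \<le> 2 * r" by (rule order_trans) (use XY(3) in simp)
    \<comment> \<open>This leads to \<open>t ^ 4 \<le> s\<^sup>2\<close>; with
      \<open>36/25 * (31/30)\<^sup>2 = 34596/22500\<close> and the factor 2 from \<open>A0\<close>,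
      the result stays far below 132.\<close>
    have "t\<^sup>2 \<le> s\<^sup>2" using t s by (intro power_mono) auto
    also have "s\<^sup>2 \<le> s" using s s0 by (simp add: power2_eq_square mult_left_le)
    finally have "(t\<^sup>2)\<^sup>2 \<le> s\<^sup>2" by (intro power_mono) auto
    have "36/25 * (L * (31/30 * A0) * t\<^sup>2)\<^sup>2 = (34596/22500 * L\<^sup>2) * (A0\<^sup>2 * (t\<^sup>2)\<^sup>2)"
      by (simp add: power_mult_distrib power_divide)
    also have "\<dots> \<le> (34596/22500 * L\<^sup>2) * ((2 * r) * s\<^sup>2)"
      using A0r \<open>(t\<^sup>2)\<^sup>2 \<le> s\<^sup>2\<close> r by (intro mult_left_mono mult_mono) auto
    also have "\<dots> = 69192/22500 * ((L * s)\<^sup>2 * r)" by (simp add: power_mult_distrib)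
    also have "\<dots> \<le> 132 * ((L * s)\<^sup>2 * r)" using r by (intro mult_right_mono) auto
    finally show ?thesis by simp
  qed
  also have "\<dots> \<le> 132 * exp (4 * s / 3) * (L * s)\<^sup>2 * r"
    using s0 r by (intro mult_right_mono) auto
  finally have "36/25 * (L * (31/30 * A0) * t\<^sup>2)\<^sup>2 \<le> 132 * exp (4 * s / 3) * (L * s)\<^sup>2 * r" .
  with main have "(s / t + 5/4) * ((t * (A2 + 3 * (16/15 * A0)) + (1 - \<eta>\<^sup>2) * A1)\<^sup>2 / (2 * (1 - \<eta>\<^sup>2)))
    + 36/25 * (L * (31/30 * A0) * t\<^sup>2)\<^sup>2 \<le> 1 * (s / \<gamma> * T\<^sup>2 + 132 * exp (4 * s / 3) * (L * s)\<^sup>2) * r"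
    by (simp add: algebra_simps)
  also have "\<dots> \<le> c_star L \<eta> \<gamma> s * r"
    unfolding c_star_def T_def[symmetric] using r s0 \<gamma> by (intro mult_right_mono) auto
  finally show ?thesis by (simp only: \<gamma>_def)
qed

text \<open>\<open>t\<^sup>2 \<le> 1/16\<close> turns \<open>X / t + 8/15 * t * X\<close> into at
  most \<open>31/30 * X / t\<close>, so each of the first two squares is at most
  \<open>2 * r / t\<^sup>2\<close>. Their coefficients add up to 4, which is below 13, and 36/25 is
  below 5.\<close>

lemma one_step_cost_le:
  fixes t \<eta> X Y r :: real
  assumes t: "0 < t" "t \<le> 1/4" and \<eta>: "0 \<le> \<eta>" "\<eta> < 1"
    and XY: "0 \<le> X" "0 \<le> Y" "X\<^sup>2 + Y\<^sup>2 \<le> r" and L: "0 < L"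
  shows "(X / t + 8/15 * t * X + Y)\<^sup>2 / (2 * (1 - \<eta>\<^sup>2)) + \<eta>\<^sup>2 * (11/10 * X / t)\<^sup>2 / (2 * (1 - \<eta>\<^sup>2))
    + 36/25 * (L * X * t\<^sup>2)\<^sup>2 \<le> c_one L \<eta> t * r"
proof -
  have e: "0 < 1 - \<eta>\<^sup>2" "\<eta>\<^sup>2 \<le> 1" using \<eta> by (auto simp: power_less_one_iff abs_square_less_1 power_le_one)
  have r: "0 \<le> r" using XY(3) by (meson order_trans sum_power2_ge_zero)
  have Xr: "X\<^sup>2 \<le> r" using XY(3) by (smt (verit) zero_le_power2)
  have "X / t + 8/15 * t * X + Y \<le> (31/30 * X + 1/4 * Y) / t"
  proof -
    have "t * (t * X) \<le> 1/4 * (1/4 * X)" using t XY by (intro mult_mono) auto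
    moreover have "t * Y \<le> 1/4 * Y" using t XY by (intro mult_right_mono) auto
    ultimately have "(X / t + 8/15 * t * X + Y) * t \<le> 31/30 * X + 1/4 * Y"
      using t by (simp add: algebra_simps)
    then show ?thesis using t by (simp add: le_divide_eq)
  qed
  then have "(X / t + 8/15 * t * X + Y)\<^sup>2 \<le> ((31/30 * X + 1/4 * Y) / t)\<^sup>2"
    using t XY by (intro power_mono) auto
  also have "\<dots> = (31/30 * X + 1/4 * Y)\<^sup>2 / t\<^sup>2" by (rule power_divide)
  also have "\<dots> \<le> 2 * r / t\<^sup>2"
  proof (rule divide_right_mono)
    have "(31/30 * X + 1/4 * Y)\<^sup>2 \<le> ((31/30)\<^sup>2 + (1/4)\<^sup>2) * (X\<^sup>2 + Y\<^sup>2)"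
      by (rule cauchy_schwarz_two)
    also have "\<dots> \<le> 2 * (X\<^sup>2 + Y\<^sup>2)" by (intro mult_right_mono) (auto simp: power2_eq_square)
    finally have "(31/30 * X + 1/4 * Y)\<^sup>2 \<le> 2 * (X\<^sup>2 + Y\<^sup>2)" .
    then show "(31/30 * X + 1/4 * Y)\<^sup>2 \<le> 2 * r" by (rule order_trans) (use XY(3) in simp)
  qed simp
  finally have 1: "(X / t + 8/15 * t * X + Y)\<^sup>2 \<le> 2 * r / t\<^sup>2" .
  have "\<eta>\<^sup>2 * (11/10 * X / t)\<^sup>2 \<le> 1 * (2 * r / t\<^sup>2)"
  proof (intro mult_mono e)
    have "(11/10 * X / t)\<^sup>2 = 121/100 * X\<^sup>2 / t\<^sup>2" by (simp add: power_divide power_mult_distrib)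
    also have "\<dots> \<le> 2 * r / t\<^sup>2" using Xr r by (intro divide_right_mono) auto
    finally show "(11/10 * X / t)\<^sup>2 \<le> 2 * r / t\<^sup>2" .
  qed auto
  with 1 have "(X / t + 8/15 * t * X + Y)\<^sup>2 + \<eta>\<^sup>2 * (11/10 * X / t)\<^sup>2 \<le> 4 * r / t\<^sup>2" by simp
  also have "\<dots> \<le> 13 * r / t\<^sup>2" using r by (intro divide_right_mono) auto
  finally have "((X / t + 8/15 * t * X + Y)\<^sup>2 + \<eta>\<^sup>2 * (11/10 * X / t)\<^sup>2) / (2 * (1 - \<eta>\<^sup>2)) \<le> (13 * r / t\<^sup>2) / (2 * (1 - \<eta>\<^sup>2))"
    using e by (intro divide_right_mono) auto
  also have "\<dots> = 13 / (2 * t\<^sup>2 * (1 - \<eta>\<^sup>2)) * r" by simp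
  finally have 2: "(X / t + 8/15 * t * X + Y)\<^sup>2 / (2 * (1 - \<eta>\<^sup>2)) + \<eta>\<^sup>2 * (11/10 * X / t)\<^sup>2 / (2 * (1 - \<eta>\<^sup>2)) \<le> 13 / (2 * t\<^sup>2 * (1 - \<eta>\<^sup>2)) * r"
    by (simp add: add_divide_distrib)
  have "36/25 * (L * X * t\<^sup>2)\<^sup>2 = (36/25 * (L\<^sup>2 * t ^ 4)) * X\<^sup>2"
    by (simp add: power_mult_distrib flip: power_mult)
  also have "\<dots> \<le> (5 * (L\<^sup>2 * t ^ 4)) * r" using Xr r t by (intro mult_mono) auto
  finally have "(X / t + 8/15 * t * X + Y)\<^sup>2 / (2 * (1 - \<eta>\<^sup>2)) + \<eta>\<^sup>2 * (11/10 * X / t)\<^sup>2 / (2 * (1 - \<eta>\<^sup>2))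
    + 36/25 * (L * X * t\<^sup>2)\<^sup>2 \<le> 1 * (13 / (2 * t\<^sup>2 * (1 - \<eta>\<^sup>2)) + 5 * L\<^sup>2 * t ^ 4) * r"
    using 2 by (simp add: algebra_simps)
  also have "\<dots> \<le> c_one L \<eta> t * r"
    unfolding c_one_def using r t e by (intro mult_right_mono) auto
  finally show ?thesis .
qed

section \<open>Log-Harnack inequalities with explicit constants and the passage to entropy\<close>

context hmc
begin

lemma refresh_mono:
  fixes F G :: "(real^'d) \<times> (real^'d) \<Rightarrow> real"
  assumes F: "bounded_borel F" and G: "bounded_borel G" and le: "\<And>z. F z \<le> G z"
  shows "\<D> F z \<le> \<D> G z"
proof -
  have int: "integrable std_gaussian (\<lambda>x. h (fst z, \<eta> *\<^sub>R snd z + sqrt (1 - \<eta>\<^sup>2) *\<^sub>R x))"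
    if "bounded_borel h" for h :: "(real^'d) \<times> (real^'d) \<Rightarrow> real"
    by (rule G.bounded_borel_integrable[OF that]) (use affine_pair_measurable in simp)
  show ?thesis unfolding refresh_op_eq by (intro integral_mono int F G le)
qed

lemma Q_funpow_mono:
  assumes F: "bounded_borel F" and G: "bounded_borel G" and le: "\<And>z. F z \<le> G z"
  shows "(Q ^^ n) F z \<le> (Q ^^ n) G z"
proof (induction n arbitrary: z)
  case (Suc n)
  let ?F = "(Q ^^ n) F" and ?G = "(Q ^^ n) G"
  have b: "bounded_borel ?F" "bounded_borel ?G" using F G by (auto intro: bounded_borel_Q)
  have "\<D> ?F z \<le> \<D> ?G z" for z by (rule refresh_mono[OF b Suc.IH])
  then have "\<D> (flow_op U t (\<D> ?F)) z \<le> \<D> (flow_op U t (\<D> ?G)) z"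
    using b by (intro refresh_mono bounded_borel_flow bounded_borel_refresh) (auto simp: flow_op_def)
  then show ?case by (simp add: Q_eq[of ?F] Q_eq[of ?G])
qed (simp add: le)

lemma difference_norms:
  "(norm (fst z' - fst z))\<^sup>2 + (norm (\<eta> *\<^sub>R (snd z' - snd z)))\<^sup>2 \<le> (norm (z - z'))\<^sup>2" for z z' :: "(real^'d) \<times> (real^'d)"
proof -
  have "(norm (\<eta> *\<^sub>R (snd z' - snd z)))\<^sup>2 = \<eta>\<^sup>2 * (norm (snd z - snd z'))\<^sup>2"
    by (simp add: power_mult_distrib norm_minus_commute)
  also have "\<dots> \<le> (norm (snd z - snd z'))\<^sup>2" using \<eta>2 by (intro mult_left_le_one_le) auto
  finally show ?thesis by (simp add: norm_prod_def norm_minus_commute[of "fst z"])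
qed

text \<open>A single step consists of the exact matching alone, so the displacement contains the
  full \<open>norm (x' - x) / t\<close>; this is the origin of \<open>1 / t\<^sup>2\<close> in
  \<open>c_one\<close>.\<close>

lemma one_step_log_Harnack:
  assumes k: "between a b k" and a: "0 < a"
  shows "Q (\<lambda>z. ln (k z)) z \<le> ln (Q k z') + c_one L \<eta> t * (norm (z - z'))\<^sup>2"
proof -
  obtain x v where z: "z = (x, v)" by (cases z)
  obtain x' v' where z': "z' = (x', v')" by (cases z')
  let ?X = "norm (x' - x)" and ?Y = "norm (\<eta> *\<^sub>R (v' - v))"
  have W: "norm (steer t x x' p - p - \<eta> *\<^sub>R (v' - v)) \<le> ?X / t + 8/15 * t * ?X + ?Y" for p
  proof -
    have "steer t x x' p - p - \<eta> *\<^sub>R (v' - v) = (steer t x x' p - p + (1 / t) *\<^sub>R (x' - x)) - (1 / t) *\<^sub>R (x' - x) - \<eta> *\<^sub>R (v' - v)"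
      by simp
    then have "norm (steer t x x' p - p - \<eta> *\<^sub>R (v' - v)) \<le> norm (steer t x x' p - p + (1 / t) *\<^sub>R (x' - x)) + norm ((1 / t) *\<^sub>R (x' - x)) + ?Y"
      by (metis norm_diff_diff_le)
    moreover have "norm ((1 / t) *\<^sub>R (x' - x)) = ?X / t" using t by simp
    ultimately show ?thesis using steer_momentum[OF t, of x x' p] by linarith
  qed
  have "Q (\<lambda>z. ln (k z)) z \<le> ln (Q k z') + ((?X / t + 8/15 * t * ?X + ?Y)\<^sup>2 / (2 * (1 - \<eta>\<^sup>2))
      + \<eta>\<^sup>2 * (11/10 * ?X / t)\<^sup>2 / (2 * (1 - \<eta>\<^sup>2)) + 36/25 * (L * ?X * t\<^sup>2)\<^sup>2)"
    using final_step[OF k a W] unfolding z z' \<sigma>(2) by simp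
  also have "\<dots> \<le> ln (Q k z') + c_one L \<eta> t * (norm (z - z'))\<^sup>2"
    using difference_norms[of z' z] by (intro add_left_mono one_step_cost_le t \<eta> L) (simp_all add: z z')
  finally show ?thesis .
qed

text \<open>The path given by \<open>hermite_plan\<close> starts at the initial position difference,
  and its initial slope is the velocity difference as contracted by the first refreshment.\<close>

lemma many_step_log_Harnack:
  assumes k: "between a b k" and a: "0 < a" and N: "2 \<le> N" "real N * t \<le> 1/4" and \<eta>0: "0 < \<eta>"
  shows "(Q ^^ N) (\<lambda>z. ln (k z)) z \<le> ln ((Q ^^ N) k z') + c_star L \<eta> ((1 - \<eta>) / t) (real N * t) * (norm (z - z'))\<^sup>2"
proof -
  define \<alpha> where "\<alpha> = fst z' - fst z"
  define \<beta> where "\<beta> = \<eta> *\<^sub>R (snd z' - snd z)"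
  define s where "s = real N * t"
  let ?A0 = "norm \<alpha> + s * norm \<beta>" and ?A1 = "3/2 / s * norm \<alpha> + norm \<beta>"
    and ?A2 = "6 / s\<^sup>2 * norm \<alpha> + 4 / s * norm \<beta>"
  have N1: "1 \<le> N" using N by simp
  obtain P S where PS: "P 0 = \<alpha>" "P N = 0" "S 0 = \<beta>"
    "\<And>j. j \<le> N \<Longrightarrow> norm (P j) \<le> ?A0"
    "\<And>j. j < N \<Longrightarrow> P (Suc j) = P j + t *\<^sub>R S (Suc j)"
    "\<And>j. j \<le> N \<Longrightarrow> norm (S j) \<le> ?A1"
    "\<And>j. j < N \<Longrightarrow> norm (S (Suc j) - S j) \<le> t * ?A2"
    "norm (S N) \<le> t * ?A2"
    using hermite_plan[OF N1, of \<alpha> \<beta>] unfolding s_def by blast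
  have "(Q ^^ N) (\<lambda>z. ln (k z)) z \<le> ln ((Q ^^ N) k z')
      + (real N + 5/4) * ((t * (?A2 + 3 * (16/15 * ?A0)) + \<sigma>\<^sup>2 * ?A1)\<^sup>2 / (2 * \<sigma>\<^sup>2))
      + 36/25 * (L * (31/30 * ?A0) * t\<^sup>2)\<^sup>2"
    by (rule steering_log_Harnack[OF k a N1 PS(4) PS(2) PS(5,6,7,8)]) (simp_all add: PS \<alpha>_def \<beta>_def)
  moreover have "real N = s / t" using t by (simp add: s_def)
  moreover have "(s / t + 5/4) * ((t * (?A2 + 3 * (16/15 * ?A0)) + (1 - \<eta>\<^sup>2) * ?A1)\<^sup>2 / (2 * (1 - \<eta>\<^sup>2)))
      + 36/25 * (L * (31/30 * ?A0) * t\<^sup>2)\<^sup>2 \<le> c_star L \<eta> ((1 - \<eta>) / t) s * (norm (z - z'))\<^sup>2"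
  proof (rule steering_cost_le[OF t(1) \<eta>0 \<eta>(2)])
    show "2 * t \<le> s" using N t by (simp add: s_def mult_right_mono)
    show "s \<le> 1/4" using N by (simp add: s_def)
    show "(norm \<alpha>)\<^sup>2 + (norm \<beta>)\<^sup>2 \<le> (norm (z - z'))\<^sup>2"
      unfolding \<alpha>_def \<beta>_def by (rule difference_norms)
  qed (use L in auto)
  ultimately show ?thesis unfolding \<sigma>(2) s_def[symmetric] by (simp only:)
qed

lemma coupling_measurable:
  assumes r: "r \<in> couplings \<nu> \<mu>" and \<nu>: "sets \<nu> = sets borel"
  shows "fst \<in> measurable r \<nu>" "snd \<in> measurable r \<mu>" "fst \<in> borel_measurable r" "snd \<in> borel_measurable r"
proof -
  have s: "sets r = sets (\<nu> \<Otimes>\<^sub>M \<mu>)" using r by (simp add: couplings_def)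
  show 1: "fst \<in> measurable r \<nu>" "snd \<in> measurable r \<mu>"
    using measurable_fst[of \<nu> \<mu>] measurable_snd[of \<nu> \<mu>] measurable_cong_sets[OF s refl] by blast+
  show "fst \<in> borel_measurable r" "snd \<in> borel_measurable r"
    using 1 measurable_cong_sets[OF refl \<nu>] measurable_cong_sets[OF refl sets_\<mu>] by blast+
qed

text \<open>Integrating the pointwise inequality along a coupling and using the invariance of \<open>\<mu>\<close> gives the
  variational bound that characterises the entropy.\<close>

lemma Ent_le_coupling_cost:
  assumes LH: "\<And>a b k z z'. between a b k \<Longrightarrow> 0 < a \<Longrightarrow>
      (Q ^^ n) (\<lambda>z. ln (k z)) z \<le> ln ((Q ^^ n) k z') + c * (norm (z - z'))\<^sup>2"
    and \<nu>: "prob_space \<nu>" "sets \<nu> = sets borel" and r: "r \<in> couplings \<nu> \<mu>"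
    and I: "(\<integral>\<^sup>+p. ennreal ((norm (fst p - snd p))\<^sup>2) \<partial>r) = ennreal I" "0 \<le> I"
  shows "Ent (markov_act \<nu> (Q ^^ n)) \<mu> \<le> ereal (c * I)"
proof (rule Ent_le_of_variational)
  note act = markov_act[OF is_markov_funpow[OF is_markov_Q, of n] \<nu>]
  note meas = coupling_measurable[OF r \<nu>(2)]
  show "prob_space \<mu>" by (rule \<mu>.prob_space_axioms)
  show "prob_space (markov_act \<nu> (Q ^^ n))" by (rule act(1))
  show "sets (markov_act \<nu> (Q ^^ n)) = sets \<mu>" unfolding act(2) sets_\<mu> ..
  have marg: "distr r \<nu> fst = \<nu>" "distr r \<mu> snd = \<mu>" using r by (auto simp: couplings_def)
  \<comment> \<open>\<open>couplings\<close> does not ask for total mass 1; the first marginal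
    forces it.\<close>
  interpret R: prob_space r
    using \<nu>(1) marg(1) prob_space_distrD[OF meas(1)] by simp
  fix f :: "(real^'d) \<times> (real^'d) \<Rightarrow> real" and B
  assume "f \<in> borel_measurable \<mu>" and fB: "\<And>z. \<bar>f z\<bar> \<le> B"
  then have fm: "f \<in> borel_measurable borel" using measurable_cong_sets[OF sets_\<mu> refl] by blast
  have bf: "bounded_borel f" by (rule bounded_borelI[OF fm fB])
  define k where "k z = exp (f z)" for z
  have k: "between (exp (- B)) (exp B) k"
    unfolding between_def k_def using fm fB by (auto simp: abs_le_iff minus_le_iff simp del: split_paired_All)
  have fk: "f = (\<lambda>z. ln (k z))" by (simp add: k_def)
  have Qk: "between (exp (- B)) (exp B) ((Q ^^ n) k)" by (rule between_Q_funpow[OF k])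
  have bQf: "bounded_borel ((Q ^^ n) f)" by (rule bounded_borel_Q[OF bf])
  have blQk: "bounded_borel (\<lambda>z. ln ((Q ^^ n) k z))" by (rule between_bounded_borel[OF between_ln[OF exp_gt_zero Qk]])
  have cost: "has_bochner_integral r (\<lambda>p. (norm (fst p - snd p))\<^sup>2) I"
    by (rule has_bochner_integral_nn_integral) (use I meas(3,4) in \<open>auto intro!: borel_measurable_power borel_measurable_norm borel_measurable_diff\<close>)
  have i1: "integrable r (\<lambda>p. (Q ^^ n) f (fst p))" by (rule R.bounded_borel_integrable[OF bQf meas(3)])
  have i2: "integrable r (\<lambda>p. ln ((Q ^^ n) k (snd p)))" by (rule R.bounded_borel_integrable[OF blQk meas(4)])
  have "(\<integral>z. f z \<partial>markov_act \<nu> (Q ^^ n)) = (\<integral>z. (Q ^^ n) f z \<partial>distr r \<nu> fst)"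
    unfolding act(3)[OF bf] marg(1) ..
  also have "\<dots> = (\<integral>p. (Q ^^ n) f (fst p) \<partial>r)"
    by (rule integral_distr[OF meas(1)]) (use bounded_borel_measurable[OF bQf] measurable_cong_sets[OF \<nu>(2) refl] in blast)
  also have "\<dots> \<le> (\<integral>p. ln ((Q ^^ n) k (snd p)) + c * (norm (fst p - snd p))\<^sup>2 \<partial>r)"
  proof (rule integral_mono[OF i1])
    show "(Q ^^ n) f (fst p) \<le> ln ((Q ^^ n) k (snd p)) + c * (norm (fst p - snd p))\<^sup>2" for p
      unfolding fk by (rule LH[OF k exp_gt_zero])
  qed (use i2 cost in \<open>auto simp: has_bochner_integral_iff\<close>)
  also have "\<dots> = (\<integral>p. ln ((Q ^^ n) k (snd p)) \<partial>r) + c * I"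
    using i2 cost by (simp add: has_bochner_integral_iff)
  also have "(\<integral>p. ln ((Q ^^ n) k (snd p)) \<partial>r) = (\<integral>z. ln ((Q ^^ n) k z) \<partial>distr r \<mu> snd)"
    by (rule integral_distr[OF meas(2), symmetric]) (rule \<mu>_measurable[OF bounded_borel_measurable[OF blQk]])
  also have "\<dots> = (\<integral>z. ln ((Q ^^ n) k z) \<partial>\<mu>)" unfolding marg(2) ..
  also have "\<dots> \<le> ln (\<integral>z. (Q ^^ n) k z \<partial>\<mu>)"
  proof (rule \<mu>.jensen_ln(1)[OF _ exp_gt_zero])
    show "(Q ^^ n) k \<in> borel_measurable \<mu>" by (rule \<mu>_measurable) (use Qk in \<open>simp add: between_def\<close>)
    show "exp (- B) \<le> (Q ^^ n) k z" "(Q ^^ n) k z \<le> exp B" for z using Qk by (simp_all add: between_def del: split_paired_All)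
  qed
  also have "(\<integral>z. (Q ^^ n) k z \<partial>\<mu>) = (\<integral>z. exp (f z) \<partial>\<mu>)"
    using integral_\<mu>_Q[OF between_bounded_borel[OF k]] by (simp add: k_def)
  finally show "(\<integral>z. f z \<partial>markov_act \<nu> (Q ^^ n)) \<le> c * I + ln (\<integral>z. exp (f z) \<partial>\<mu>)" by simp
qed

lemma Ent_le_W2:
  assumes LH: "\<And>a b k z z'. between a b k \<Longrightarrow> 0 < a \<Longrightarrow>
      (Q ^^ n) (\<lambda>z. ln (k z)) z \<le> ln ((Q ^^ n) k z') + c * (norm (z - z'))\<^sup>2"
    and c: "0 < c" and \<nu>: "prob_space \<nu>" "sets \<nu> = sets borel"
  shows "Ent (markov_act \<nu> (Q ^^ n)) \<mu> \<le> ereal c * enn2ereal (W2_sq \<nu> \<mu>)"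
proof (cases "W2_sq \<nu> \<mu> = \<infinity>")
  \<comment> \<open>Positivity of \<open>c\<close> matters here: in \<open>ereal\<close>, zero times
    infinity is 0.\<close>
  case True
  then show ?thesis using c by simp
next
  case False
  then obtain w where w: "W2_sq \<nu> \<mu> = ennreal w" "0 \<le> w" by (cases "W2_sq \<nu> \<mu>") auto
  \<comment> \<open>A coupling whose cost is within \<open>e / c\<close> of the infimum is used, so
    no optimal coupling has to exist.\<close>
  have "Ent (markov_act \<nu> (Q ^^ n)) \<mu> \<le> ereal (c * w) + ereal e" if e: "0 < e" for e
  proof -
    have "W2_sq \<nu> \<mu> < ennreal (w + e / c)" using w e c by (simp add: ennreal_less_iff)
    then obtain r where r: "r \<in> couplings \<nu> \<mu>" "(\<integral>\<^sup>+p. ennreal ((norm (fst p - snd p))\<^sup>2) \<partial>r) < ennreal (w + e / c)"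
      unfolding W2_sq_def INF_less_iff by blast
    then obtain I where I: "(\<integral>\<^sup>+p. ennreal ((norm (fst p - snd p))\<^sup>2) \<partial>r) = ennreal I" "0 \<le> I"
      by (cases "\<integral>\<^sup>+p. ennreal ((norm (fst p - snd p))\<^sup>2) \<partial>r") auto
    have "I < w + e / c" using r(2) I by (simp add: ennreal_less_iff)
    then have "c * I \<le> c * w + e" using c by (simp add: field_simps)
    then have le: "ereal (c * I) \<le> ereal (c * w) + ereal e" by simp
    have "Ent (markov_act \<nu> (Q ^^ n)) \<mu> \<le> ereal (c * I)"
    proof (rule Ent_le_coupling_cost[where n=n and c=c and I=I and r=r])
      fix a b k z z' assume "between a b k" "0 < a"
      then show "(Q ^^ n) (\<lambda>z. ln (k z)) z \<le> ln ((Q ^^ n) k z') + c * (norm (z - z'))\<^sup>2" by (rule LH)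
    qed (fact \<nu> r(1) I)+
    then show ?thesis using le by (rule order_trans)
  qed
  then have "Ent (markov_act \<nu> (Q ^^ n)) \<mu> \<le> ereal (c * w)" by (rule ereal_le_epsilon2)
  then show ?thesis by (simp add: w enn2ereal_ennreal)
qed

end

lemma c_one_pos:
  assumes "0 < t" "0 \<le> \<eta>" "\<eta> < 1"
  shows "0 < c_one L \<eta> t"
proof -
  have "\<eta>\<^sup>2 < 1" using assms by (simp add: power_less_one_iff abs_square_less_1)
  then have "0 < 13 / (2 * t\<^sup>2 * (1 - \<eta>\<^sup>2))" using assms by simp
  then have "0 < 13 / (2 * t\<^sup>2 * (1 - \<eta>\<^sup>2)) + 5 * L\<^sup>2 * t ^ 4" using assms by (intro add_pos_nonneg) auto
  then show ?thesis unfolding c_one_def by (intro mult_pos_pos) auto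
qed

lemma c_star_pos:
  assumes "0 < s" "0 < L" "0 < \<gamma>"
  shows "0 < c_star L \<eta> \<gamma> s"
proof -
  have "0 < 132 * exp (4 * s / 3) * (L * s)\<^sup>2" using assms by simp
  moreover have "0 \<le> s / \<gamma> * (12 / (\<eta> * s\<^sup>2) + 6 * \<gamma> / (\<eta> * s) + 4)\<^sup>2"
    using assms by (intro mult_nonneg_nonneg) auto
  ultimately show ?thesis unfolding c_star_def by (intro mult_pos_pos add_nonneg_pos) auto
qed

theorem theorem2:
  fixes U :: "real ^ 'd \<Rightarrow> real" and t \<eta> L\<^sub>H :: real
    and \<mu> :: "((real ^ 'd) \<times> (real ^ 'd)) measure"
  assumes t: "0 < t" "t \<le> 1 / 4"
    and \<eta>: "0 \<le> \<eta>" "\<eta> < 1"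
    and C2: "C2 U"
    and prob: "prob_space (gibbs U)"
    and hess_bound: "\<And>x. operator_norm (hessian U x) \<le> 1"
    and L\<^sub>H: "0 < L\<^sub>H"
    and hess_Lipschitz:
      "\<And>x x'. frobenius_norm (hessian U x - hessian U x') \<le> L\<^sub>H * norm (x - x')"
    and \<mu>: "\<mu> = gibbs U \<Otimes>\<^sub>M std_gaussian"
  shows "(\<forall>\<nu>. prob_space \<nu> \<and> sets \<nu> = sets borel \<longrightarrow>
            Ent (markov_act \<nu> (hmc_op U \<eta> t)) \<mu> \<le> ereal (c_one L\<^sub>H \<eta> t) * enn2ereal (W2_sq \<nu> \<mu>))
       \<and> (0 < \<eta> \<and> t \<le> 1 / 8 \<longrightarrow>
            (\<forall>\<nu>. \<forall>n\<ge>2. prob_space \<nu> \<and> sets \<nu> = sets borel \<longrightarrow>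
               Ent (markov_act \<nu> (hmc_op U \<eta> t ^^ n)) \<mu>
                 \<le> ereal (c_n L\<^sub>H \<eta> t n) * enn2ereal (W2_sq \<nu> \<mu>)))"
proof (intro conjI allI impI)
  interpret hmc U L\<^sub>H t \<eta>
    by (intro hmc.intro potential.intro hmc_axioms.intro) (fact t \<eta> C2 prob hess_bound L\<^sub>H hess_Lipschitz)+
  let ?Q = "hmc_op U \<eta> t"
  show "Ent (markov_act \<nu> ?Q) \<mu> \<le> ereal (c_one L\<^sub>H \<eta> t) * enn2ereal (W2_sq \<nu> \<mu>)"
    if \<nu>: "prob_space \<nu> \<and> sets \<nu> = sets borel" for \<nu>
    using Ent_le_W2[of 1 "c_one L\<^sub>H \<eta> t" \<nu>] one_step_log_Harnack c_one_pos[OF t(1) \<eta>] \<nu>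
    unfolding \<mu> by simp
  fix \<nu> :: "((real ^ 'd) \<times> (real ^ 'd)) measure" and n :: nat
  assume \<eta>t: "0 < \<eta> \<and> t \<le> 1 / 8" and n: "2 \<le> n" and \<nu>: "prob_space \<nu> \<and> sets \<nu> = sets borel"
  \<comment> \<open>The number of steering steps that fit into the time 1/4; as
    \<open>t \<le> 1/8\<close>, there are at least two.\<close>
  define N where "N = nat (min (int n) \<lfloor>1 / (4 * t)\<rfloor>)"
  have fl: "2 \<le> \<lfloor>1 / (4 * t)\<rfloor>" using \<eta>t t by (simp add: le_floor_iff le_divide_eq)
  have "0 \<le> min (int n) \<lfloor>1 / (4 * t)\<rfloor>" using fl n by linarith
  then have iN: "int N = min (int n) \<lfloor>1 / (4 * t)\<rfloor>" by (simp only: N_def nat_0_le)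
  have N: "2 \<le> N" "N \<le> n" using fl n iN by linarith+
  have "real N \<le> 1 / (4 * t)" using iN by linarith
  then have Nt: "real N * t \<le> 1/4" using t by (simp add: field_simps)
  have cn: "c_n L\<^sub>H \<eta> t n = c_star L\<^sub>H \<eta> ((1 - \<eta>) / t) (real N * t)"
    unfolding c_n_def iN[symmetric] by (simp add: mult.commute)
  have "0 < c_n L\<^sub>H \<eta> t n"
    unfolding cn using N t \<eta> L\<^sub>H by (intro c_star_pos) auto
  moreover have "(?Q ^^ n) (\<lambda>z. ln (k z)) z \<le> ln ((?Q ^^ n) k z') + c_n L\<^sub>H \<eta> t n * (norm (z - z'))\<^sup>2"
    if k: "between a b k" and a: "0 < a" for a b k z z'
  proof -
    \<comment> \<open>The \<open>m\<close> surplus steps come after the first \<open>N\<close> in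
      time, so they are the inner power; Jensen's inequality moves them inside the logarithm at no
      cost.\<close>
    define m where "m = n - N"
    have nm: "n = N + m" using N by (simp add: m_def)
    have "(?Q ^^ n) (\<lambda>z. ln (k z)) z = (?Q ^^ N) ((?Q ^^ m) (\<lambda>z. ln (k z))) z" by (simp add: nm funpow_add)
    also have "\<dots> \<le> (?Q ^^ N) (\<lambda>z. ln ((?Q ^^ m) k z)) z"
      by (intro Q_funpow_mono bounded_borel_Q between_bounded_borel[OF between_ln[OF a k]]
          between_bounded_borel[OF between_ln[OF a between_Q_funpow[OF k]]] Q_jensen[OF k a])
    also have "\<dots> \<le> ln ((?Q ^^ N) ((?Q ^^ m) k) z') + c_n L\<^sub>H \<eta> t n * (norm (z - z'))\<^sup>2"
      unfolding cn using \<eta>t by (intro many_step_log_Harnack[OF between_Q_funpow[OF k] a N(1) Nt]) auto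
    also have "(?Q ^^ N) ((?Q ^^ m) k) = (?Q ^^ n) k" by (simp add: nm funpow_add)
    finally show ?thesis .
  qed
  ultimately show "Ent (markov_act \<nu> (?Q ^^ n)) \<mu> \<le> ereal (c_n L\<^sub>H \<eta> t n) * enn2ereal (W2_sq \<nu> \<mu>)"
    unfolding \<mu> using \<nu> by (intro Ent_le_W2) auto
qed

end
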